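(* Let $n\in\mathbb{N}$, $m\in\mathbb{N}_0$, $1\le p<\infty$, and $-1<a<p(m+1)-1$. Suppose that $f\in\dot B^{m+1-(a+1)/p,\,p}(\mathbb{R}^n)$ and let $$u(x,t):=(W_t*f)(x)=\int_{\mathbb{R}^n}W_t(x-y)f(y)\,dy,\qquad W_t(x):=\frac{\exp(-|x|^2/(4t^2))}{(4\pi t^2)^{n/2}},\qquad (x,t)\in\mathbb{R}^n\times(0,\infty).$$ Then $$\int_{\mathbb{R}^{n+1}_+}t^a|\nabla^{m+1}u(x,t)|^p\,dx\,dt\le C\,|f|^p_{B^{m+1-(a+1)/p,\,p}(\mathbb{R}^n)},$$ where $C>0$ is a constant depending only on $n,m,a,p$ (not on $f$).
   Context: $\mathbb{N}_0=\{0,1,2,\dots\}$, $\mathbb{N}=\{1,2,\dots\}$, $\mathbb{R}^{n+1}_+=\mathbb{R}^n\times(0,\infty)$ with points $(x,t)$. $\nabla^{k}u$ is the tensor of all partial derivatives of order $k$ of $u$ jointly in $(x,t)$. Differences: $\Delta_hf(x)=f(x+h)-f(x)$, $\Delta_h^{k+1}f=\Delta_h^k(\Delta_hf)$. Homogeneous Besov spaces, for $1\le p<\infty$. For $0<s\le1$, $\dot B^{s,p}(\mathbb{R}^n)$ is the set of $f\in L^p_{\mathrm{loc}}(\mathbb{R}^n)$ with $$|f|_{B^{s,p}(\mathbb{R}^n)}:=\Big(\int_{\mathbb{R}^n}\|\Delta_h^{\lfloor s\rfloor+1}f\|_{L^p(\mathbb{R}^n)}^p\frac{dh}{|h|^{n+sp}}\Big)^{1/p}<\infty$$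 (so first differences are used if $0<s<1$ and second differences if $s=1$). For $s>1$ let $\ell=\max\{j\in\mathbb{N}: j<s\}$; $\dot B^{s,p}(\mathbb{R}^n)$ is the set of $f\in W^{\ell,p}_{\mathrm{loc}}(\mathbb{R}^n)$ such that $\frac{\partial^\alpha f}{\partial x^\alpha}\in\dot B^{s-\ell,p}(\mathbb{R}^n)$ for all multi-indices $\alpha\in\mathbb{N}_0^n$ with $|\alpha|=\ell$, with seminorm $|f|_{B^{s,p}(\mathbb{R}^n)}:=\sum_{|\alpha|=\ell}\big|\frac{\partial^\alpha f}{\partial x^\alpha}\big|_{B^{s-\ell,p}(\mathbb{R}^n)}$. *)

theory Defs
  imports "HOL-Analysis.Analysis"
begin

section \<open>Classical partial derivatives\<close>

definition partial :: "'a::euclidean_space \<Rightarrow> ('a \<Rightarrow> real) \<Rightarrow> 'a \<Rightarrow> real" where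
  "partial b f x = deriv (\<lambda>s. f (x + s *\<^sub>R b)) 0"

primrec partials :: "'a::euclidean_space list \<Rightarrow> ('a \<Rightarrow> real) \<Rightarrow> 'a \<Rightarrow> real" where
  "partials [] f = f"
| "partials (b # bs) f = partial b (partials bs f)"

text \<open>
  Being of class \<open>C\<^sup>k\<close> on an open set. Since \<^const>\<open>deriv\<close> is a total function, existence of the
  partial derivatives has to be required separately.
\<close>

definition Ck_on :: "nat \<Rightarrow> ('a::euclidean_space \<Rightarrow> real) \<Rightarrow> 'a set \<Rightarrow> bool" where
  "Ck_on k f S \<longleftrightarrow>
     (\<forall>bs. set bs \<subseteq> Basis \<longrightarrow>
        (length bs \<le> k \<longrightarrow> continuous_on S (partials bs f)) \<and>
        (length bs < k \<longrightarrow>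
          (\<forall>b\<in>Basis. \<forall>x\<in>S. (\<lambda>s. partials bs f (x + s *\<^sub>R b)) differentiable (at 0))))"

text \<open>
  The Euclidean norm of the tensor of all partial derivatives of order \<open>k\<close>; its entries are indexed
  by the \<open>k\<close>-tuples of coordinate directions.
\<close>

definition grad_norm :: "nat \<Rightarrow> ('a::euclidean_space \<Rightarrow> real) \<Rightarrow> 'a \<Rightarrow> real" where
  "grad_norm k f x =
     sqrt (\<Sum>bs | set bs \<subseteq> Basis \<and> length bs = k. (partials bs f x)\<^sup>2)"

lemma finite_tensor_index:
  "finite {bs. set bs \<subseteq> (Basis :: 'a::euclidean_space set) \<and> length bs = k}"
  by (rule finite_lists_length_eq) simp

definition test_function :: "('a::euclidean_space \<Rightarrow> real) \<Rightarrow> bool" where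
  "test_function \<phi> \<longleftrightarrow> (\<forall>k. Ck_on k \<phi> UNIV) \<and> compact (closure {x. \<phi> x \<noteq> 0})"


section \<open>Local Lebesgue and Sobolev spaces\<close>

definition Lp_loc :: "real \<Rightarrow> ('a::euclidean_space \<Rightarrow> real) set" where
  "Lp_loc p = {f. f \<in> borel_measurable lebesgue \<and>
     (\<forall>K. compact K \<longrightarrow> (\<integral>\<^sup>+x\<in>K. ennreal (\<bar>f x\<bar> powr p) \<partial>lebesgue) < \<infinity>)}"

definition multi_order :: "('n::finite \<Rightarrow> nat) \<Rightarrow> nat" where
  "multi_order \<alpha> = (\<Sum>i\<in>UNIV. \<alpha> i)"

text \<open>
  The type \<open>'n\<close> has no canonical order, so for a multi-index \<open>\<alpha>\<close> the partial derivative
  of the smooth function \<open>\<phi>\<close> is taken along any list \<open>is\<close> of coordinates that contains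
  each \<open>i\<close> exactly \<open>\<alpha> i\<close> times; by Schwarz's theorem the choice of \<open>is\<close> is immaterial.
\<close>

definition has_weak_deriv ::
  "('n::finite \<Rightarrow> nat) \<Rightarrow> (real^'n \<Rightarrow> real) \<Rightarrow> (real^'n \<Rightarrow> real) \<Rightarrow> bool" where
  "has_weak_deriv \<alpha> f g \<longleftrightarrow> f \<in> Lp_loc 1 \<and> g \<in> Lp_loc 1 \<and>
     (\<forall>\<phi> is. test_function \<phi> \<and> (\<forall>i. count_list is i = \<alpha> i) \<longrightarrow>
        (LINT x|lebesgue. f x * partials (map (\<lambda>i. axis i 1) is) \<phi> x) =
        (-1) ^ multi_order \<alpha> * (LINT x|lebesgue. g x * \<phi> x))"

text \<open>A representative of the weak derivative, which is unique up to null sets.\<close>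

definition weak_deriv :: "('n::finite \<Rightarrow> nat) \<Rightarrow> (real^'n \<Rightarrow> real) \<Rightarrow> (real^'n \<Rightarrow> real)" where
  "weak_deriv \<alpha> f = (SOME g. has_weak_deriv \<alpha> f g)"

definition Wkp_loc :: "nat \<Rightarrow> real \<Rightarrow> (real^'n::finite \<Rightarrow> real) set" where
  "Wkp_loc k p = {f \<in> Lp_loc p.
     \<forall>\<alpha>. multi_order \<alpha> \<le> k \<longrightarrow> (\<exists>g\<in>Lp_loc p. has_weak_deriv \<alpha> f g)}"


section \<open>Homogeneous Besov spaces\<close>

text \<open>Powers on \<open>[0,\<infinity>]\<close>, meant for positive exponents only.\<close>

definition epowr :: "ennreal \<Rightarrow> real \<Rightarrow> ennreal" where
  "epowr x r = (if x = \<infinity> then \<infinity> else ennreal (enn2real x powr r))"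

definition Lp_norm :: "real \<Rightarrow> ('a::euclidean_space \<Rightarrow> real) \<Rightarrow> ennreal" where
  "Lp_norm p f = epowr (\<integral>\<^sup>+x. ennreal (\<bar>f x\<bar> powr p) \<partial>lebesgue) (1 / p)"

primrec fdiff :: "nat \<Rightarrow> 'a::euclidean_space \<Rightarrow> ('a \<Rightarrow> real) \<Rightarrow> 'a \<Rightarrow> real" where
  "fdiff 0 h f = f"
| "fdiff (Suc k) h f = fdiff k h (\<lambda>x. f (x + h) - f x)"

definition besov_seminorm_le1 :: "real \<Rightarrow> real \<Rightarrow> (real^'n::finite \<Rightarrow> real) \<Rightarrow> ennreal" where
  "besov_seminorm_le1 s p f =
     epowr (\<integral>\<^sup>+h. epowr (Lp_norm p (fdiff (nat \<lfloor>s\<rfloor> + 1) h f)) p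
                    / ennreal (norm h powr (real CARD('n) + s * p)) \<partial>lebesgue) (1 / p)"

definition besov_space_le1 :: "real \<Rightarrow> real \<Rightarrow> (real^'n::finite \<Rightarrow> real) set" where
  "besov_space_le1 s p = {f \<in> Lp_loc p. besov_seminorm_le1 s p f < \<infinity>}"

definition besov_order :: "real \<Rightarrow> nat" where
  "besov_order s = Max {j. 1 \<le> j \<and> real j < s}"

definition besov_space :: "real \<Rightarrow> real \<Rightarrow> (real^'n::finite \<Rightarrow> real) set" where
  "besov_space s p =
     (if s \<le> 1 then besov_space_le1 s p
      else {f \<in> Wkp_loc (besov_order s) p.
              \<forall>\<alpha>. multi_order \<alpha> = besov_order s \<longrightarrow>
                   weak_deriv \<alpha> f \<in> besov_space_le1 (s - real (besov_order s)) p})"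

definition besov_seminorm :: "real \<Rightarrow> real \<Rightarrow> (real^'n::finite \<Rightarrow> real) \<Rightarrow> ennreal" where
  "besov_seminorm s p f =
     (if s \<le> 1 then besov_seminorm_le1 s p f
      else (\<Sum>\<alpha> | multi_order \<alpha> = besov_order s.
              besov_seminorm_le1 (s - real (besov_order s)) p (weak_deriv \<alpha> f)))"

lemma finite_multi_order: "finite {\<alpha> :: 'n::finite \<Rightarrow> nat. multi_order \<alpha> = k}"
proof (rule finite_subset)
  show "{\<alpha> :: 'n \<Rightarrow> nat. multi_order \<alpha> = k} \<subseteq> PiE UNIV (\<lambda>_. {..k})"
    by (auto simp: multi_order_def intro!: member_le_sum)
  show "finite (PiE (UNIV :: 'n set) (\<lambda>_. {..k}))"
    by (rule finite_PiE) auto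
qed


section \<open>Convolution with the Gaussian kernel\<close>

definition gauss_kernel :: "real \<Rightarrow> real^'n::finite \<Rightarrow> real" where
  "gauss_kernel t x =
     exp (- (norm x)\<^sup>2 / (4 * t\<^sup>2)) / (4 * pi * t\<^sup>2) powr (real CARD('n) / 2)"

definition gauss_ext :: "(real^'n::finite \<Rightarrow> real) \<Rightarrow> (real^'n) \<times> real \<Rightarrow> real" where
  "gauss_ext f = (\<lambda>(x, t). LINT y|lebesgue. gauss_kernel t (x - y) * f y)"

definition half_space :: "((real^'n::finite) \<times> real) set" where
  "half_space = UNIV \<times> {0<..}"

end

theory Submission
  imports Defs "HOL-Real_Asymp.Real_Asymp"
begin

text \<open>
  All derivatives of the Gaussian extension \<open>u\<close> are combinations of \<open>t\<^sup>j U\<^sub>\<beta>\<close>, where \<open>U\<^sub>\<beta>\<close> is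
  the convolution with \<open>\<partial>\<^sup>\<beta> W\<^sub>t\<close> and \<open>\<bar>\<beta>\<bar> - j\<close> is the order: since \<open>W\<close> solves the heat equation in the
  variable \<open>t\<^sup>2\<close>, a time derivative is \<open>2 t\<close> times the Laplacian. If \<open>s > 1\<close> and \<open>l\<close> is the largest
  integer below \<open>s\<close>, then \<open>l\<close> of the derivatives in \<open>\<beta>\<close> can be moved to \<open>f\<close>, which reduces the claim to
  \<open>0 < s \<le> 1\<close>. There the kernel has mean zero, so \<open>U\<^sub>\<beta>\<close> is an average of first differences
  of \<open>f\<close>, and of second differences if \<open>\<bar>\<beta>\<bar>\<close> is even; Jensen's inequality, Tonelli's theorem and the scaling
  of the kernel give the bound. For \<open>s = 1\<close> and odd \<open>\<bar>\<beta>\<bar>\<close> the semigroup property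
  of the heat kernel removes one derivative first.

  Moving derivatives requires that \<open>f\<close> is integrable against every Gaussian. For \<open>s \<le> 1\<close> this follows from the
  finiteness of the seminorm at a single point; for \<open>s > 1\<close> it is passed down from the derivatives of order
  \<open>l\<close> to \<open>f\<close>, because \<open>f (x + e\<^sub>i) - f x\<close> is the average of \<open>\<partial>\<^sub>i f\<close> over a segment.
\<close>

section \<open>Derivatives of the Gaussian kernel\<close>

text \<open>For odd |\<beta>| the kernel is odd and annihilates the symmetric second difference, so
  averaging gives nothing at s = 1. Factoring the kernel at time sqrt 2 t into two kernels at time t
  leaves an even order, at least 2, on one factor; the single derivative on the other costs 1 / t in
  L^1, which a shift of the weight by p pays for. Membership in the space gives no growth bound
  outright. At a fixed x the second differences control only k (2 h) - 2 k h with k h = g (x + h) -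
  g x, and the unit differences of f do not bound f directly either. Both growth proofs bound an
  integral over a ball or cube by a constant plus half of the same integral; local integrability
  makes that integral finite, so it can be absorbed before the set grows. Kernels and test functions
  are products of functions of one coordinate, each given with the list of all its derivatives. A
  partial derivative is then an index shift in one factor, and mixed derivatives commute by
  construction. Such products still separate locally integrable functions, because they approximate
  indicators of boxes.\<close>

definition jet :: "(nat \<Rightarrow> real \<Rightarrow> real) \<Rightarrow> bool" where
  "jet A \<longleftrightarrow> (\<forall>k s. (A k has_real_derivative A (Suc k) s) (at s))"

lemma jetD: "jet A \<Longrightarrow> (A k has_real_derivative A (Suc k) s) (at s)"
  by (simp add: jet_def)

definition incr :: "'n \<Rightarrow> ('n \<Rightarrow> nat) \<Rightarrow> 'n \<Rightarrow> nat" where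
  "incr i \<beta> = \<beta>(i := Suc (\<beta> i))"

text \<open>If each D i lists a function of one variable together with its derivatives, this is the
  partial derivative of order \<beta> of the product function
  \<open>tensor D (\<lambda>_. 0)\<close>.\<close>

definition tensor :: "('n::finite \<Rightarrow> nat \<Rightarrow> real \<Rightarrow> real) \<Rightarrow> ('n \<Rightarrow> nat) \<Rightarrow> real^'n \<Rightarrow> real" where
  "tensor D \<beta> x = (\<Prod>i\<in>UNIV. D i (\<beta> i) (x $ i))"

lemma tensor_has_derivative_axis:
  fixes D :: "'n::finite \<Rightarrow> nat \<Rightarrow> real \<Rightarrow> real"
  assumes "jet (D i)"
  shows "((\<lambda>s. tensor D \<beta> (x + s *\<^sub>R axis i 1)) has_real_derivative tensor D (incr i \<beta>) (x + s *\<^sub>R axis i 1)) (at s)"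
proof -
  have e: "tensor D \<gamma> (x + s *\<^sub>R axis i 1) = D i (\<gamma> i) (x $ i + s) * (\<Prod>j\<in>UNIV - {i}. D j (\<gamma> j) (x $ j))" for s \<gamma>
    unfolding tensor_def by (subst prod.remove[of _ i]) (auto intro!: prod.cong simp: axis_def)
  have "((\<lambda>s. D i (\<beta> i) (x $ i + s)) has_real_derivative D i (Suc (\<beta> i)) (x $ i + s) * 1) (at s)"
    by (rule DERIV_chain2[where f = "D i (\<beta> i)", OF jetD[OF assms]])
      (auto intro!: derivative_eq_intros)
  from DERIV_cmult_right[OF this, of "\<Prod>j\<in>UNIV - {i}. D j (\<beta> j) (x $ j)"] show ?thesis
    by (simp add: e incr_def)
qed

text \<open>The derivatives of \<open>F v = exp (- v\<^sup>2 / 4) / sqrt (4 \<pi>)\<close>; the recursion is \<open>2 F' = - v F\<close> differentiated \<open>k + 1\<close> times.\<close>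

fun gauss_profile :: "nat \<Rightarrow> real \<Rightarrow> real" where
  "gauss_profile 0 v = exp (- v\<^sup>2 / 4) / sqrt (4 * pi)"
| "gauss_profile (Suc 0) v = - (v / 2) * gauss_profile 0 v"
| "gauss_profile (Suc (Suc k)) v = - (v * gauss_profile (Suc k) v + (real k + 1) * gauss_profile k v) / 2"

lemma gauss_profile_has_derivative: "(gauss_profile k has_real_derivative gauss_profile (Suc k) v) (at v)"
proof (induction k v rule: gauss_profile.induct)
  case (1 v)
  have "gauss_profile 0 = (\<lambda>v. exp (- v\<^sup>2 / 4) / sqrt (4 * pi))" by (rule ext) simp
  moreover have "((\<lambda>v. exp (- v\<^sup>2 / 4)) has_real_derivative - (v / 2) * exp (- v\<^sup>2 / 4)) (at v)"
    by (auto intro!: derivative_eq_intros)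
  from DERIV_cdivide[OF this, of "sqrt (4 * pi)"]
  have "((\<lambda>v. exp (- v\<^sup>2 / 4) / sqrt (4 * pi)) has_real_derivative gauss_profile (Suc 0) v) (at v)"
    by simp
  ultimately show ?case by (simp only:)
next
  case (2 v)
  have "gauss_profile (Suc 0) = (\<lambda>v. - (v / 2) * gauss_profile 0 v)" by (rule ext) simp
  moreover have "((\<lambda>v. - (v / 2) * gauss_profile 0 v) has_real_derivative gauss_profile (Suc (Suc 0)) v) (at v)"
    using 2 by (auto intro!: derivative_eq_intros simp del: gauss_profile.simps(1) simp: field_simps)
  ultimately show ?case by (simp only:)
next
  case (3 k v)
  have "gauss_profile (Suc (Suc k)) = (\<lambda>v. - (v * gauss_profile (Suc k) v + (real k + 1) * gauss_profile k v) / 2)"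
    by (rule ext) simp
  moreover have "((\<lambda>v. - (v * gauss_profile (Suc k) v + (real k + 1) * gauss_profile k v) / 2) has_real_derivative
      - (1 * gauss_profile (Suc k) v + gauss_profile (Suc (Suc k)) v * v + (real k + 1) * gauss_profile (Suc k) v) / 2) (at v)"
    by (rule DERIV_cdivide DERIV_minus DERIV_add DERIV_mult DERIV_ident DERIV_cmult 3)+
  \<comment> \<open>The product rule on v * F^(k+1) yields one further F^(k+1), so the coefficient k
    + 1 becomes k + 2: the recursion reproduces itself at the next index.\<close>
  moreover have "- (1 * gauss_profile (Suc k) v + gauss_profile (Suc (Suc k)) v * v + (real k + 1) * gauss_profile (Suc k) v) / 2
     = gauss_profile (Suc (Suc (Suc k))) v"
    by (subst gauss_profile.simps(3)[of "Suc k"]) (simp add: algebra_simps del: gauss_profile.simps)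
  ultimately show ?case by (simp only:)
qed

lemma continuous_on_gauss_profile [continuous_intros]:
  assumes "continuous_on S f"
  shows "continuous_on S (\<lambda>x. gauss_profile k (f x))"
proof -
  have "continuous_on UNIV (gauss_profile k)"
    by (rule continuous_at_imp_continuous_on) (blast intro: DERIV_isCont gauss_profile_has_derivative)
  then show ?thesis using assms by (rule continuous_on_compose2) auto
qed

lemma gauss_profile_bound_aux: "\<exists>C>0. \<forall>v. \<bar>gauss_profile k v\<bar> \<le> C * (1 + \<bar>v\<bar>) ^ k * exp (- v\<^sup>2 / 4)"
proof (induction k rule: induct_nat_012)
  case 0
  show ?case by (intro exI[of _ "1 / sqrt (4 * pi)"]) auto
next
  case 1
  show ?case
  proof (intro exI[of _ "1 / sqrt (4 * pi)"] conjI allI)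
    fix v :: real
    have "\<bar>v\<bar> / 2 * (exp (- v\<^sup>2 / 4) / sqrt (4 * pi)) \<le> (1 + \<bar>v\<bar>) * (exp (- v\<^sup>2 / 4) / sqrt (4 * pi))"
      by (intro mult_right_mono) auto
    then show "\<bar>gauss_profile (Suc 0) v\<bar> \<le> 1 / sqrt (4 * pi) * (1 + \<bar>v\<bar>) ^ Suc 0 * exp (- v\<^sup>2 / 4)"
      by (simp add: abs_mult)
  qed auto
next
  case (ge2 k)
  then obtain C D where C: "C > 0" "\<And>v. \<bar>gauss_profile k v\<bar> \<le> C * (1 + \<bar>v\<bar>) ^ k * exp (- v\<^sup>2 / 4)"
    and D: "D > 0" "\<And>v. \<bar>gauss_profile (Suc k) v\<bar> \<le> D * (1 + \<bar>v\<bar>) ^ Suc k * exp (- v\<^sup>2 / 4)" by blast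
  show ?case
  proof (intro exI[of _ "D + (real k + 1) * C"] conjI allI)
    show "D + (real k + 1) * C > 0" using C D by (simp add: add_pos_pos)
    fix v :: real
    let ?e = "exp (- v\<^sup>2 / 4)" and ?w = "1 + \<bar>v\<bar>"
    have "\<bar>gauss_profile (Suc (Suc k)) v\<bar> \<le> (\<bar>v\<bar> * \<bar>gauss_profile (Suc k) v\<bar> + (real k + 1) * \<bar>gauss_profile k v\<bar>) / 2"
    proof -
      have "\<bar>gauss_profile (Suc (Suc k)) v\<bar> = \<bar>v * gauss_profile (Suc k) v + (real k + 1) * gauss_profile k v\<bar> / 2"
        by (simp only: gauss_profile.simps abs_divide abs_minus_cancel abs_numeral)
      also have "\<dots> \<le> (\<bar>v * gauss_profile (Suc k) v\<bar> + \<bar>(real k + 1) * gauss_profile k v\<bar>) / 2"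
        by (intro divide_right_mono abs_triangle_ineq) auto
      finally show ?thesis by (simp add: abs_mult del: gauss_profile.simps)
    qed
    also have "\<dots> \<le> \<bar>v\<bar> * \<bar>gauss_profile (Suc k) v\<bar> + (real k + 1) * \<bar>gauss_profile k v\<bar>"
      by (simp add: add_nonneg_nonneg)
    also have "\<dots> \<le> ?w * (D * ?w ^ Suc k * ?e) + (real k + 1) * (C * ?w ^ Suc (Suc k) * ?e)"
    proof (intro add_mono mult_mono)
      have "\<bar>gauss_profile k v\<bar> \<le> C * ?w ^ k * ?e" by (rule C)
      \<comment> \<open>The weight 1 + |v| is at least 1, so both terms of the recursion can be
        brought to the power k + 2.\<close>
      also have "\<dots> \<le> C * ?w ^ Suc (Suc k) * ?e"
        using C(1) by (intro mult_right_mono mult_left_mono power_increasing) auto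
      finally show "\<bar>gauss_profile k v\<bar> \<le> C * ?w ^ Suc (Suc k) * ?e" .
    qed (use D in auto)
    finally show "\<bar>gauss_profile (Suc (Suc k)) v\<bar> \<le> (D + (real k + 1) * C) * ?w ^ Suc (Suc k) * ?e"
      by (simp add: algebra_simps)
  qed
qed

lemma poly_exp_bound: "\<exists>C>0. \<forall>v::real. (1 + \<bar>v\<bar>) ^ k * exp (- v\<^sup>2 / 8) \<le> C"
proof -
  have lim: "((\<lambda>v::real. (1 + v) ^ k * exp (- v\<^sup>2 / 8)) \<longlongrightarrow> 0) at_top"
    by real_asymp
  then have "eventually (\<lambda>v::real. (1 + v) ^ k * exp (- v\<^sup>2 / 8) < 1) at_top"
    by (rule order_tendstoD) simp
  then obtain M where M: "\<And>v. v \<ge> M \<Longrightarrow> (1 + v) ^ k * exp (- v\<^sup>2 / 8) < (1::real)"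
    by (auto simp: eventually_at_top_linorder)
  show ?thesis
  proof (intro exI[of _ "max 1 ((1 + \<bar>M\<bar>) ^ k)"] conjI allI)
    fix v :: real
    show "(1 + \<bar>v\<bar>) ^ k * exp (- v\<^sup>2 / 8) \<le> max 1 ((1 + \<bar>M\<bar>) ^ k)"
    proof (cases "\<bar>v\<bar> \<ge> M")
      case True
      then have "(1 + \<bar>v\<bar>) ^ k * exp (- v\<^sup>2 / 8) \<le> 1" using M[of "\<bar>v\<bar>"] by simp
      then show ?thesis by (rule max.coboundedI1)
    next
      case False
      then have "(1 + \<bar>v\<bar>) ^ k * exp (- v\<^sup>2 / 8) \<le> (1 + \<bar>M\<bar>) ^ k * 1"
        by (intro mult_mono power_mono) auto
      then show ?thesis by simp
    qed
  qed auto
qed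

text \<open>Write exp (-v^2 / 4) as the square of exp (-v^2 / 8); one factor absorbs the polynomial.
  This is the origin of the 8 in all later Gaussian bounds.\<close>

lemma gauss_profile_bound: "\<exists>C>0. \<forall>v. \<bar>gauss_profile k v\<bar> \<le> C * exp (- v\<^sup>2 / 8)"
proof -
  obtain C where C: "C > 0" "\<And>v. \<bar>gauss_profile k v\<bar> \<le> C * (1 + \<bar>v\<bar>) ^ k * exp (- v\<^sup>2 / 4)"
    using gauss_profile_bound_aux by blast
  obtain D where D: "D > 0" "\<And>v::real. (1 + \<bar>v\<bar>) ^ k * exp (- v\<^sup>2 / 8) \<le> D"
    using poly_exp_bound by blast
  show ?thesis
  proof (intro exI[of _ "C * D"] conjI allI)
    fix v :: real
    have "exp (- v\<^sup>2 / 4) = exp (- v\<^sup>2 / 8) * exp (- v\<^sup>2 / 8)" by (simp flip: exp_add)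
    then have "\<bar>gauss_profile k v\<bar> \<le> C * ((1 + \<bar>v\<bar>) ^ k * exp (- v\<^sup>2 / 8)) * exp (- v\<^sup>2 / 8)"
      using C(2)[of v] by (simp add: mult.assoc)
    also have "\<dots> \<le> C * D * exp (- v\<^sup>2 / 8)"
      using C D by (intro mult_right_mono mult_left_mono) auto
    finally show "\<bar>gauss_profile k v\<bar> \<le> C * D * exp (- v\<^sup>2 / 8)" .
  qed (use C D in auto)
qed

lemma gauss_profile_uminus: "gauss_profile k (- v) = (-1) ^ k * gauss_profile k v"
  by (induction k rule: induct_nat_012) (auto simp: field_simps)

text \<open>The k-th derivative in s of F (s / t) / t, with F the Gaussian profile: one power of t
  normalises, the other k come from the chain rule.\<close>

definition gauss_kernel_1d :: "nat \<Rightarrow> real \<Rightarrow> real \<Rightarrow> real" where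
  "gauss_kernel_1d k t s = gauss_profile k (s / t) / t ^ Suc k"

lemma gauss_kernel_1d_has_derivative:
  assumes "t \<noteq> 0"
  shows "(gauss_kernel_1d k t has_real_derivative gauss_kernel_1d (Suc k) t s) (at s)"
proof -
  have "((\<lambda>s. gauss_profile k (s / t) / t ^ Suc k) has_real_derivative gauss_profile (Suc k) (s / t) * (1 / t) / t ^ Suc k) (at s)"
    by (intro DERIV_cdivide DERIV_chain2[where f = "gauss_profile k"] gauss_profile_has_derivative) (rule DERIV_cdivide DERIV_ident)+
  moreover have "gauss_profile (Suc k) (s / t) * (1 / t) / t ^ Suc k = gauss_kernel_1d (Suc k) t s"
    using assms by (simp add: gauss_kernel_1d_def)
  ultimately show ?thesis by (simp add: gauss_kernel_1d_def[abs_def] del: gauss_profile.simps)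
qed

text \<open>The heat equation in the time variable \<open>t\<^sup>2\<close>.\<close>

lemma gauss_kernel_1d_has_derivative_time:
  assumes "t > 0"
  shows "((\<lambda>t. gauss_kernel_1d k t s) has_real_derivative 2 * t * gauss_kernel_1d (Suc (Suc k)) t s) (at t)"
proof -
  let ?u = "gauss_profile k (s / t)" and ?w = "gauss_profile (Suc k) (s / t)"
  have "((\<lambda>t. gauss_profile k (s / t)) has_real_derivative ?w * (- s / t\<^sup>2)) (at t)"
  proof (rule DERIV_chain2[where f = "gauss_profile k"])
    show "((\<lambda>t. s / t) has_real_derivative - s / t\<^sup>2) (at t)"
      using assms by (auto intro!: derivative_eq_intros simp: power2_eq_square)
  qed (rule gauss_profile_has_derivative)
  from DERIV_quotient[OF this DERIV_pow[of "Suc k"]]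
  have "((\<lambda>t. gauss_profile k (s / t) / t ^ Suc k) has_real_derivative
     (?w * (- s / t\<^sup>2) * t ^ Suc k - (1 + real k) * t ^ k * ?u) / (t ^ Suc k)\<^sup>2) (at t)"
    using assms by (simp add: numeral_2_eq_2 del: gauss_profile.simps)
  moreover have "(?w * (- s / t\<^sup>2) * t ^ Suc k - (1 + real k) * t ^ k * ?u) / (t ^ Suc k)\<^sup>2
      = 2 * t * gauss_kernel_1d (Suc (Suc k)) t s"
  proof -
    \<comment> \<open>u and w stand for the profile derivatives of orders k and k + 1 at s / t. The
      recursion expresses the one of order k + 2 by them, and its denominator 2 cancels the 2 of the
      heat equation.\<close>
    have "2 * t * (- (s / t * w + (real k + 1) * u) / 2 / t ^ Suc (Suc (Suc k)))
      = (w * (- s / t\<^sup>2) * t ^ Suc k - (1 + real k) * t ^ k * u) / (t ^ Suc k)\<^sup>2" for u w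
      using assms by (simp add: field_simps power2_eq_square)
    then show ?thesis by (simp only: gauss_kernel_1d_def gauss_profile.simps)
  qed
  ultimately show ?thesis by (simp only: gauss_kernel_1d_def[abs_def])
qed

lemma gauss_kernel_1d_uminus: "gauss_kernel_1d k t (- s) = (-1) ^ k * gauss_kernel_1d k t s"
  by (simp add: gauss_kernel_1d_def gauss_profile_uminus)

text \<open>The spatial derivative of order \<beta> of the kernel W at time t;
  \<open>gauss_deriv_eq_gauss_kernel\<close> identifies the case of order zero for t > 0.\<close>

definition gauss_deriv :: "('n::finite \<Rightarrow> nat) \<Rightarrow> real \<Rightarrow> real^'n \<Rightarrow> real" where
  "gauss_deriv \<beta> t = tensor (\<lambda>_ k. gauss_kernel_1d k t) \<beta>"

lemma gauss_deriv_eq: "gauss_deriv \<beta> t x = (\<Prod>i\<in>UNIV. gauss_kernel_1d (\<beta> i) t (x $ i))"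
  by (simp add: gauss_deriv_def tensor_def)

lemma multi_order_incr [simp]: "multi_order (incr i \<beta>) = Suc (multi_order \<beta>)"
  for \<beta> :: "'n::finite \<Rightarrow> nat"
  by (simp add: multi_order_def incr_def sum.remove[of _ i])

lemma norm_power2_vec: "(norm x)\<^sup>2 = (\<Sum>i\<in>UNIV. (x $ i)\<^sup>2)" for x :: "real^'n::finite"
  by (simp add: norm_vec_def L2_set_def sum_nonneg)

lemma gauss_deriv_eq_gauss_kernel:
  fixes x :: "real^'n::finite"
  assumes "t > 0"
  shows "gauss_deriv (\<lambda>_. 0) t x = gauss_kernel t x"
proof -
  have 1: "(4 * pi * t\<^sup>2) powr (real CARD('n) / 2) = (sqrt (4 * pi) * t) ^ CARD('n)"
  proof -
    have "(4 * pi * t\<^sup>2) powr (real CARD('n) / 2) = ((4 * pi * t\<^sup>2) powr (1/2)) powr real CARD('n)"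
      by (simp add: powr_powr)
    also have "(4 * pi * t\<^sup>2) powr (1/2) = sqrt (4 * pi) * t"
      using assms by (simp add: powr_half_sqrt real_sqrt_mult)
    also have "(sqrt (4 * pi) * t) powr real CARD('n) = (sqrt (4 * pi) * t) ^ CARD('n)"
      using assms by (intro powr_realpow) auto
    finally show ?thesis .
  qed
  have "gauss_deriv (\<lambda>_. 0) t x = (\<Prod>i\<in>UNIV. exp (- ((x $ i)\<^sup>2 / (4 * t\<^sup>2))) / (sqrt (4 * pi) * t))"
    unfolding gauss_deriv_eq by (intro prod.cong) (auto simp: gauss_kernel_1d_def power_divide field_simps)
  also have "\<dots> = exp (- (norm x)\<^sup>2 / (4 * t\<^sup>2)) / (sqrt (4 * pi) * t) ^ CARD('n)"
    by (simp add: prod_dividef flip: exp_sum)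
      (simp add: sum_negf norm_power2_vec sum_divide_distrib)
  finally show ?thesis by (simp add: gauss_kernel_def 1)
qed

text \<open>Coordinate i contributes t to the power -(1 + \<beta> i), which multiplies up to -(n +
  |\<beta>|). C is uniform in t, which the later integration over all times requires.\<close>

lemma gauss_deriv_bound:
  fixes \<beta> :: "'n::finite \<Rightarrow> nat"
  shows "\<exists>C>0. \<forall>t>0. \<forall>x. \<bar>gauss_deriv \<beta> t x\<bar> \<le> C / t ^ (CARD('n) + multi_order \<beta>) * exp (- (norm x)\<^sup>2 / (8 * t\<^sup>2))"
proof -
  have "\<forall>i. \<exists>C>0. \<forall>v. \<bar>gauss_profile (\<beta> i) v\<bar> \<le> C * exp (- v\<^sup>2 / 8)"
    using gauss_profile_bound by blast
  then obtain C where C: "\<And>i. C i > 0" "\<And>i v. \<bar>gauss_profile (\<beta> i) v\<bar> \<le> C i * exp (- v\<^sup>2 / 8)"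
    by metis
  show ?thesis
  proof (intro exI[of _ "\<Prod>i\<in>UNIV. C i"] conjI allI impI)
    show "0 < (\<Prod>i\<in>UNIV. C i)" by (intro prod_pos) (use C in auto)
    fix t :: real and x :: "real^'n" assume t: "t > 0"
    have "\<bar>gauss_deriv \<beta> t x\<bar> = (\<Prod>i\<in>UNIV. \<bar>gauss_kernel_1d (\<beta> i) t (x $ i)\<bar>)"
      unfolding gauss_deriv_eq by (rule abs_prod)
    also have "\<dots> \<le> (\<Prod>i\<in>UNIV. C i * exp (- (x $ i)\<^sup>2 / (8 * t\<^sup>2)) / t ^ Suc (\<beta> i))"
    proof (intro prod_mono conjI)
      fix i
      show "\<bar>gauss_kernel_1d (\<beta> i) t (x $ i)\<bar> \<le> C i * exp (- (x $ i)\<^sup>2 / (8 * t\<^sup>2)) / t ^ Suc (\<beta> i)"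
        using C(2)[of i "x $ i / t"] t
        by (simp add: gauss_kernel_1d_def divide_right_mono power_divide field_simps)
    qed auto
    also have "\<dots> = (\<Prod>i\<in>UNIV. C i) / t ^ (CARD('n) + multi_order \<beta>) * exp (- (norm x)\<^sup>2 / (8 * t\<^sup>2))"
      by (simp add: prod_dividef prod.distrib multi_order_def power_add power_sum flip: exp_sum)
        (simp add: sum_negf norm_power2_vec sum_divide_distrib)
    finally show "\<bar>gauss_deriv \<beta> t x\<bar> \<le> (\<Prod>i\<in>UNIV. C i) / t ^ (CARD('n) + multi_order \<beta>) * exp (- (norm x)\<^sup>2 / (8 * t\<^sup>2))" .
  qed
qed

text \<open>This parity decides whether the kernel can be paired with a symmetric second
  difference.\<close>

lemma gauss_deriv_uminus: "gauss_deriv \<beta> t (- x) = (-1) ^ multi_order \<beta> * gauss_deriv \<beta> t x"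
  by (simp add: gauss_deriv_eq gauss_kernel_1d_uminus prod.distrib multi_order_def power_sum)

lemma gauss_deriv_scale:
  fixes \<beta> :: "'n::finite \<Rightarrow> nat"
  assumes "t > 0"
  shows "gauss_deriv \<beta> t x = gauss_deriv \<beta> 1 ((1 / t) *\<^sub>R x) / t ^ (CARD('n) + multi_order \<beta>)"
  by (simp add: gauss_deriv_eq gauss_kernel_1d_def prod_dividef prod.distrib multi_order_def power_add power_sum)

lemma gauss_deriv_has_derivative_axis:
  fixes \<beta> :: "'n::finite \<Rightarrow> nat"
  assumes "t > 0"
  shows "((\<lambda>s. gauss_deriv \<beta> t (x + s *\<^sub>R axis i 1)) has_real_derivative gauss_deriv (incr i \<beta>) t (x + s *\<^sub>R axis i 1)) (at s)"
  unfolding gauss_deriv_def using assms by (intro tensor_has_derivative_axis) (simp add: jet_def gauss_kernel_1d_has_derivative)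

lemma has_real_derivative_prod:
  fixes f :: "'i \<Rightarrow> real \<Rightarrow> real"
  assumes "finite I" "\<And>i. i \<in> I \<Longrightarrow> (f i has_real_derivative f' i) (at t)"
  shows "((\<lambda>t. \<Prod>i\<in>I. f i t) has_real_derivative (\<Sum>i\<in>I. f' i * (\<Prod>j\<in>I - {i}. f j t))) (at t)"
  using assms
proof (induction I rule: finite_induct)
  case (insert k I)
  have "((\<lambda>t. f k t * (\<Prod>i\<in>I. f i t)) has_real_derivative
      f' k * (\<Prod>i\<in>I. f i t) + (\<Sum>i\<in>I. f' i * (\<Prod>j\<in>I - {i}. f j t)) * f k t) (at t)"
    using insert by (intro DERIV_mult) auto
  moreover have "(\<Sum>i\<in>I. f' i * (\<Prod>j\<in>I - {i}. f j t)) * f k t = (\<Sum>i\<in>I. f' i * (\<Prod>j\<in>insert k I - {i}. f j t))"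
    unfolding sum_distrib_right
  proof (intro sum.cong refl)
    fix i assume "i \<in> I"
    then have "insert k I - {i} = insert k (I - {i})" using insert by auto
    then show "f' i * (\<Prod>j\<in>I - {i}. f j t) * f k t = f' i * (\<Prod>j\<in>insert k I - {i}. f j t)"
      using insert by simp
  qed
  moreover have "insert k I - {k} = I" using insert by auto
  ultimately show ?case using insert by simp
qed auto

lemma gauss_deriv_has_derivative_time:
  fixes \<beta> :: "'n::finite \<Rightarrow> nat"
  assumes "t > 0"
  shows "((\<lambda>t. gauss_deriv \<beta> t x) has_real_derivative (\<Sum>i\<in>UNIV. 2 * t * gauss_deriv (incr i (incr i \<beta>)) t x)) (at t)"
proof -
  have "((\<lambda>t. gauss_deriv \<beta> t x) has_real_derivative
      (\<Sum>i\<in>UNIV. 2 * t * gauss_kernel_1d (Suc (Suc (\<beta> i))) t (x $ i) * (\<Prod>j\<in>UNIV - {i}. gauss_kernel_1d (\<beta> j) t (x $ j)))) (at t)"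
    unfolding gauss_deriv_eq using assms by (intro has_real_derivative_prod gauss_kernel_1d_has_derivative_time) auto
  moreover have "2 * t * gauss_kernel_1d (Suc (Suc (\<beta> i))) t (x $ i) * (\<Prod>j\<in>UNIV - {i}. gauss_kernel_1d (\<beta> j) t (x $ j))
     = 2 * t * gauss_deriv (incr i (incr i \<beta>)) t x" for i
    unfolding gauss_deriv_eq by (subst (2) prod.remove[of _ i]) (auto simp: incr_def)
  ultimately show ?thesis by simp
qed

lemma continuous_on_gauss_deriv:
  fixes \<beta> :: "'n::finite \<Rightarrow> nat" and g :: "'a::topological_space \<Rightarrow> real^'n"
  assumes "continuous_on S f" "continuous_on S g" "\<And>z. z \<in> S \<Longrightarrow> f z \<noteq> 0"
  shows "continuous_on S (\<lambda>z. gauss_deriv \<beta> (f z) (g z))"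
  unfolding gauss_deriv_eq gauss_kernel_1d_def using assms by (intro continuous_intros) auto

lemma gauss_profile_measurable [measurable]: "gauss_profile k \<in> borel_measurable borel"
  by (intro borel_measurable_continuous_onI continuous_intros)

lemma gauss_deriv_measurable [measurable (raw)]:
  fixes \<beta> :: "'n::finite \<Rightarrow> nat"
  assumes [measurable]: "f \<in> borel_measurable M" "g \<in> borel_measurable M"
  shows "(\<lambda>z. gauss_deriv \<beta> (f z) (g z)) \<in> borel_measurable M"
proof -
  have [measurable]: "(\<lambda>z. g z $ i) \<in> borel_measurable M" for i
  proof -
    have "(\<lambda>x::real^'n. x $ i) \<in> borel_measurable borel"
      by (intro borel_measurable_continuous_onI continuous_intros)
    from measurable_compose[OF assms(2) this] show ?thesis .
  qed
  show ?thesis unfolding gauss_deriv_eq gauss_kernel_1d_def by measurable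
qed

section \<open>The Gaussian extension and its partial derivatives\<close>

lemma nn_integral_lborel_affine:
  fixes t :: "'a::euclidean_space"
  assumes [measurable]: "f \<in> borel_measurable borel" and c: "c \<noteq> 0"
  shows "(\<integral>\<^sup>+x. f x \<partial>lborel) = ennreal (\<bar>c\<bar> ^ DIM('a)) * (\<integral>\<^sup>+x. f (t + c *\<^sub>R x) \<partial>lborel)"
  by (subst lborel_affine[OF c, of t])
    (simp add: nn_integral_density nn_integral_distr nn_integral_cmult)

lemma nn_integral_lborel_translation:
  fixes t :: "'a::euclidean_space"
  assumes [measurable]: "f \<in> borel_measurable borel"
  shows "(\<integral>\<^sup>+x. f (t + x) \<partial>lborel) = (\<integral>\<^sup>+x. f x \<partial>lborel)"
  using nn_integral_lborel_affine[OF assms, of 1 t] by simp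

lemma integrable_lborel_affine:
  fixes t :: "'a::euclidean_space" and f :: "'a \<Rightarrow> real"
  assumes f: "integrable lborel f" and c: "c \<noteq> 0"
  shows "integrable lborel (\<lambda>x. f (t + c *\<^sub>R x))"
proof -
  have [measurable]: "f \<in> borel_measurable borel" using f by (auto dest: borel_measurable_integrable)
  from f have "integrable (density (distr lborel borel (\<lambda>x. t + c *\<^sub>R x)) (\<lambda>_. \<bar>c\<bar> ^ DIM('a))) f"
    by (subst (asm) lborel_affine[OF c, of t])
  then have "integrable lborel (\<lambda>x. \<bar>c\<bar> ^ DIM('a) *\<^sub>R f (t + c *\<^sub>R x))"
    by (subst (asm) integrable_density) (auto simp: integrable_distr_eq)
  then have "integrable lborel (\<lambda>x. (1 / \<bar>c\<bar> ^ DIM('a)) * (\<bar>c\<bar> ^ DIM('a) * f (t + c *\<^sub>R x)))"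
    by (intro integrable_mult_right) simp
  then show ?thesis using c by simp
qed

lemma integral_lborel_affine:
  fixes t :: "'a::euclidean_space" and f :: "'a \<Rightarrow> real"
  assumes [measurable]: "f \<in> borel_measurable borel" and c: "c \<noteq> 0"
  shows "(\<integral>x. f x \<partial>lborel) = \<bar>c\<bar> ^ DIM('a) * (\<integral>x. f (t + c *\<^sub>R x) \<partial>lborel)"
  by (subst lborel_affine[OF c, of t]) (simp add: integral_density integral_distr)

text \<open>In a first countable space the limit can be tested along sequences. Domination and
  measurability hold only near z0, hence for a tail of the sequence, which explains the shift by
  N.\<close>

lemma tendsto_integral_dominated:
  fixes F :: "'b::first_countable_topology \<Rightarrow> 'a \<Rightarrow> real"
  assumes bound: "eventually (\<lambda>z. \<forall>y\<in>space M. \<bar>F z y\<bar> \<le> w y) (at z0 within S)"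
    and lim: "\<And>y. y \<in> space M \<Longrightarrow> ((\<lambda>z. F z y) \<longlongrightarrow> F0 y) (at z0 within S)"
    and w: "integrable M w" and meas: "eventually (\<lambda>z. F z \<in> borel_measurable M) (at z0 within S)"
    and meas0: "F0 \<in> borel_measurable M"
  shows "((\<lambda>z. \<integral>y. F z y \<partial>M) \<longlongrightarrow> (\<integral>y. F0 y \<partial>M)) (at z0 within S)"
  unfolding tendsto_at_iff_sequentially
proof (intro allI impI)
  fix X :: "nat \<Rightarrow> 'b" assume X: "\<forall>i. X i \<in> S - {z0}" "X \<longlonglongrightarrow> z0"
  have XF: "filterlim X (at z0 within S) sequentially"
    using X by (auto simp: filterlim_at)
  have "eventually (\<lambda>i. (\<forall>y\<in>space M. \<bar>F (X i) y\<bar> \<le> w y) \<and> F (X i) \<in> borel_measurable M) sequentially"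
    using filterlim_iff[THEN iffD1, OF XF, rule_format, OF bound]
      filterlim_iff[THEN iffD1, OF XF, rule_format, OF meas]
    by eventually_elim auto
  then obtain N where N: "\<And>i. i \<ge> N \<Longrightarrow> (\<forall>y\<in>space M. \<bar>F (X i) y\<bar> \<le> w y)"
    "\<And>i. i \<ge> N \<Longrightarrow> F (X i) \<in> borel_measurable M"
    by (auto simp: eventually_sequentially)
  have "(\<lambda>i. \<integral>y. F (X (i + N)) y \<partial>M) \<longlonglongrightarrow> (\<integral>y. F0 y \<partial>M)"
  proof (rule integral_dominated_convergence[OF _ _ w])
    show "AE y in M. (\<lambda>i. F (X (i + N)) y) \<longlonglongrightarrow> F0 y"
    proof (intro AE_I2)
      fix y assume "y \<in> space M"
      from filterlim_compose[OF lim[OF this] XF]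
      show "(\<lambda>i. F (X (i + N)) y) \<longlonglongrightarrow> F0 y" by (rule LIMSEQ_ignore_initial_segment)
    qed
  qed (use N meas0 in auto)
  then show "((\<lambda>z. \<integral>y. F z y \<partial>M) \<circ> X) \<longlonglongrightarrow> (\<integral>y. F0 y \<partial>M)"
    unfolding comp_def by (rule LIMSEQ_offset)
qed

lemma has_real_derivative_integral:
  fixes F :: "real \<Rightarrow> 'a \<Rightarrow> real"
  assumes d: "d > 0"
    and der: "\<And>s y. \<bar>s - s0\<bar> < d \<Longrightarrow> ((\<lambda>s. F s y) has_real_derivative F' s y) (at s)"
    and bound: "\<And>s y. \<bar>s - s0\<bar> < d \<Longrightarrow> \<bar>F' s y\<bar> \<le> w y"
    and w: "integrable M w" and int: "\<And>s. \<bar>s - s0\<bar> < d \<Longrightarrow> integrable M (F s)"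
    and meas: "F' s0 \<in> borel_measurable M"
  shows "((\<lambda>s. \<integral>y. F s y \<partial>M) has_real_derivative (\<integral>y. F' s0 y \<partial>M)) (at s0)"
  unfolding DERIV_def
proof (rule Lim_transform_eventually)
  have near: "eventually (\<lambda>h. h \<noteq> 0 \<and> \<bar>h\<bar> < d) (at (0::real))"
    using d by (auto simp: eventually_at dist_real_def)
  show "((\<lambda>h. \<integral>y. (F (s0 + h) y - F s0 y) / h \<partial>M) \<longlongrightarrow> (\<integral>y. F' s0 y \<partial>M)) (at 0)"
  proof (rule tendsto_integral_dominated[OF _ _ w _ meas])
    show "\<forall>\<^sub>F h in at 0. \<forall>y\<in>space M. \<bar>(F (s0 + h) y - F s0 y) / h\<bar> \<le> w y"
      using near
    proof eventually_elim
      case (elim h)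
      show ?case
      proof
        fix y
        \<comment> \<open>The mean value inequality on the ball bounds the difference quotient by
          the majorant of the derivative.\<close>
        have "norm (F (s0 + h) y - F s0 y) \<le> w y * norm (s0 + h - s0)"
        proof (rule field_differentiable_bound[where S = "ball s0 d" and f = "\<lambda>s. F s y" and f' = "\<lambda>s. F' s y"])
          fix s assume "s \<in> ball s0 d"
          then have "\<bar>s - s0\<bar> < d" by (auto simp: dist_real_def)
          then show "((\<lambda>s. F s y) has_field_derivative F' s y) (at s within ball s0 d)" "norm (F' s y) \<le> w y"
            using der[of s y] bound[of s y] by (auto intro: has_field_derivative_at_within)
        qed (use elim d in \<open>auto simp: dist_real_def\<close>)
        then show "\<bar>(F (s0 + h) y - F s0 y) / h\<bar> \<le> w y"
          using elim by (simp add: field_simps)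
      qed
    qed
    show "((\<lambda>h. (F (s0 + h) y - F s0 y) / h) \<longlongrightarrow> F' s0 y) (at 0)" for y
      using der[of s0 y] d by (simp add: DERIV_def)
    show "\<forall>\<^sub>F h in at 0. (\<lambda>y. (F (s0 + h) y - F s0 y) / h) \<in> borel_measurable M"
      using near
    proof eventually_elim
      case (elim h)
      then show ?case using int[of "s0 + h"] int[of s0] d by (auto intro!: borel_measurable_divide borel_measurable_diff)
    qed
  qed
  show "\<forall>\<^sub>F h in at 0. (\<integral>y. (F (s0 + h) y - F s0 y) / h \<partial>M) = ((\<integral>y. F (s0 + h) y \<partial>M) - (\<integral>y. F s0 y \<partial>M)) / h"
    using near
  proof eventually_elim
    case (elim h)
    then show ?case using int[of "s0 + h"] int[of s0] d by (simp add: Bochner_Integration.integral_diff)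
  qed
qed

text \<open>Used to recentre Gaussians: |y|^2 / 2 - |x|^2 \<le> |x - y|^2, so moving the centre
  costs a constant factor and half of the exponent.\<close>

lemma norm_add_power2_le: "(norm (u + v))\<^sup>2 \<le> 2 * (norm u)\<^sup>2 + 2 * (norm v)\<^sup>2"
  for u v :: "'a::real_normed_vector"
proof -
  have "(norm (u + v))\<^sup>2 \<le> (norm u + norm v)\<^sup>2" by (intro power_mono norm_triangle_ineq) auto
  also have "\<dots> \<le> 2 * (norm u)\<^sup>2 + 2 * (norm v)\<^sup>2"
    using sum_squares_bound[of "norm u" "norm v"] by (simp add: power2_sum)
  finally show ?thesis .
qed

text \<open>One Gaussian in y dominates the kernels for all (x, t) in a compact set; it serves as
  majorant under the integral. The 16 is the 8 of the kernel bound times the 2 lost in recentring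
  from x - y to y.\<close>

lemma gauss_deriv_dominated:
  fixes \<beta> :: "'n::finite \<Rightarrow> nat"
  assumes "0 < t1" "t1 \<le> t2"
  shows "\<exists>C>0. \<exists>\<epsilon>>0. \<forall>x t y. norm x \<le> r \<longrightarrow> t1 \<le> t \<longrightarrow> t \<le> t2 \<longrightarrow>
     \<bar>gauss_deriv \<beta> t (x - y)\<bar> \<le> C * exp (- \<epsilon> * (norm y)\<^sup>2)"
proof -
  let ?N = "CARD('n) + multi_order \<beta>"
  obtain C where C: "C > 0"
    "\<And>t x. t > 0 \<Longrightarrow> \<bar>gauss_deriv \<beta> t x\<bar> \<le> C / t ^ ?N * exp (- (norm x)\<^sup>2 / (8 * t\<^sup>2))"
    using gauss_deriv_bound[of \<beta>] by blast
  show ?thesis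
  proof (rule exI[of _ "C / t1 ^ ?N * exp (r\<^sup>2 / (8 * t2\<^sup>2))"], rule conjI[rotated],
      rule exI[of _ "1 / (16 * t2\<^sup>2)"], intro conjI allI impI)
    show "0 < C / t1 ^ ?N * exp (r\<^sup>2 / (8 * t2\<^sup>2))" "0 < 1 / (16 * t2\<^sup>2)" using C assms by auto
    fix x y :: "real^'n" and t assume x: "norm x \<le> r" and t: "t1 \<le> t" "t \<le> t2"
    have "(norm y)\<^sup>2 \<le> 2 * (norm (x - y))\<^sup>2 + 2 * (norm x)\<^sup>2"
      using norm_add_power2_le[of "y - x" x] by (simp add: norm_minus_commute)
    also have "(norm x)\<^sup>2 \<le> r\<^sup>2" using x by (intro power_mono) auto
    finally have q: "(norm y)\<^sup>2 / 2 - r\<^sup>2 \<le> (norm (x - y))\<^sup>2" by simp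
    have "((norm y)\<^sup>2 / 2 - r\<^sup>2) / (8 * t2\<^sup>2) \<le> (norm (x - y))\<^sup>2 / (8 * t2\<^sup>2)"
      using q by (intro divide_right_mono) auto
    also have "\<dots> \<le> (norm (x - y))\<^sup>2 / (8 * t\<^sup>2)"
      using t assms by (intro divide_left_mono mult_left_mono power_mono) auto
    finally have e: "exp (- (norm (x - y))\<^sup>2 / (8 * t\<^sup>2)) \<le> exp (r\<^sup>2 / (8 * t2\<^sup>2)) * exp (- (1 / (16 * t2\<^sup>2)) * (norm y)\<^sup>2)"
      unfolding exp_add[symmetric] by (simp add: diff_divide_distrib)
    have "\<bar>gauss_deriv \<beta> t (x - y)\<bar> \<le> C / t ^ ?N * exp (- (norm (x - y))\<^sup>2 / (8 * t\<^sup>2))"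
      using C(2)[of t "x - y"] t assms by auto
    also have "\<dots> \<le> C / t1 ^ ?N * (exp (r\<^sup>2 / (8 * t2\<^sup>2)) * exp (- (1 / (16 * t2\<^sup>2)) * (norm y)\<^sup>2))"
      using t assms C e by (intro mult_mono divide_left_mono power_mono) auto
    finally show "\<bar>gauss_deriv \<beta> t (x - y)\<bar> \<le> C / t1 ^ ?N * exp (r\<^sup>2 / (8 * t2\<^sup>2)) * exp (- (1 / (16 * t2\<^sup>2)) * (norm y)\<^sup>2)"
      by (simp add: mult.assoc)
  qed
qed

text \<open>Every \<epsilon> is required, because the majorant of the kernel at time t has exponent
  of order 1 / t^2, which becomes arbitrarily small for large t.\<close>

definition gauss_integrable :: "(real^'n::finite \<Rightarrow> real) \<Rightarrow> bool" where
  "gauss_integrable f \<longleftrightarrow> f \<in> borel_measurable borel \<and>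
     (\<forall>\<epsilon>>0. integrable lborel (\<lambda>y. exp (- \<epsilon> * (norm y)\<^sup>2) * f y))"

lemma gauss_integrable_measurable [measurable_dest]:
  "gauss_integrable f \<Longrightarrow> f \<in> borel_measurable borel"
  by (simp add: gauss_integrable_def)

lemma gauss_integrable_abs:
  assumes "gauss_integrable f" "\<epsilon> > 0"
  shows "integrable lborel (\<lambda>y. C * (exp (- \<epsilon> * (norm y)\<^sup>2) * \<bar>f y\<bar>))"
proof -
  have "integrable lborel (\<lambda>y. \<bar>exp (- \<epsilon> * (norm y)\<^sup>2) * f y\<bar>)"
    using assms by (intro integrable_abs) (auto simp: gauss_integrable_def)
  then show ?thesis by (intro integrable_mult_right) (simp add: abs_mult)
qed

text \<open>The convolution U_\<beta> of the overview, as a function of the pair (x, t).\<close>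

definition heat :: "('n::finite \<Rightarrow> nat) \<Rightarrow> (real^'n \<Rightarrow> real) \<Rightarrow> (real^'n) \<times> real \<Rightarrow> real" where
  "heat \<beta> f z = (\<integral>y. gauss_deriv \<beta> (snd z) (fst z - y) * f y \<partial>lborel)"

lemma heat_integrable:
  assumes f: "gauss_integrable f" and t: "t > 0"
  shows "integrable lborel (\<lambda>y. gauss_deriv \<beta> t (x - y) * f y)"
proof -
  obtain C \<epsilon> where C: "C > 0" "\<epsilon> > 0" "\<And>y. \<bar>gauss_deriv \<beta> t (x - y)\<bar> \<le> C * exp (- \<epsilon> * (norm y)\<^sup>2)"
    using gauss_deriv_dominated[OF t order_refl, of "norm x" \<beta>] by blast
  note f[measurable]
  show ?thesis
  proof (rule Bochner_Integration.integrable_bound[OF gauss_integrable_abs[OF f C(2), of C]])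
    show "AE y in lborel. norm (gauss_deriv \<beta> t (x - y) * f y) \<le> norm (C * (exp (- \<epsilon> * (norm y)\<^sup>2) * \<bar>f y\<bar>))"
      using C by (auto simp: abs_mult mult.assoc[symmetric] intro!: mult_right_mono)
  qed measurable
qed

lemma heat_continuous:
  fixes f :: "real^'n::finite \<Rightarrow> real"
  assumes f: "gauss_integrable f"
  shows "continuous_on half_space (heat \<beta> f)"
  unfolding continuous_on_def
proof
  note f[measurable]
  fix z0 :: "(real^'n) \<times> real" assume "z0 \<in> half_space"
  then have t0: "snd z0 > 0" by (auto simp: half_space_def)
  obtain C \<epsilon> where C: "C > 0" "\<epsilon> > 0"
    "\<And>x t y. norm x \<le> norm (fst z0) + 1 \<Longrightarrow> snd z0 / 2 \<le> t \<Longrightarrow> t \<le> 2 * snd z0 \<Longrightarrow>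
       \<bar>gauss_deriv \<beta> t (x - y)\<bar> \<le> C * exp (- \<epsilon> * (norm y)\<^sup>2)"
    using gauss_deriv_dominated[of "snd z0 / 2" "2 * snd z0" "norm (fst z0) + 1" \<beta>] t0 by auto
  have fst: "eventually (\<lambda>z. norm (fst z) < norm (fst z0) + 1) (at z0 within half_space)"
    by (rule order_tendstoD[where y = "norm (fst z0)"]) (auto intro!: tendsto_intros)
  have snd: "(snd \<longlongrightarrow> snd z0) (at z0 within half_space)" by (auto intro!: tendsto_intros)
  have s1: "eventually (\<lambda>z. snd z > snd z0 / 2) (at z0 within half_space)"
    and s2: "eventually (\<lambda>z. snd z < 2 * snd z0) (at z0 within half_space)"
    by (rule order_tendstoD[OF snd], use t0 in simp)+
  show "(heat \<beta> f \<longlongrightarrow> heat \<beta> f z0) (at z0 within half_space)"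
    unfolding heat_def
  proof (rule tendsto_integral_dominated[where w = "\<lambda>y. C * (exp (- \<epsilon> * (norm y)\<^sup>2) * \<bar>f y\<bar>)"])
    show "\<forall>\<^sub>F z in at z0 within half_space. \<forall>y\<in>space lborel.
       \<bar>gauss_deriv \<beta> (snd z) (fst z - y) * f y\<bar> \<le> C * (exp (- \<epsilon> * (norm y)\<^sup>2) * \<bar>f y\<bar>)"
      using fst s1 s2
    proof eventually_elim
      case (elim z)
      then show ?case using C(3)[of "fst z" "snd z"]
        by (auto simp: abs_mult mult.assoc[symmetric] intro!: mult_right_mono)
    qed
    show "((\<lambda>z. gauss_deriv \<beta> (snd z) (fst z - y) * f y) \<longlongrightarrow> gauss_deriv \<beta> (snd z0) (fst z0 - y) * f y) (at z0 within half_space)" for y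
    proof (rule tendsto_mult_right)
      have "continuous_on half_space (\<lambda>z. gauss_deriv \<beta> (snd z) (fst z - y))"
        by (intro continuous_on_gauss_deriv continuous_intros) (auto simp: half_space_def)
      then show "((\<lambda>z. gauss_deriv \<beta> (snd z) (fst z - y)) \<longlongrightarrow> gauss_deriv \<beta> (snd z0) (fst z0 - y)) (at z0 within half_space)"
        using \<open>z0 \<in> half_space\<close> by (simp add: continuous_on_def)
    qed
  qed (use gauss_integrable_abs[OF f C(2)] in auto)
qed

lemma heat_has_derivative_axis:
  fixes f :: "real^'n::finite \<Rightarrow> real"
  assumes f: "gauss_integrable f" and t: "t > 0"
  shows "((\<lambda>s. heat \<beta> f (x + s *\<^sub>R axis i 1, t)) has_real_derivative heat (incr i \<beta>) f (x + s *\<^sub>R axis i 1, t)) (at s)"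
proof -
  note f[measurable]
  obtain C \<epsilon> where C: "C > 0" "\<epsilon> > 0"
    "\<And>x' y. norm x' \<le> norm x + \<bar>s\<bar> + 1 \<Longrightarrow> \<bar>gauss_deriv (incr i \<beta>) t (x' - y)\<bar> \<le> C * exp (- \<epsilon> * (norm y)\<^sup>2)"
    using gauss_deriv_dominated[OF t order_refl, of "norm x + \<bar>s\<bar> + 1" "incr i \<beta>"] t by auto
  show ?thesis
    unfolding heat_def fst_conv snd_conv
  proof (rule has_real_derivative_integral[where d = 1 and w = "\<lambda>y. C * (exp (- \<epsilon> * (norm y)\<^sup>2) * \<bar>f y\<bar>)"])
    fix r y
    have "((\<lambda>r. gauss_deriv \<beta> t ((x - y) + r *\<^sub>R axis i 1)) has_real_derivative gauss_deriv (incr i \<beta>) t ((x - y) + r *\<^sub>R axis i 1)) (at r)"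
      by (rule gauss_deriv_has_derivative_axis[OF t])
    then have "((\<lambda>r. gauss_deriv \<beta> t (x + r *\<^sub>R axis i 1 - y)) has_real_derivative gauss_deriv (incr i \<beta>) t (x + r *\<^sub>R axis i 1 - y)) (at r)"
      by (simp add: algebra_simps)
    then show "((\<lambda>r. gauss_deriv \<beta> t (x + r *\<^sub>R axis i 1 - y) * f y) has_real_derivative gauss_deriv (incr i \<beta>) t (x + r *\<^sub>R axis i 1 - y) * f y) (at r)"
      by (rule DERIV_cmult_right)
    assume "\<bar>r - s\<bar> < 1"
    then have "norm (x + r *\<^sub>R axis i 1) \<le> norm x + \<bar>s\<bar> + 1"
      by (intro order.trans[OF norm_triangle_ineq]) (auto simp: norm_axis_1)
    from C(3)[OF this, of y]
    show "\<bar>gauss_deriv (incr i \<beta>) t (x + r *\<^sub>R axis i 1 - y) * f y\<bar> \<le> C * (exp (- \<epsilon> * (norm y)\<^sup>2) * \<bar>f y\<bar>)"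
      by (auto simp: abs_mult mult.assoc[symmetric] intro!: mult_right_mono)
  qed (use gauss_integrable_abs[OF f C(2)] heat_integrable[OF f t] in auto)
qed

lemma heat_has_derivative_time:
  fixes f :: "real^'n::finite \<Rightarrow> real"
  assumes f: "gauss_integrable f" and t: "t > 0"
  shows "((\<lambda>s. heat \<beta> f (x, s)) has_real_derivative (\<Sum>i\<in>UNIV. 2 * t * heat (incr i (incr i \<beta>)) f (x, t))) (at t)"
proof -
  note f[measurable]
  have "\<exists>C \<epsilon>. C > 0 \<and> \<epsilon> > 0 \<and> (\<forall>s y. t / 2 \<le> s \<longrightarrow> s \<le> 2 * t \<longrightarrow> \<bar>gauss_deriv (incr i (incr i \<beta>)) s (x - y)\<bar> \<le> C * exp (- \<epsilon> * (norm y)\<^sup>2))" for i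
    using gauss_deriv_dominated[of "t/2" "2 * t" "norm x" "incr i (incr i \<beta>)"] t by force
  then obtain C \<epsilon> where C: "\<And>i. C i > 0" "\<And>i. \<epsilon> i > 0"
    "\<And>i s y. t / 2 \<le> s \<Longrightarrow> s \<le> 2 * t \<Longrightarrow> \<bar>gauss_deriv (incr i (incr i \<beta>)) s (x - y)\<bar> \<le> C i * exp (- \<epsilon> i * (norm y)\<^sup>2)"
    by metis
  have "((\<lambda>s. heat \<beta> f (x, s)) has_real_derivative
      (\<integral>y. (\<Sum>i\<in>UNIV. 2 * t * (gauss_deriv (incr i (incr i \<beta>)) t (x - y) * f y)) \<partial>lborel)) (at t)"
    unfolding heat_def fst_conv snd_conv
  proof (rule has_real_derivative_integral[where d = "t / 2" and
        w = "\<lambda>y. \<Sum>i\<in>UNIV. 4 * t * (C i * (exp (- \<epsilon> i * (norm y)\<^sup>2) * \<bar>f y\<bar>))"])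
    fix s y assume "\<bar>s - t\<bar> < t / 2"
    \<comment> \<open>Staying within t / 2 of t keeps the times in a compact part of the positive
      axis and bounds the factor 2 * s by 4 * t.\<close>
    then have s: "s > 0" "t / 2 \<le> s" "s \<le> 2 * t" using t unfolding abs_less_iff by linarith+
    have "((\<lambda>s. gauss_deriv \<beta> s (x - y) * f y) has_real_derivative (\<Sum>i\<in>UNIV. 2 * s * gauss_deriv (incr i (incr i \<beta>)) s (x - y)) * f y) (at s)"
      by (rule DERIV_cmult_right[OF gauss_deriv_has_derivative_time[OF s(1)]])
    then show "((\<lambda>s. gauss_deriv \<beta> s (x - y) * f y) has_real_derivative (\<Sum>i\<in>UNIV. 2 * s * (gauss_deriv (incr i (incr i \<beta>)) s (x - y) * f y))) (at s)"
      by (simp add: sum_distrib_right mult.assoc)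
    show "\<bar>\<Sum>i\<in>UNIV. 2 * s * (gauss_deriv (incr i (incr i \<beta>)) s (x - y) * f y)\<bar>
      \<le> (\<Sum>i\<in>UNIV. 4 * t * (C i * (exp (- \<epsilon> i * (norm y)\<^sup>2) * \<bar>f y\<bar>)))"
    proof (intro order.trans[OF sum_abs] sum_mono)
      fix i
      have "2 * s * (\<bar>gauss_deriv (incr i (incr i \<beta>)) s (x - y)\<bar> * \<bar>f y\<bar>) \<le> 4 * t * (C i * exp (- \<epsilon> i * (norm y)\<^sup>2) * \<bar>f y\<bar>)"
        using s t C(3)[OF s(2,3), of i y] C(1)[of i]
        by (intro mult_mono[of "2 * s" "4 * t"] mult_right_mono) auto
      then show "\<bar>2 * s * (gauss_deriv (incr i (incr i \<beta>)) s (x - y) * f y)\<bar> \<le> 4 * t * (C i * (exp (- \<epsilon> i * (norm y)\<^sup>2) * \<bar>f y\<bar>))"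
        using s by (simp add: abs_mult mult.assoc)
    qed
    show "integrable lborel (\<lambda>y. gauss_deriv \<beta> s (x - y) * f y)" by (rule heat_integrable[OF f s(1)])
  next
    show "integrable lborel (\<lambda>y. \<Sum>i\<in>UNIV. 4 * t * (C i * (exp (- \<epsilon> i * (norm y)\<^sup>2) * \<bar>f y\<bar>)))"
      by (rule Bochner_Integration.integrable_sum, rule integrable_mult_right, rule gauss_integrable_abs[OF f C(2)])
  qed (use t in auto)
  also have "(\<integral>y. (\<Sum>i\<in>UNIV. 2 * t * (gauss_deriv (incr i (incr i \<beta>)) t (x - y) * f y)) \<partial>lborel)
     = (\<Sum>i\<in>UNIV. 2 * t * heat (incr i (incr i \<beta>)) f (x, t))"
    unfolding heat_def using heat_integrable[OF f t]
    by (subst Bochner_Integration.integral_sum) auto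
  finally show ?thesis .
qed

text \<open>Operators rather than functions, so that the constants of the final estimate do not depend on \<open>f\<close>.\<close>

inductive heat_class :: "nat \<Rightarrow> ((real^'n::finite \<Rightarrow> real) \<Rightarrow> (real^'n) \<times> real \<Rightarrow> real) \<Rightarrow> bool" where
  base: "multi_order \<beta> = k + j \<Longrightarrow> heat_class k (\<lambda>f z. snd z ^ j * heat \<beta> f z)"
| add: "heat_class k V \<Longrightarrow> heat_class k W \<Longrightarrow> heat_class k (\<lambda>f z. V f z + W f z)"
| scale: "heat_class k V \<Longrightarrow> heat_class k (\<lambda>f z. c * V f z)"

lemma heat_class_zero:
  "heat_class k (\<lambda>f z. 0 :: real)" for k
proof -
  \<comment> \<open>Any multi-index of order k would do here; the term built from it is multiplied
    by 0.\<close>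
  let ?\<beta> = "\<lambda>i::'n::finite. if i = undefined then k else 0"
  have "multi_order ?\<beta> = k + 0" by (simp add: multi_order_def)
  from heat_class.scale[OF heat_class.base[OF this], of 0] show ?thesis by simp
qed

lemma heat_class_sum:
  "finite I \<Longrightarrow> (\<And>i. i \<in> I \<Longrightarrow> heat_class k (V i)) \<Longrightarrow> heat_class k (\<lambda>f z. \<Sum>i\<in>I. V i f z)"
  by (induction I rule: finite_induct) (auto intro: heat_class_zero heat_class.add)

lemma heat_class_continuous:
  assumes "heat_class k V" "gauss_integrable f"
  shows "continuous_on half_space (V f)"
  using assms by (induction rule: heat_class.induct) (auto intro!: continuous_intros heat_continuous)

text \<open>A derivative in x raises |\<beta>| by one. In t, the product rule either lowers j by one
  or, through the heat equation, raises j by one and |\<beta>| by two. In each case |\<beta>| - j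
  grows by one. W is chosen before f and z.\<close>

lemma heat_class_derivative:
  fixes V :: "(real^'n::finite \<Rightarrow> real) \<Rightarrow> (real^'n) \<times> real \<Rightarrow> real"
  assumes "heat_class k V" and b: "b \<in> Basis"
  shows "\<exists>W. heat_class (Suc k) W \<and> (\<forall>f z. gauss_integrable f \<longrightarrow> z \<in> half_space \<longrightarrow>
     ((\<lambda>s. V f (z + s *\<^sub>R b)) has_real_derivative W f z) (at 0))"
  using assms(1)
proof induction
  case (base \<beta> k j)
  from b consider i where "b = (axis i 1, 0)" | "b = (0, 1)"
    by (auto simp: Basis_prod_def Basis_vec_def)
  then show ?case
  proof cases
    case (1 i)
    show ?thesis
    proof (intro exI[of _ "\<lambda>f z. snd z ^ j * heat (incr i \<beta>) f z"] conjI allI impI)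
      show "heat_class (Suc k) (\<lambda>f z. snd z ^ j * heat (incr i \<beta>) f z)"
        by (rule heat_class.base) (use base in auto)
      fix f :: "real^'n \<Rightarrow> real" and z :: "(real^'n) \<times> real"
      assume f: "gauss_integrable f" and z: "z \<in> half_space"
      obtain x t where zt: "z = (x, t)" "t > 0" using z by (auto simp: half_space_def)
      show "((\<lambda>s. snd (z + s *\<^sub>R b) ^ j * heat \<beta> f (z + s *\<^sub>R b)) has_real_derivative snd z ^ j * heat (incr i \<beta>) f z) (at 0)"
        using DERIV_cmult[OF heat_has_derivative_axis[OF f zt(2), of \<beta> x i 0], of "t ^ j"] zt 1 by simp
    qed
  next
    case 2
    let ?W = "\<lambda>f z. real j * (snd z ^ (j - 1) * heat \<beta> f z) + (\<Sum>i\<in>UNIV. 2 * (snd z ^ Suc j * heat (incr i (incr i \<beta>)) f z))"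
    show ?thesis
    proof (intro exI[of _ ?W] conjI allI impI)
      \<comment> \<open>For j = 0 the subtraction \<open>j - 1\<close> is truncated, but the
        coefficient \<open>real j\<close> vanishes and the term is zero.\<close>
      have "heat_class (Suc k) (\<lambda>f z. real j * (snd z ^ (j - 1) * heat \<beta> f z))"
      proof (cases j)
        case 0
        then show ?thesis by (simp add: heat_class_zero)
      next
        case (Suc j')
        then show ?thesis using base by (intro heat_class.scale heat_class.base) auto
      qed
      moreover have "heat_class (Suc k) (\<lambda>f z. \<Sum>i\<in>UNIV. 2 * (snd z ^ Suc j * heat (incr i (incr i \<beta>)) f z))"
        by (intro heat_class_sum heat_class.scale heat_class.base) (use base in auto)
      ultimately show "heat_class (Suc k) ?W" by (rule heat_class.add)
      fix f :: "real^'n \<Rightarrow> real" and z :: "(real^'n) \<times> real"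
      assume f: "gauss_integrable f" and z: "z \<in> half_space"
      obtain x t where zt: "z = (x, t)" "t > 0" using z by (auto simp: half_space_def)
      \<comment> \<open>The point is written as 0 + t so that \<open>DERIV_shift\<close> turns the
        derivative at t into one at 0 along the line t + s.\<close>
      have "((\<lambda>s. s ^ j * heat \<beta> f (x, s)) has_real_derivative ?W f z) (at (0 + t))"
        using DERIV_mult[OF DERIV_pow[of j t] heat_has_derivative_time[OF f zt(2), of \<beta> x]] zt
        by (simp add: sum_distrib_right sum_distrib_left algebra_simps)
      then have "((\<lambda>s. (t + s) ^ j * heat \<beta> f (x, t + s)) has_real_derivative ?W f z) (at 0)"
        by (subst (asm) DERIV_shift) (simp add: add.commute[of t])
      then show "((\<lambda>s. snd (z + s *\<^sub>R b) ^ j * heat \<beta> f (z + s *\<^sub>R b)) has_real_derivative ?W f z) (at 0)"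
        using zt 2 by simp
    qed
  qed
next
  case (add k V1 V2)
  then obtain W1 W2 where "heat_class (Suc k) W1" "heat_class (Suc k) W2"
    "\<And>f z. gauss_integrable f \<Longrightarrow> z \<in> half_space \<Longrightarrow> ((\<lambda>s. V1 f (z + s *\<^sub>R b)) has_real_derivative W1 f z) (at 0)"
    "\<And>f z. gauss_integrable f \<Longrightarrow> z \<in> half_space \<Longrightarrow> ((\<lambda>s. V2 f (z + s *\<^sub>R b)) has_real_derivative W2 f z) (at 0)"
    by blast
  then show ?case
    by (intro exI[of _ "\<lambda>f z. W1 f z + W2 f z"]) (auto intro!: heat_class.add DERIV_add)
next
  case (scale k V c)
  then obtain W where "heat_class (Suc k) W"
    "\<And>f z. gauss_integrable f \<Longrightarrow> z \<in> half_space \<Longrightarrow> ((\<lambda>s. V f (z + s *\<^sub>R b)) has_real_derivative W f z) (at 0)"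
    by blast
  then show ?case
    by (intro exI[of _ "\<lambda>f z. c * W f z"]) (auto intro!: heat_class.scale DERIV_cmult)
qed

section \<open>Iterated partial derivatives on the half space\<close>

lemma open_half_space: "open half_space"
  unfolding half_space_def by (intro open_Times) auto

lemma eventually_line_in_open:
  fixes x b :: "'a::euclidean_space"
  assumes "open S" "x \<in> S"
  shows "eventually (\<lambda>s. x + s *\<^sub>R b \<in> S) (nhds (0::real))"
proof -
  have "((\<lambda>s::real. x + s *\<^sub>R b) \<longlongrightarrow> x + 0 *\<^sub>R b) (nhds 0)" by (intro tendsto_intros filterlim_ident)
  from topological_tendstoD[OF this assms(1)] show ?thesis using assms by simp
qed

lemma partial_cong_open:
  assumes "open S" "x \<in> S" "\<And>y. y \<in> S \<Longrightarrow> f y = g y"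
  shows "partial b f x = partial b g x"
  unfolding partial_def
  by (rule deriv_cong_ev) (auto intro: eventually_mono[OF eventually_line_in_open[OF assms(1,2)]] assms(3))

text \<open>\<open>gauss_ext\<close> and \<open>heat\<close> are identified only for t > 0. On an
  open set this suffices, since each partial derivative looks only at nearby points.\<close>

lemma partials_cong_open:
  assumes "open S" "\<And>y. y \<in> S \<Longrightarrow> f y = g y" "x \<in> S"
  shows "partials bs f x = partials bs g x"
  using assms(3)
proof (induction bs arbitrary: x)
  case (Cons b bs)
  show ?case
    unfolding partials.simps by (rule partial_cong_open[OF assms(1) Cons.prems]) (rule Cons.IH)
qed (simp add: assms(2))

lemma Ck_on_cong_open:
  assumes "open S" "\<And>y. y \<in> S \<Longrightarrow> f y = g y" and g: "Ck_on k g S"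
  shows "Ck_on k f S"
  unfolding Ck_on_def
proof (intro allI impI conjI ballI)
  fix bs :: "'a list" assume bs: "set bs \<subseteq> Basis"
  have eq: "partials bs f x = partials bs g x" if "x \<in> S" for x
    by (rule partials_cong_open[OF assms(1,2) that])
  show "continuous_on S (partials bs f)" if "length bs \<le> k"
    using g bs that continuous_on_cong[OF refl eq, of S] by (simp add: Ck_on_def)
  fix b x :: 'a assume l: "length bs < k" and b: "b \<in> Basis" and x: "x \<in> S"
  have "(\<lambda>s. partials bs g (x + s *\<^sub>R b)) differentiable (at 0)"
    using g bs l b x by (simp add: Ck_on_def)
  then obtain D where D: "((\<lambda>s. partials bs g (x + s *\<^sub>R b)) has_derivative D) (at 0)"
    by (auto simp: differentiable_def)
  obtain e where e: "e > 0" "\<And>s. dist s 0 < e \<Longrightarrow> x + s *\<^sub>R b \<in> S"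
    using eventually_line_in_open[OF assms(1) x, of b] by (auto simp: eventually_nhds_metric)
  have "((\<lambda>s. partials bs f (x + s *\<^sub>R b)) has_derivative D) (at 0)"
    by (rule has_derivative_transform_within[OF D e(1)]) (use e eq in auto)
  then show "(\<lambda>s. partials bs f (x + s *\<^sub>R b)) differentiable (at 0)"
    by (auto simp: differentiable_def)
qed

lemma partials_heat_class:
  fixes bs :: "((real^'n::finite) \<times> real) list"
  assumes "set bs \<subseteq> Basis"
  shows "\<exists>W. heat_class (length bs) W \<and> (\<forall>f z. gauss_integrable f \<longrightarrow> z \<in> half_space \<longrightarrow>
     partials bs (heat (\<lambda>_. 0) f) z = W f z)"
  using assms
proof (induction bs)
  case Nil
  have "multi_order (\<lambda>_::'n. 0) = 0 + 0" by (simp add: multi_order_def)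
  from heat_class.base[OF this] show ?case
    by (intro exI[of _ "\<lambda>f z. snd z ^ 0 * heat (\<lambda>_. 0) f z"]) auto
next
  case (Cons b bs)
  then obtain V where V: "heat_class (length bs) V"
    "\<And>f z. gauss_integrable f \<Longrightarrow> z \<in> half_space \<Longrightarrow> partials bs (heat (\<lambda>_. 0) f) z = V f z"
    by auto
  obtain W where W: "heat_class (Suc (length bs)) W"
    "\<And>f z. gauss_integrable f \<Longrightarrow> z \<in> half_space \<Longrightarrow> ((\<lambda>s. V f (z + s *\<^sub>R b)) has_real_derivative W f z) (at 0)"
    using heat_class_derivative[OF V(1), of b] Cons.prems by auto
  have "partials (b # bs) (heat (\<lambda>_. 0) f) z = W f z" if "gauss_integrable f" "z \<in> half_space" for f z
  proof -
    have "partials (b # bs) (heat (\<lambda>_. 0) f) z = partial b (V f) z"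
      using partial_cong_open[OF open_half_space that(2), of "partials bs (heat (\<lambda>_. 0) f)" "V f"] V(2) that by auto
    also have "\<dots> = W f z"
      unfolding partial_def by (rule DERIV_imp_deriv) (rule W(2)[OF that])
    finally show ?thesis .
  qed
  then show ?case using W(1) by auto
qed

lemma Ck_on_heat:
  fixes f :: "real^'n::finite \<Rightarrow> real"
  assumes f: "gauss_integrable f"
  shows "Ck_on k (heat (\<lambda>_. 0) f) half_space"
  unfolding Ck_on_def
proof (intro allI impI conjI ballI)
  fix bs :: "((real^'n) \<times> real) list" assume bs: "set bs \<subseteq> Basis"
  obtain W where W: "heat_class (length bs) W"
    "\<And>z. z \<in> half_space \<Longrightarrow> partials bs (heat (\<lambda>_. 0) f) z = W f z"
    using partials_heat_class[OF bs] f by auto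
  show "continuous_on half_space (partials bs (heat (\<lambda>_. 0) f))"
    using heat_class_continuous[OF W(1) f] by (subst continuous_on_cong[OF refl W(2)]) auto
  fix b z :: "(real^'n) \<times> real" assume b: "b \<in> Basis" and z: "z \<in> half_space"
  obtain D where D: "((\<lambda>s. W f (z + s *\<^sub>R b)) has_real_derivative D) (at 0)"
    using heat_class_derivative[OF W(1) b] f z by blast
  obtain e where e: "e > 0" "\<And>s. dist s 0 < e \<Longrightarrow> z + s *\<^sub>R b \<in> half_space"
    using eventually_line_in_open[OF open_half_space z, of b] by (auto simp: eventually_nhds_metric)
  have "((\<lambda>s. partials bs (heat (\<lambda>_. 0) f) (z + s *\<^sub>R b)) has_derivative (*) D) (at 0)"
    by (rule has_derivative_transform_within[OF D[unfolded has_field_derivative_def] e(1)]) (use e W(2) in auto)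
  then show "(\<lambda>s. partials bs (heat (\<lambda>_. 0) f) (z + s *\<^sub>R b)) differentiable (at 0)"
    by (auto simp: differentiable_def)
qed

section \<open>Kernel estimates\<close>

lemma powr_above_tangent:
  fixes p v v0 :: real
  assumes "1 \<le> p" "0 \<le> v" "0 < v0"
  shows "v0 powr p + p * v0 powr (p - 1) * (v - v0) \<le> v powr p"
proof (cases "v = 0")
  \<comment> \<open>Convexity is applied on the open half-line, so the endpoint is separate: there
    the tangent has the value (1 - p) * v0^p \<le> 0.\<close>
  case True
  have "v0 powr (p - 1) * v0 = v0 powr p" using assms by (simp add: powr_diff)
  then have "v0 powr p + p * v0 powr (p - 1) * (v - v0) = (1 - p) * v0 powr p"
    using True by (simp add: algebra_simps)
  also have "\<dots> \<le> 0" using assms by (intro mult_nonpos_nonneg) auto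
  finally show ?thesis using True assms by simp
next
  case False
  have "p * v0 powr (p - 1) * (v - v0) \<le> v powr p - v0 powr p"
  proof (rule convex_on_imp_above_tangent[OF powr_convex[OF assms(1)]])
    show "((\<lambda>x. x powr p) has_field_derivative p * v0 powr (p - 1)) (at v0 within {0<..})"
      using assms by (intro has_field_derivative_at_within[OF has_real_derivative_powr])
  qed (use assms False in \<open>auto simp: interior_open\<close>)
  then show ?thesis by simp
qed

lemma le_one_plus_powr: "v \<le> 1 + v powr p" if "0 \<le> v" "1 \<le> p" for v p :: real
proof (cases "v \<le> 1")
  case True
  then show ?thesis by (simp add: add_increasing2)
next
  case False
  then have "v powr 1 \<le> v powr p" using that by (intro powr_mono) auto
  then show ?thesis using False by simp
qed

text \<open>With A the integral of |K|, the weight |K| / A is a probability density, and Jensen for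
  v^p gives the factor A^(p - 1). The right side is an extended integral, so h need not be
  integrable against K beforehand.\<close>

lemma jensen_kernel:
  fixes K h :: "'a \<Rightarrow> real"
  assumes p: "1 \<le> p" and K: "integrable M K" and h[measurable]: "h \<in> borel_measurable M"
  shows "ennreal (\<bar>\<integral>y. K y * h y \<partial>M\<bar> powr p)
     \<le> ennreal ((\<integral>y. \<bar>K y\<bar> \<partial>M) powr (p - 1)) * (\<integral>\<^sup>+y. ennreal (\<bar>K y\<bar> * \<bar>h y\<bar> powr p) \<partial>M)"
proof -
  have [measurable]: "K \<in> borel_measurable M" using K by auto
  define A where "A = (\<integral>y. \<bar>K y\<bar> \<partial>M)"
  have "A \<ge> 0" by (simp add: A_def)
  consider "A = 0" | "A > 0" "(\<integral>\<^sup>+y. ennreal (\<bar>K y\<bar> * \<bar>h y\<bar> powr p) \<partial>M) = \<infinity>"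
    | "A > 0" "(\<integral>\<^sup>+y. ennreal (\<bar>K y\<bar> * \<bar>h y\<bar> powr p) \<partial>M) < \<infinity>"
    using \<open>A \<ge> 0\<close> order_le_less[of 0 A] less_top[of "\<integral>\<^sup>+y. ennreal (\<bar>K y\<bar> * \<bar>h y\<bar> powr p) \<partial>M"]
    unfolding infinity_ennreal_def by metis
  then show ?thesis
  proof cases
    case 1
    then have "AE y in M. \<bar>K y\<bar> = 0"
      using integral_nonneg_eq_0_iff_AE[of M "\<lambda>y. \<bar>K y\<bar>"] K by (auto simp: A_def)
    then have "(\<integral>y. K y * h y \<partial>M) = 0" by (intro integral_eq_zero_AE) auto
    then show ?thesis using p by simp
  next
    \<comment> \<open>Since A > 0, the factor A^(p - 1) is nonzero and the right side is
      infinite.\<close>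
    case 2
    then show ?thesis by (simp add: A_def[symmetric] ennreal_mult_top)
  next
    case 3
    have intp: "integrable M (\<lambda>y. \<bar>K y\<bar> * \<bar>h y\<bar> powr p)"
      using 3 by (simp add: integrable_iff_bounded)
    have int1: "integrable M (\<lambda>y. \<bar>K y\<bar> * \<bar>h y\<bar>)"
    proof (rule Bochner_Integration.integrable_bound[OF Bochner_Integration.integrable_add[OF integrable_abs[OF K] intp]])
      have "\<bar>K y\<bar> * \<bar>h y\<bar> \<le> \<bar>K y\<bar> + \<bar>K y\<bar> * \<bar>h y\<bar> powr p" for y
        using mult_left_mono[OF le_one_plus_powr[of "\<bar>h y\<bar>" p], of "\<bar>K y\<bar>"] p by (simp add: algebra_simps)
      then show "AE y in M. norm (\<bar>K y\<bar> * \<bar>h y\<bar>) \<le> norm (\<bar>K y\<bar> + \<bar>K y\<bar> * \<bar>h y\<bar> powr p)"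
        by simp
    qed measurable
    define X where "X = (\<integral>y. \<bar>K y\<bar> * \<bar>h y\<bar> \<partial>M)"
    define B where "B = (\<integral>y. \<bar>K y\<bar> * \<bar>h y\<bar> powr p \<partial>M)"
    have X0: "X \<ge> 0" and B0: "B \<ge> 0" by (auto simp: X_def B_def)
    have main: "X powr p \<le> A powr (p - 1) * B"
    proof (cases "X = 0")
      case True
      then show ?thesis using B0 p by simp
    next
      case False
      \<comment> \<open>v0 is the mean of |h| under |K| / A. The tangent to v^p at v0 lies below
        v^p, and its linear part integrates to zero.\<close>
      define v0 where "v0 = X / A"
      have v0: "v0 > 0" using False X0 3 by (simp add: v0_def)
      have "v0 powr p * A = (\<integral>y. v0 powr p * \<bar>K y\<bar> + p * v0 powr (p - 1) * (\<bar>K y\<bar> * \<bar>h y\<bar> - v0 * \<bar>K y\<bar>) \<partial>M)"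
      proof -
        have "X - v0 * A = 0" using 3 by (simp add: v0_def)
        then show ?thesis using K int1 by (simp add: X_def A_def)
      qed
      also have "\<dots> \<le> B"
        unfolding B_def
      proof (rule integral_mono)
        fix y
        have "(v0 powr p + p * v0 powr (p - 1) * (\<bar>h y\<bar> - v0)) * \<bar>K y\<bar> \<le> \<bar>h y\<bar> powr p * \<bar>K y\<bar>"
          using p v0 by (intro mult_right_mono powr_above_tangent) auto
        then show "v0 powr p * \<bar>K y\<bar> + p * v0 powr (p - 1) * (\<bar>K y\<bar> * \<bar>h y\<bar> - v0 * \<bar>K y\<bar>) \<le> \<bar>K y\<bar> * \<bar>h y\<bar> powr p"
          by (simp add: algebra_simps)
      qed (use K int1 intp in auto)
      finally have le: "v0 powr p * A \<le> B" .
      have "X powr p = v0 powr p * A powr p" using 3 X0 v0 by (simp add: v0_def powr_divide)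
      also have "A powr p = A powr (p - 1) * A" using 3 by (simp add: powr_diff)
      finally have "X powr p = A powr (p - 1) * (v0 powr p * A)" by simp
      also have "\<dots> \<le> A powr (p - 1) * B" using le by (intro mult_left_mono) auto
      finally show ?thesis .
    qed
    have "\<bar>\<integral>y. K y * h y \<partial>M\<bar> \<le> X"
      unfolding X_def abs_mult[symmetric] by (rule integral_abs_bound)
    then have "\<bar>\<integral>y. K y * h y \<partial>M\<bar> powr p \<le> X powr p" using p by (intro powr_mono2) auto
    also note main
    finally have "ennreal (\<bar>\<integral>y. K y * h y \<partial>M\<bar> powr p) \<le> ennreal (A powr (p - 1)) * ennreal B"
      by (simp add: ennreal_mult[symmetric] B0 ennreal_leI)
    also have "ennreal B = (\<integral>\<^sup>+y. ennreal (\<bar>K y\<bar> * \<bar>h y\<bar> powr p) \<partial>M)"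
      unfolding B_def by (rule nn_integral_eq_integral[symmetric, OF intp]) auto
    finally show ?thesis by (simp add: A_def)
  qed
qed

lemma nn_integral_exp_abs_finite:
  assumes "\<epsilon> > 0"
  shows "(\<integral>\<^sup>+x. ennreal (exp (- \<epsilon> * \<bar>x\<bar>)) \<partial>lborel) < \<infinity>"
proof -
  have lim: "((\<lambda>x. - exp (- \<epsilon> * x) / \<epsilon>) \<longlongrightarrow> 0) at_top"
    using assms by real_asymp
  have half: "(\<integral>\<^sup>+x. ennreal (exp (- \<epsilon> * x)) * indicator {0..} x \<partial>lborel) = ennreal (0 - (- exp (- \<epsilon> * 0) / \<epsilon>))"
    by (rule nn_integral_FTC_atLeast[OF _ _ _ lim])
      (use assms in \<open>auto intro!: derivative_eq_intros\<close>)
  let ?f = "\<lambda>x::real. ennreal (exp (- \<epsilon> * x)) * indicator {0..} x"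
  have "(\<integral>\<^sup>+x. ennreal (exp (- \<epsilon> * \<bar>x\<bar>)) \<partial>lborel) \<le> (\<integral>\<^sup>+x. ?f x + ?f (0 + (-1) * x) \<partial>lborel)"
    by (intro nn_integral_mono) (auto simp: indicator_def abs_if)
  also have "\<dots> = (\<integral>\<^sup>+x. ?f x \<partial>lborel) + (\<integral>\<^sup>+x. ?f (0 + (-1) * x) \<partial>lborel)"
    by (intro nn_integral_add) auto
  also have "(\<integral>\<^sup>+x. ?f (0 + (-1) * x) \<partial>lborel) = (\<integral>\<^sup>+x. ?f x \<partial>lborel)"
    using nn_integral_real_affine[of ?f "-1" 0] by simp
  finally show ?thesis using half by (auto simp: less_top[symmetric] top_unique)
qed

text \<open>In one variable |x| \<le> 1 + x^2 compares the Gaussian with exp (-\<epsilon> |x|); in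
  several variables the integral factors over the basis.\<close>

lemma integrable_gaussian:
  assumes "\<epsilon> > 0"
  shows "integrable lborel (\<lambda>x::'a::euclidean_space. exp (- \<epsilon> * (norm x)\<^sup>2))"
proof -
  have "(\<integral>\<^sup>+x. ennreal (exp (- \<epsilon> * x\<^sup>2)) \<partial>lborel) \<le> (\<integral>\<^sup>+x. ennreal (exp \<epsilon>) * ennreal (exp (- \<epsilon> * \<bar>x\<bar>)) \<partial>lborel)"
  proof (intro nn_integral_mono)
    fix x :: real
    have "0 \<le> (\<bar>x\<bar> - 1)\<^sup>2" by simp
    then have "\<bar>x\<bar> \<le> 1 + x\<^sup>2" by (simp add: power2_diff)
    then have "\<epsilon> * \<bar>x\<bar> \<le> \<epsilon> * (1 + x\<^sup>2)" using assms by (intro mult_left_mono) auto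
    then show "ennreal (exp (- \<epsilon> * x\<^sup>2)) \<le> ennreal (exp \<epsilon>) * ennreal (exp (- \<epsilon> * \<bar>x\<bar>))"
      by (simp add: ennreal_mult[symmetric] exp_add[symmetric] algebra_simps)
  qed
  also have "\<dots> < \<infinity>"
    using nn_integral_exp_abs_finite[OF assms] by (simp add: nn_integral_cmult ennreal_mult_less_top)
  finally have fin: "(\<integral>\<^sup>+x. ennreal (exp (- \<epsilon> * x\<^sup>2)) \<partial>lborel) < \<infinity>" .
  have "(\<integral>\<^sup>+x. ennreal (norm (exp (- \<epsilon> * (norm (x::'a))\<^sup>2))) \<partial>lborel)
      = (\<integral>\<^sup>+x. (\<Prod>b\<in>Basis. ennreal (exp (- \<epsilon> * ((x::'a) \<bullet> b)\<^sup>2))) \<partial>lborel)"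
  proof (intro nn_integral_cong)
    fix x :: 'a
    have "(norm x)\<^sup>2 = (\<Sum>b\<in>Basis. (x \<bullet> b)\<^sup>2)"
      unfolding power2_norm_eq_inner by (subst euclidean_inner) (simp add: power2_eq_square)
    then show "ennreal (norm (exp (- \<epsilon> * (norm x)\<^sup>2))) = (\<Prod>b\<in>Basis. ennreal (exp (- \<epsilon> * (x \<bullet> b)\<^sup>2)))"
      by (simp add: prod_ennreal exp_sum[symmetric] sum_distrib_left sum_negf)
  qed
  also have "\<dots> = (\<Prod>b\<in>(Basis::'a set). (\<integral>\<^sup>+x. ennreal (exp (- \<epsilon> * x\<^sup>2)) \<partial>lborel))"
    by (rule nn_integral_lborel_prod) auto
  also have "\<dots> < \<infinity>"
    using fin by (simp add: power_less_top_ennreal)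
  finally show ?thesis by (simp add: integrable_iff_bounded)
qed

lemma gauss_integrable_bounded:
  fixes f :: "real^'n::finite \<Rightarrow> real"
  assumes [measurable]: "f \<in> borel_measurable borel" and "\<And>y. \<bar>f y\<bar> \<le> C"
  shows "gauss_integrable f"
  unfolding gauss_integrable_def
proof (intro conjI allI impI)
  fix \<epsilon> :: real assume "\<epsilon> > 0"
  from integrable_mult_right[OF integrable_gaussian[OF this], of C]
  show "integrable lborel (\<lambda>y. exp (- \<epsilon> * (norm y)\<^sup>2) * f y)"
  proof (rule Bochner_Integration.integrable_bound)
    show "AE y in lborel. norm (exp (- \<epsilon> * (norm y)\<^sup>2) * f y) \<le> norm (C * exp (- \<epsilon> * (norm y)\<^sup>2))"
      using assms(2) by (auto simp: abs_mult mult.commute intro!: mult_right_mono order.trans[OF _ abs_ge_self])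
  qed measurable
qed (rule assms)

section \<open>Kernels of mean zero and representations by differences\<close>

lemma gauss_deriv_integrable:
  assumes "t > 0"
  shows "integrable lborel (gauss_deriv \<beta> t)"
proof -
  \<comment> \<open>The convolution integrand for the constant function 1 at x = 0; the sign is
    chosen to cancel the one produced by the reflection of y.\<close>
  have "integrable lborel (\<lambda>y. (-1) ^ multi_order \<beta> * (gauss_deriv \<beta> t (0 - y) * 1))"
    by (intro integrable_mult_right heat_integrable gauss_integrable_bounded[of _ 1] assms) auto
  then show ?thesis by (simp add: gauss_deriv_uminus mult.assoc[symmetric] power_mult_distrib[symmetric])
qed

lemma incr_cases:
  fixes \<beta> :: "'n::finite \<Rightarrow> nat"
  assumes "multi_order \<beta> > 0"
  obtains i \<beta>' where "\<beta> = incr i \<beta>'"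
proof -
  obtain i where i: "\<beta> i > 0" using assms unfolding multi_order_def
    by (metis gr0I less_irrefl sum.neutral)
  have "\<beta> = incr i (\<beta>(i := \<beta> i - 1))" using i by (auto simp: incr_def fun_eq_iff)
  then show thesis by (rule that)
qed

text \<open>Convolving the constant 1 with any kernel gives a function constant in x, so its
  derivative along axis i, which is the integral of the kernel of order \<beta>, vanishes.\<close>

lemma gauss_deriv_integral_zero:
  fixes \<beta> :: "'n::finite \<Rightarrow> nat"
  assumes t: "t > 0" and \<beta>: "multi_order \<beta> > 0"
  shows "(\<integral>y. gauss_deriv \<beta> t y \<partial>lborel) = 0"
proof -
  obtain i \<beta>' where i: "\<beta> = incr i \<beta>'" using incr_cases[OF \<beta>] .
  have const: "heat \<gamma> (\<lambda>_. 1) (x, t) = (\<integral>y. gauss_deriv \<gamma> t y \<partial>lborel)" for x and \<gamma> :: "'n \<Rightarrow> nat"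
    using integral_lborel_affine[of "gauss_deriv \<gamma> t" "-1" x] by (simp add: heat_def)
  have "((\<lambda>s. heat \<beta>' (\<lambda>_. 1) (0 + s *\<^sub>R axis i 1, t)) has_real_derivative
      heat \<beta> (\<lambda>_. 1) (0 + 0 *\<^sub>R axis i 1, t)) (at 0)"
    unfolding i by (intro heat_has_derivative_axis gauss_integrable_bounded[of _ 1] t) auto
  then have "((\<lambda>s. (\<integral>y. gauss_deriv \<beta>' t y \<partial>lborel)) has_real_derivative (\<integral>y. gauss_deriv \<beta> t y \<partial>lborel)) (at (0::real))"
    unfolding const .
  from DERIV_unique[OF this DERIV_const] show ?thesis .
qed

lemma gauss_deriv_abs_integral:
  fixes \<beta> :: "'n::finite \<Rightarrow> nat"
  assumes t: "t > 0"
  shows "(\<integral>y. \<bar>gauss_deriv \<beta> t y\<bar> \<partial>lborel) = (\<integral>y. \<bar>gauss_deriv \<beta> 1 y\<bar> \<partial>lborel) / t ^ multi_order \<beta>"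
proof -
  have "(\<integral>y. \<bar>gauss_deriv \<beta> t y\<bar> \<partial>lborel) = t ^ CARD('n) * (\<integral>y. \<bar>gauss_deriv \<beta> t (0 + t *\<^sub>R y)\<bar> \<partial>lborel)"
    using integral_lborel_affine[of "\<lambda>y. \<bar>gauss_deriv \<beta> t y\<bar>" t 0] t by simp
  also have "(\<integral>y. \<bar>gauss_deriv \<beta> t (0 + t *\<^sub>R y)\<bar> \<partial>lborel) = (\<integral>y. \<bar>gauss_deriv \<beta> 1 y\<bar> / t ^ (CARD('n) + multi_order \<beta>) \<partial>lborel)"
    by (subst gauss_deriv_scale[OF t]) (use t in \<open>simp add: abs_divide\<close>)
  also have "\<dots> = (\<integral>y. \<bar>gauss_deriv \<beta> 1 y\<bar> \<partial>lborel) / t ^ (CARD('n) + multi_order \<beta>)" by simp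
  finally show ?thesis using t by (simp add: power_add)
qed

lemma heat_eq_translate:
  fixes g :: "real^'n::finite \<Rightarrow> real"
  assumes g: "gauss_integrable g" and t: "t > 0"
  shows "integrable lborel (\<lambda>z. gauss_deriv \<beta> t z * g (x + z))"
    and "heat \<beta> g (x, t) = (-1) ^ multi_order \<beta> * (\<integral>z. gauss_deriv \<beta> t z * g (x + z) \<partial>lborel)"
    and "integrable lborel (\<lambda>z. gauss_deriv \<beta> t z * g (x - z))"
    and "heat \<beta> g (x, t) = (\<integral>z. gauss_deriv \<beta> t z * g (x - z) \<partial>lborel)"
proof -
  note g[measurable]
  let ?s = "(-1) ^ multi_order \<beta> :: real"
  have ss: "?s * ?s = 1" by (simp flip: power_mult_distrib)
  have int: "integrable lborel (\<lambda>y. gauss_deriv \<beta> t (x - y) * g y)" by (rule heat_integrable[OF g t])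
  have "integrable lborel (\<lambda>z. ?s * (gauss_deriv \<beta> t (x - (x + 1 *\<^sub>R z)) * g (x + 1 *\<^sub>R z)))"
    by (intro integrable_mult_right integrable_lborel_affine[OF int]) auto
  then show "integrable lborel (\<lambda>z. gauss_deriv \<beta> t z * g (x + z))"
    using ss by (simp add: gauss_deriv_uminus mult.assoc[symmetric])
  show "heat \<beta> g (x, t) = ?s * (\<integral>z. gauss_deriv \<beta> t z * g (x + z) \<partial>lborel)"
    using integral_lborel_affine[of "\<lambda>y. gauss_deriv \<beta> t (x - y) * g y" 1 x]
    by (simp add: heat_def gauss_deriv_uminus mult.assoc)
  show "integrable lborel (\<lambda>z. gauss_deriv \<beta> t z * g (x - z))"
    using integrable_lborel_affine[OF int, of "-1" x] by simp
  show "heat \<beta> g (x, t) = (\<integral>z. gauss_deriv \<beta> t z * g (x - z) \<partial>lborel)"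
    using integral_lborel_affine[of "\<lambda>y. gauss_deriv \<beta> t (x - y) * g y" "-1" x] by (simp add: heat_def)
qed

lemma heat_first_difference:
  fixes g :: "real^'n::finite \<Rightarrow> real"
  assumes g: "gauss_integrable g" and t: "t > 0" and \<beta>: "multi_order \<beta> > 0"
  shows "\<bar>heat \<beta> g (x, t)\<bar> = \<bar>\<integral>z. gauss_deriv \<beta> t z * (g (x + z) - g x) \<partial>lborel\<bar>"
proof -
  have "(\<integral>z. gauss_deriv \<beta> t z * (g (x + z) - g x) \<partial>lborel)
     = (\<integral>z. gauss_deriv \<beta> t z * g (x + z) - g x * gauss_deriv \<beta> t z \<partial>lborel)"
    by (simp add: algebra_simps)
  also have "\<dots> = (\<integral>z. gauss_deriv \<beta> t z * g (x + z) \<partial>lborel)"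
    by (subst Bochner_Integration.integral_diff)
      (auto intro: heat_eq_translate(1)[OF g t] gauss_deriv_integrable[OF t] simp: gauss_deriv_integral_zero[OF t \<beta>])
  finally show ?thesis using heat_eq_translate(2)[OF g t] by (simp add: abs_mult power_abs)
qed

text \<open>Average the representations by g (x + z) and by g (x - z). For even |\<beta>| both carry
  the sign +1, and the central term -2 g x may be inserted because the kernel has mean zero.\<close>

lemma heat_second_difference:
  fixes g :: "real^'n::finite \<Rightarrow> real"
  assumes g: "gauss_integrable g" and t: "t > 0" and \<beta>: "multi_order \<beta> > 0" "even (multi_order \<beta>)"
  shows "heat \<beta> g (x, t) = (\<integral>z. gauss_deriv \<beta> t z * ((g (x + z) - 2 * g x + g (x - z)) / 2) \<partial>lborel)"
proof -
  have "(\<integral>z. gauss_deriv \<beta> t z * ((g (x + z) - 2 * g x + g (x - z)) / 2) \<partial>lborel)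
     = (\<integral>z. (1/2) * (gauss_deriv \<beta> t z * g (x + z)) - g x * gauss_deriv \<beta> t z + (1/2) * (gauss_deriv \<beta> t z * g (x - z)) \<partial>lborel)"
    by (intro Bochner_Integration.integral_cong) (auto simp: field_simps)
  also have "\<dots> = (1/2) * (\<integral>z. gauss_deriv \<beta> t z * g (x + z) \<partial>lborel) + (1/2) * (\<integral>z. gauss_deriv \<beta> t z * g (x - z) \<partial>lborel)"
  proof -
    note int = heat_eq_translate(1,3)[OF g t, of \<beta> x] gauss_deriv_integrable[OF t, of \<beta>]
    show ?thesis
      using int by (subst Bochner_Integration.integral_add, simp, simp, subst Bochner_Integration.integral_diff)
        (simp_all add: gauss_deriv_integral_zero[OF t \<beta>(1)])
  qed
  also have "\<dots> = heat \<beta> g (x, t)"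
    using heat_eq_translate(2,4)[OF g t, of \<beta> x] \<beta> by simp
  finally show ?thesis by simp
qed

text \<open>The substitution t = r u extracts r^(-q) and leaves a fixed integral, which converges at
  0 because of the exponential and at infinity because q > 0.\<close>

lemma radial_integral:
  assumes q: "q > 0"
  shows "\<exists>c\<ge>0. \<forall>r>0. (\<integral>\<^sup>+t. ennreal (t powr (- q - 1) * exp (- r\<^sup>2 / (8 * t\<^sup>2))) * indicator {0<..} t \<partial>lborel)
     \<le> ennreal (c * r powr (- q))"
proof -
  let ?F = "\<lambda>u::real. ennreal (u powr (- q - 1) * exp (- 1 / (8 * u\<^sup>2))) * indicator {0<..} u"
  obtain k :: nat where k: "real k \<ge> q + 1" "k > 0"
    by (meson gr0I le_less_trans less_le not_less of_nat_0_less_iff q real_arch_simple zero_less_one add_pos_pos)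
  have small: "u powr (- q - 1) * exp (- 1 / (8 * u\<^sup>2)) \<le> (8 * real k) ^ k" if "0 < u" "u \<le> 1" for u :: real
  proof -
    \<comment> \<open>With y = 1 / (8 u^2), exp y \<ge> (1 + y / k)^k \<ge> (y / k)^k. The resulting
      power u^(2 k) outweighs u^(-q - 1) for u \<le> 1, since 2 k \<ge> q + 1.\<close>
    have "(1 / (8 * real k * u\<^sup>2)) ^ k \<le> (1 + (1 / (8 * u\<^sup>2)) / real k) ^ k"
      using that k by (intro power_mono) (auto simp: field_simps)
    also have "\<dots> \<le> exp (1 / (8 * u\<^sup>2))"
    proof (rule exp_ge_one_plus_x_over_n_power_n)
      show "- real k \<le> 1 / (8 * u\<^sup>2)" by (rule order.trans[of _ 0]) auto
    qed (use k in auto)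
    finally have "exp (- 1 / (8 * u\<^sup>2)) \<le> (8 * real k * u\<^sup>2) ^ k"
      using that k by (simp add: exp_minus field_simps power_divide)
    then have "u powr (- q - 1) * exp (- 1 / (8 * u\<^sup>2)) \<le> u powr (- q - 1) * (8 * real k * u\<^sup>2) ^ k"
      by (intro mult_left_mono) auto
    also have "\<dots> = (8 * real k) ^ k * (u powr (- q - 1) * u powr (2 * real k))"
    proof -
      have "u powr (2 * real k) = u ^ (2 * k)" using that powr_realpow[of u "2 * k"] by simp
      also have "\<dots> = (u\<^sup>2) ^ k" by (rule power_mult)
      finally show ?thesis by (simp add: power_mult_distrib)
    qed
    also have "\<dots> \<le> (8 * real k) ^ k * 1"
    proof (intro mult_left_mono)
      show "u powr (- q - 1) * u powr (2 * real k) \<le> 1"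
        using that k by (simp add: powr_add[symmetric] powr_le1)
    qed auto
    finally show ?thesis by simp
  qed
  have lim: "((\<lambda>u. - (u powr (- q)) / q) \<longlongrightarrow> 0) at_top" using q by real_asymp
  have tail: "(\<integral>\<^sup>+u. ennreal (u powr (- q - 1)) * indicator {1..} u \<partial>lborel) = ennreal (0 - (- (1 powr (- q)) / q))"
  proof (rule nn_integral_FTC_atLeast[OF _ _ _ lim])
    fix u :: real assume u: "1 \<le> u"
    have "((\<lambda>u. u powr (- q)) has_real_derivative (- q) * u powr (- q - 1)) (at u)"
      using u by (intro has_real_derivative_powr) auto
    from DERIV_cdivide[OF DERIV_minus[OF this], of q]
    show "((\<lambda>u. - (u powr - q) / q) has_real_derivative u powr (- q - 1)) (at u)" using q by simp
  qed auto
  have "(\<integral>\<^sup>+u. ?F u \<partial>lborel) \<le> (\<integral>\<^sup>+u. ennreal ((8 * real k) ^ k) * indicator {0..1} u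
       + ennreal (u powr (- q - 1)) * indicator {1..} u \<partial>lborel)"
  proof (intro nn_integral_mono)
    fix u :: real
    consider "u \<le> 0" | "0 < u" "u \<le> 1" | "u > 1" by linarith
    then show "?F u \<le> ennreal ((8 * real k) ^ k) * indicator {0..1} u + ennreal (u powr (- q - 1)) * indicator {1..} u"
    proof cases
      case 2
      then show ?thesis using small[of u] by (intro add_increasing2) (auto intro!: ennreal_leI)
    next
      case 3
      then show ?thesis by (auto intro!: ennreal_leI mult_left_le)
    qed auto
  qed
  also have "\<dots> = ennreal ((8 * real k) ^ k) * emeasure lborel {0..1::real} + ennreal (1 / q)"
    using tail by (subst nn_integral_add) (auto simp: nn_integral_cmult_indicator)
  also have "\<dots> < \<infinity>" by (simp add: ennreal_mult_less_top)
  finally have fin: "(\<integral>\<^sup>+u. ?F u \<partial>lborel) < \<infinity>" .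
  define c where "c = enn2real (\<integral>\<^sup>+u. ?F u \<partial>lborel)"
  have c: "ennreal c = (\<integral>\<^sup>+u. ?F u \<partial>lborel)" using fin by (simp add: c_def)
  show ?thesis
  proof (intro exI[of _ c] conjI allI impI)
    show "c \<ge> 0" by (simp add: c_def)
    fix r :: real assume r: "r > 0"
    let ?f = "\<lambda>t. ennreal (t powr (- q - 1) * exp (- r\<^sup>2 / (8 * t\<^sup>2))) * indicator {0<..} t"
    have "(\<integral>\<^sup>+t. ?f t \<partial>lborel) = ennreal r * (\<integral>\<^sup>+u. ?f (0 + r * u) \<partial>lborel)"
      using nn_integral_real_affine[of ?f r 0] r by simp
    also have "(\<integral>\<^sup>+u. ?f (0 + r * u) \<partial>lborel) = (\<integral>\<^sup>+u. ennreal (r powr (- q - 1)) * ?F u \<partial>lborel)"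
    proof (intro nn_integral_cong)
      fix u :: real
      have "- r\<^sup>2 / (8 * (r * u)\<^sup>2) = - 1 / (8 * u\<^sup>2)" using r by (simp add: power_mult_distrib)
      then show "?f (0 + r * u) = ennreal (r powr (- q - 1)) * ?F u"
        using r by (cases "u > 0") (auto simp: powr_mult ennreal_mult[symmetric] mult.assoc zero_less_mult_iff)
    qed
    also have "\<dots> = ennreal (r powr (- q - 1)) * ennreal c" by (simp add: nn_integral_cmult c)
    also have "ennreal r * (ennreal (r powr (- q - 1)) * ennreal c) = ennreal (c * (r powr (- q - 1) * r))"
      using r \<open>c \<ge> 0\<close> by (simp add: ennreal_mult[symmetric] mult_ac)
    also have "r powr (- q - 1) * r = r powr (- q)" using r by (simp add: powr_diff)
    finally show "(\<integral>\<^sup>+t. ?f t \<partial>lborel) \<le> ennreal (c * r powr (- q))" by simp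
  qed
qed

section \<open>The weighted estimate by differences\<close>

definition heat_energy :: "real \<Rightarrow> real \<Rightarrow> ((real^'n::finite) \<times> real \<Rightarrow> real) \<Rightarrow> ennreal" where
  "heat_energy b p F = (\<integral>\<^sup>+z. ennreal (snd z powr b * \<bar>F z\<bar> powr p) * indicator half_space z \<partial>lborel)"

text \<open>For D h = \<open>fdiff k h f\<close> with k = floor s + 1 this is the p-th power of
  \<open>besov_seminorm_le1\<close>, freed of the roots.\<close>

definition difference_energy :: "real \<Rightarrow> real \<Rightarrow> (real^'n::finite \<Rightarrow> real^'n \<Rightarrow> real) \<Rightarrow> ennreal" where
  "difference_energy s p D =
     (\<integral>\<^sup>+h. (\<integral>\<^sup>+x. ennreal (\<bar>D h x\<bar> powr p) \<partial>lborel) / ennreal (norm h powr (real CARD('n) + s * p)) \<partial>lborel)"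

lemma heat_measurable [measurable]:
  assumes [measurable]: "f \<in> borel_measurable borel"
  shows "heat \<beta> f \<in> borel_measurable borel"
proof -
  have "(\<lambda>z. \<integral>y. gauss_deriv \<beta> (snd z) (fst z - y) * f y \<partial>lborel) \<in> borel_measurable (borel \<Otimes>\<^sub>M borel)"
    by measurable
  then show ?thesis by (simp add: heat_def[abs_def] borel_prod)
qed

lemma half_space_borel [measurable]: "half_space \<in> sets borel"
  by (rule borel_open[OF open_half_space])

lemma snd_measurable_borel [measurable]: "snd \<in> borel_measurable (borel :: ('a::euclidean_space \<times> real) measure)"
  by (intro borel_measurable_continuous_onI continuous_intros)

lemma heat_energy_eq:
  fixes F :: "(real^'n::finite) \<times> real \<Rightarrow> real"
  assumes [measurable]: "F \<in> borel_measurable borel"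
  shows "heat_energy b p F =
    (\<integral>\<^sup>+t. (\<integral>\<^sup>+x. ennreal (t powr b * \<bar>F (x, t)\<bar> powr p) \<partial>lborel) * indicator {0<..} t \<partial>lborel)"
proof -
  have "heat_energy b p F = (\<integral>\<^sup>+z. ennreal (snd z powr b * \<bar>F z\<bar> powr p) * indicator half_space z \<partial>(lborel \<Otimes>\<^sub>M lborel))"
    by (simp add: heat_energy_def lborel_prod)
  also have "\<dots> = (\<integral>\<^sup>+t. (\<integral>\<^sup>+x. ennreal (t powr b * \<bar>F (x, t)\<bar> powr p) * indicator half_space (x, t) \<partial>lborel) \<partial>lborel)"
    by (subst lborel_pair.nn_integral_snd[symmetric]) (auto simp: lborel_prod)
  also have "\<dots> = (\<integral>\<^sup>+t. (\<integral>\<^sup>+x. ennreal (t powr b * \<bar>F (x, t)\<bar> powr p) * indicator {0<..} t \<partial>lborel) \<partial>lborel)"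
    by (intro nn_integral_cong) (auto simp: half_space_def indicator_def)
  also have "\<dots> = (\<integral>\<^sup>+t. (\<integral>\<^sup>+x. ennreal (t powr b * \<bar>F (x, t)\<bar> powr p) \<partial>lborel) * indicator {0<..} t \<partial>lborel)"
    by (intro nn_integral_cong nn_integral_multc) auto
  finally show ?thesis .
qed

text \<open>A count of powers of t: the weight gives (|\<beta>| - s) p - 1, the factor from Jensen
  -|\<beta>| (p - 1), the kernel bound -(n + |\<beta>|). The sum is -(n + s p) - 1, free of
  |\<beta>|. D is any function dominating through the kernel, so that first and second differences
  are covered together.\<close>

lemma heat_pointwise_bound:
  fixes \<beta> :: "'n::finite \<Rightarrow> nat"
  assumes p: "1 \<le> p"
  shows "\<exists>C\<ge>0. \<forall>g D x t. t > 0 \<longrightarrow> D \<in> borel_measurable borel \<longrightarrow>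
     \<bar>heat \<beta> g (x, t)\<bar> \<le> \<bar>\<integral>z. gauss_deriv \<beta> t z * D z \<partial>lborel\<bar> \<longrightarrow>
     ennreal (t powr ((real (multi_order \<beta>) - s) * p - 1) * \<bar>heat \<beta> g (x, t)\<bar> powr p)
     \<le> (\<integral>\<^sup>+z. ennreal (C * (t powr (- (real CARD('n) + s * p) - 1) * exp (- (norm z)\<^sup>2 / (8 * t\<^sup>2)))) * ennreal (\<bar>D z\<bar> powr p) \<partial>lborel)"
proof -
  let ?k = "multi_order \<beta>" and ?n = "CARD('n)"
  let ?b = "(real ?k - s) * p - 1" and ?q = "real ?n + s * p"
  obtain C0 where C0: "C0 > 0"
    "\<And>t x. t > 0 \<Longrightarrow> \<bar>gauss_deriv \<beta> t x\<bar> \<le> C0 / t ^ (?n + ?k) * exp (- (norm x)\<^sup>2 / (8 * t\<^sup>2))"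
    using gauss_deriv_bound[of \<beta>] by blast
  define A where "A = (\<integral>y. \<bar>gauss_deriv \<beta> 1 y\<bar> \<partial>lborel)"
  have A: "A \<ge> 0" by (simp add: A_def)
  show ?thesis
  proof (intro exI[of _ "A powr (p - 1) * C0"] conjI allI impI)
    show "0 \<le> A powr (p - 1) * C0" using C0 by simp
    fix g D :: "real^'n \<Rightarrow> real" and x and t :: real
    assume t: "t > 0" and [measurable]: "D \<in> borel_measurable borel"
      and le: "\<bar>heat \<beta> g (x, t)\<bar> \<le> \<bar>\<integral>z. gauss_deriv \<beta> t z * D z \<partial>lborel\<bar>"
    have At: "(\<integral>y. \<bar>gauss_deriv \<beta> t y\<bar> \<partial>lborel) powr (p - 1) = A powr (p - 1) * t powr (- real ?k * (p - 1))"
    proof -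
      have "(A / t ^ ?k) powr (p - 1) = A powr (p - 1) / (t powr real ?k) powr (p - 1)"
        using t A by (simp add: powr_divide powr_realpow)
      also have "\<dots> = A powr (p - 1) * t powr (- (real ?k * (p - 1)))"
        by (simp only: powr_powr powr_minus divide_inverse)
      finally show ?thesis by (simp add: gauss_deriv_abs_integral[OF t] A_def)
    qed
    have kap: "t powr ?b * (A powr (p - 1) * t powr (- real ?k * (p - 1))) * \<bar>gauss_deriv \<beta> t z\<bar>
      \<le> A powr (p - 1) * C0 * (t powr (- ?q - 1) * exp (- (norm z)\<^sup>2 / (8 * t\<^sup>2)))" for z
    proof -
      have "t powr ?b * (A powr (p - 1) * t powr (- real ?k * (p - 1))) * \<bar>gauss_deriv \<beta> t z\<bar>
        \<le> t powr ?b * (A powr (p - 1) * t powr (- real ?k * (p - 1))) * (C0 / t ^ (?n + ?k) * exp (- (norm z)\<^sup>2 / (8 * t\<^sup>2)))"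
        by (intro mult_left_mono C0(2)[OF t]) auto
      also have "\<dots> = A powr (p - 1) * C0 * ((t powr ?b * t powr (- real ?k * (p - 1)) * t powr (- real (?n + ?k))) * exp (- (norm z)\<^sup>2 / (8 * t\<^sup>2)))"
      proof -
        have "t powr (- real (?n + ?k)) = inverse (t ^ (?n + ?k))"
          by (simp only: powr_minus powr_realpow[OF t])
        then show ?thesis by (simp only: divide_inverse mult_ac)
      qed
      also have "t powr ?b * t powr (- real ?k * (p - 1)) * t powr (- real (?n + ?k)) = t powr (- ?q - 1)"
        unfolding powr_add[symmetric] by (rule arg_cong[where f = "\<lambda>r. t powr r"]) (simp add: algebra_simps)
      finally show ?thesis .
    qed
    have "ennreal (t powr ?b * \<bar>heat \<beta> g (x, t)\<bar> powr p) \<le> ennreal (t powr ?b) * ennreal (\<bar>\<integral>z. gauss_deriv \<beta> t z * D z \<partial>lborel\<bar> powr p)"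
      using le p by (auto simp: ennreal_mult[symmetric] intro!: ennreal_leI mult_left_mono powr_mono2)
    also have "\<dots> \<le> ennreal (t powr ?b) * (ennreal ((\<integral>y. \<bar>gauss_deriv \<beta> t y\<bar> \<partial>lborel) powr (p - 1)) *
        (\<integral>\<^sup>+z. ennreal (\<bar>gauss_deriv \<beta> t z\<bar> * \<bar>D z\<bar> powr p) \<partial>lborel))"
      by (intro mult_left_mono jensen_kernel p gauss_deriv_integrable t) auto
    also have "\<dots> = (\<integral>\<^sup>+z. ennreal (t powr ?b) * (ennreal ((\<integral>y. \<bar>gauss_deriv \<beta> t y\<bar> \<partial>lborel) powr (p - 1)) *
        ennreal (\<bar>gauss_deriv \<beta> t z\<bar> * \<bar>D z\<bar> powr p)) \<partial>lborel)"
      by (simp add: nn_integral_cmult)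
    also have "\<dots> \<le> (\<integral>\<^sup>+z. ennreal (A powr (p - 1) * C0 * (t powr (- ?q - 1) * exp (- (norm z)\<^sup>2 / (8 * t\<^sup>2)))) * ennreal (\<bar>D z\<bar> powr p) \<partial>lborel)"
    proof (intro nn_integral_mono)
      fix z
      have "t powr ?b * (A powr (p - 1) * t powr (- real ?k * (p - 1))) * \<bar>gauss_deriv \<beta> t z\<bar> * \<bar>D z\<bar> powr p
        \<le> A powr (p - 1) * C0 * (t powr (- ?q - 1) * exp (- (norm z)\<^sup>2 / (8 * t\<^sup>2))) * \<bar>D z\<bar> powr p"
        by (intro mult_right_mono kap) auto
      then show "ennreal (t powr ?b) * (ennreal ((\<integral>y. \<bar>gauss_deriv \<beta> t y\<bar> \<partial>lborel) powr (p - 1)) * ennreal (\<bar>gauss_deriv \<beta> t z\<bar> * \<bar>D z\<bar> powr p))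
        \<le> ennreal (A powr (p - 1) * C0 * (t powr (- ?q - 1) * exp (- (norm z)\<^sup>2 / (8 * t\<^sup>2)))) * ennreal (\<bar>D z\<bar> powr p)"
        unfolding At using C0(1) by (simp add: ennreal_mult[symmetric] mult.assoc ennreal_leI)
    qed
    finally show "ennreal (t powr ?b * \<bar>heat \<beta> g (x, t)\<bar> powr p)
      \<le> (\<integral>\<^sup>+z. ennreal (A powr (p - 1) * C0 * (t powr (- ?q - 1) * exp (- (norm z)\<^sup>2 / (8 * t\<^sup>2)))) * ennreal (\<bar>D z\<bar> powr p) \<partial>lborel)" .
  qed
qed

text \<open>After the pointwise bound, t occurs only in the scalar kernel \<open>?R t z\<close>.
  Tonelli puts the t-integral innermost, and \<open>radial_integral\<close> turns it into the Besov
  weight |z|^(-(n + s p)).\<close>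

lemma heat_energy_le_difference_energy:
  fixes \<beta> :: "'n::finite \<Rightarrow> nat"
  assumes p: "1 \<le> p" and s: "s > 0"
  shows "\<exists>C\<ge>0. \<forall>g D. g \<in> borel_measurable borel \<longrightarrow> D \<in> borel_measurable (borel \<Otimes>\<^sub>M borel) \<longrightarrow>
     (\<forall>x t. t > 0 \<longrightarrow> \<bar>heat \<beta> g (x, t)\<bar> \<le> \<bar>\<integral>z. gauss_deriv \<beta> t z * D (z, x) \<partial>lborel\<bar>) \<longrightarrow>
     heat_energy ((real (multi_order \<beta>) - s) * p - 1) p (heat \<beta> g) \<le> ennreal C * difference_energy s p (\<lambda>h x. D (h, x))"
proof -
  let ?b = "(real (multi_order \<beta>) - s) * p - 1" and ?q = "real CARD('n) + s * p"
  obtain C where C: "C \<ge> 0" "\<And>g D x t. t > 0 \<Longrightarrow> D \<in> borel_measurable borel \<Longrightarrow>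
     \<bar>heat \<beta> g (x, t)\<bar> \<le> \<bar>\<integral>z. gauss_deriv \<beta> t z * D z \<partial>lborel\<bar> \<Longrightarrow>
     ennreal (t powr ?b * \<bar>heat \<beta> g (x, t)\<bar> powr p)
     \<le> (\<integral>\<^sup>+z. ennreal (C * (t powr (- ?q - 1) * exp (- (norm z)\<^sup>2 / (8 * t\<^sup>2)))) * ennreal (\<bar>D z\<bar> powr p) \<partial>lborel)"
    using heat_pointwise_bound[OF p, of \<beta> s] by blast
  have q: "?q > 0" using p s by (intro add_pos_pos mult_pos_pos) auto
  obtain c where c: "c \<ge> 0"
    "\<And>r. r > 0 \<Longrightarrow> (\<integral>\<^sup>+t. ennreal (t powr (- ?q - 1) * exp (- r\<^sup>2 / (8 * t\<^sup>2))) * indicator {0<..} t \<partial>lborel) \<le> ennreal (c * r powr (- ?q))"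
    using radial_integral[OF q] by blast
  show ?thesis
  proof (intro exI[of _ "C * c"] conjI allI impI)
    show "0 \<le> C * c" using C c by simp
    fix g :: "real^'n \<Rightarrow> real" and D :: "(real^'n) \<times> (real^'n) \<Rightarrow> real"
    assume [measurable]: "g \<in> borel_measurable borel" "D \<in> borel_measurable (borel \<Otimes>\<^sub>M borel)"
      and le: "\<forall>x t. t > 0 \<longrightarrow> \<bar>heat \<beta> g (x, t)\<bar> \<le> \<bar>\<integral>z. gauss_deriv \<beta> t z * D (z, x) \<partial>lborel\<bar>"
    let ?R = "\<lambda>t z. ennreal (C * (t powr (- ?q - 1) * exp (- (norm (z::real^'n))\<^sup>2 / (8 * t\<^sup>2)))) * indicator {0<..} t"
    have "heat_energy ?b p (heat \<beta> g) = (\<integral>\<^sup>+t. (\<integral>\<^sup>+x. ennreal (t powr ?b * \<bar>heat \<beta> g (x, t)\<bar> powr p) \<partial>lborel) * indicator {0<..} t \<partial>lborel)"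
      by (rule heat_energy_eq) measurable
    also have "\<dots> \<le> (\<integral>\<^sup>+t. (\<integral>\<^sup>+x. (\<integral>\<^sup>+z. ?R t z * ennreal (\<bar>D (z, x)\<bar> powr p) \<partial>lborel) \<partial>lborel) \<partial>lborel)"
    proof (intro nn_integral_mono)
      fix t :: real
      show "(\<integral>\<^sup>+x. ennreal (t powr ?b * \<bar>heat \<beta> g (x, t)\<bar> powr p) \<partial>lborel) * indicator {0<..} t
        \<le> (\<integral>\<^sup>+x. (\<integral>\<^sup>+z. ?R t z * ennreal (\<bar>D (z, x)\<bar> powr p) \<partial>lborel) \<partial>lborel)"
      proof (cases "t > 0")
        case True
        have "(\<integral>\<^sup>+x. ennreal (t powr ?b * \<bar>heat \<beta> g (x, t)\<bar> powr p) \<partial>lborel)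
          \<le> (\<integral>\<^sup>+x. (\<integral>\<^sup>+z. ennreal (C * (t powr (- ?q - 1) * exp (- (norm z)\<^sup>2 / (8 * t\<^sup>2)))) * ennreal (\<bar>D (z, x)\<bar> powr p) \<partial>lborel) \<partial>lborel)"
          using le True by (intro nn_integral_mono C(2)) auto
        then show ?thesis using True by simp
      qed simp
    qed
    also have "\<dots> = (\<integral>\<^sup>+t. (\<integral>\<^sup>+z. (\<integral>\<^sup>+x. ?R t z * ennreal (\<bar>D (z, x)\<bar> powr p) \<partial>lborel) \<partial>lborel) \<partial>lborel)"
      by (intro nn_integral_cong lborel_pair.Fubini') auto
    also have "\<dots> = (\<integral>\<^sup>+t. (\<integral>\<^sup>+z. ?R t z * (\<integral>\<^sup>+x. ennreal (\<bar>D (z, x)\<bar> powr p) \<partial>lborel) \<partial>lborel) \<partial>lborel)"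
      by (intro nn_integral_cong nn_integral_cmult) auto
    also have "\<dots> = (\<integral>\<^sup>+z. (\<integral>\<^sup>+t. ?R t z * (\<integral>\<^sup>+x. ennreal (\<bar>D (z, x)\<bar> powr p) \<partial>lborel) \<partial>lborel) \<partial>lborel)"
      by (intro lborel_pair.Fubini') auto
    also have "\<dots> = (\<integral>\<^sup>+z. (\<integral>\<^sup>+t. ?R t z \<partial>lborel) * (\<integral>\<^sup>+x. ennreal (\<bar>D (z, x)\<bar> powr p) \<partial>lborel) \<partial>lborel)"
      by (intro nn_integral_cong nn_integral_multc) auto
    also have "\<dots> \<le> (\<integral>\<^sup>+z. ennreal (C * c) * ((\<integral>\<^sup>+x. ennreal (\<bar>D (z, x)\<bar> powr p) \<partial>lborel) / ennreal (norm z powr ?q)) \<partial>lborel)"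
    proof (rule nn_integral_mono_AE)
      \<comment> \<open>\<open>radial_integral\<close> needs |z| > 0; the origin is a null
        set.\<close>
      show "AE z in lborel. (\<integral>\<^sup>+t. ?R t z \<partial>lborel) * (\<integral>\<^sup>+x. ennreal (\<bar>D (z, x)\<bar> powr p) \<partial>lborel)
        \<le> ennreal (C * c) * ((\<integral>\<^sup>+x. ennreal (\<bar>D (z, x)\<bar> powr p) \<partial>lborel) / ennreal (norm z powr ?q))"
        using AE_lborel_singleton[of "0::real^'n"]
      proof eventually_elim
        case (elim z)
        have "(\<integral>\<^sup>+t. ?R t z \<partial>lborel) = (\<integral>\<^sup>+t. ennreal C * (ennreal (t powr (- ?q - 1) * exp (- (norm z)\<^sup>2 / (8 * t\<^sup>2))) * indicator {0<..} t) \<partial>lborel)"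
          using C(1) by (intro nn_integral_cong) (simp add: ennreal_mult mult.assoc)
        also have "\<dots> = ennreal C * (\<integral>\<^sup>+t. ennreal (t powr (- ?q - 1) * exp (- (norm z)\<^sup>2 / (8 * t\<^sup>2))) * indicator {0<..} t \<partial>lborel)"
          by (intro nn_integral_cmult) auto
        also have "\<dots> \<le> ennreal C * ennreal (c * norm z powr (- ?q))"
          using elim by (intro mult_left_mono c(2)) auto
        also have "\<dots> = ennreal (C * c) * inverse (ennreal (norm z powr ?q))"
        proof -
          define w where "w = norm z powr ?q"
          have "w > 0" "norm z powr (- ?q) = inverse w" using elim by (simp_all only: w_def powr_minus) simp
          then show ?thesis
            unfolding w_def[symmetric] using C(1) c(1)
            by (simp add: ennreal_mult[symmetric] inverse_ennreal mult.assoc)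
        qed
        finally have "(\<integral>\<^sup>+t. ?R t z \<partial>lborel) * (\<integral>\<^sup>+x. ennreal (\<bar>D (z, x)\<bar> powr p) \<partial>lborel)
           \<le> ennreal (C * c) * inverse (ennreal (norm z powr ?q)) * (\<integral>\<^sup>+x. ennreal (\<bar>D (z, x)\<bar> powr p) \<partial>lborel)"
          by (intro mult_right_mono) auto
        then show ?case by (simp add: divide_ennreal_def mult_ac)
      qed
    qed
    also have "\<dots> = ennreal (C * c) * difference_energy s p (\<lambda>h x. D (h, x))"
      unfolding difference_energy_def by (intro nn_integral_cmult) auto
    finally show "heat_energy ?b p (heat \<beta> g) \<le> ennreal (C * c) * difference_energy s p (\<lambda>h x. D (h, x))" .
  qed
qed

lemma heat_energy_first_difference:
  fixes \<beta> :: "'n::finite \<Rightarrow> nat"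
  assumes p: "1 \<le> p" and s: "s > 0" and \<beta>: "multi_order \<beta> > 0"
  shows "\<exists>C\<ge>0. \<forall>g. gauss_integrable g \<longrightarrow>
     heat_energy ((real (multi_order \<beta>) - s) * p - 1) p (heat \<beta> g) \<le> ennreal C * difference_energy s p (\<lambda>h. fdiff 1 h g)"
proof -
  obtain C where C: "C \<ge> 0" "\<And>g D. g \<in> borel_measurable borel \<Longrightarrow> D \<in> borel_measurable (borel \<Otimes>\<^sub>M borel) \<Longrightarrow>
     (\<And>x t. t > 0 \<Longrightarrow> \<bar>heat \<beta> g (x, t)\<bar> \<le> \<bar>\<integral>z. gauss_deriv \<beta> t z * D (z, x) \<partial>lborel\<bar>) \<Longrightarrow>
     heat_energy ((real (multi_order \<beta>) - s) * p - 1) p (heat \<beta> g) \<le> ennreal C * difference_energy s p (\<lambda>h x. D (h, x))"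
    using heat_energy_le_difference_energy[OF p s, of \<beta>] by blast
  have "heat_energy ((real (multi_order \<beta>) - s) * p - 1) p (heat \<beta> g) \<le> ennreal C * difference_energy s p (\<lambda>h. fdiff 1 h g)"
    if g: "gauss_integrable g" for g
  proof -
    have [measurable]: "g \<in> borel_measurable borel" by (rule gauss_integrable_measurable[OF g])
    have "(\<lambda>z. g (snd z + fst z) - g (snd z)) \<in> borel_measurable (borel \<Otimes>\<^sub>M borel)" by measurable
    from C(2)[OF _ this, of g] show ?thesis
      using heat_first_difference[OF g _ \<beta>] by simp
  qed
  then show ?thesis using C(1) by blast
qed

lemma heat_energy_second_difference_even:
  fixes \<beta> :: "'n::finite \<Rightarrow> nat"
  assumes p: "1 \<le> p" and s: "s > 0" and \<beta>: "multi_order \<beta> > 0" "even (multi_order \<beta>)"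
  shows "\<exists>C\<ge>0. \<forall>g. gauss_integrable g \<longrightarrow>
     heat_energy ((real (multi_order \<beta>) - s) * p - 1) p (heat \<beta> g) \<le> ennreal C * difference_energy s p (\<lambda>h. fdiff 2 h g)"
proof -
  obtain C where C: "C \<ge> 0" "\<And>g D. g \<in> borel_measurable borel \<Longrightarrow> D \<in> borel_measurable (borel \<Otimes>\<^sub>M borel) \<Longrightarrow>
     (\<And>x t. t > 0 \<Longrightarrow> \<bar>heat \<beta> g (x, t)\<bar> \<le> \<bar>\<integral>z. gauss_deriv \<beta> t z * D (z, x) \<partial>lborel\<bar>) \<Longrightarrow>
     heat_energy ((real (multi_order \<beta>) - s) * p - 1) p (heat \<beta> g) \<le> ennreal C * difference_energy s p (\<lambda>h x. D (h, x))"
    using heat_energy_le_difference_energy[OF p s, of \<beta>] by blast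
  have "heat_energy ((real (multi_order \<beta>) - s) * p - 1) p (heat \<beta> g) \<le> ennreal C * difference_energy s p (\<lambda>h. fdiff 2 h g)"
    if g: "gauss_integrable g" for g
  proof -
    have [measurable]: "g \<in> borel_measurable borel" by (rule gauss_integrable_measurable[OF g])
    let ?D = "\<lambda>z. (g (snd z + fst z) - 2 * g (snd z) + g (snd z - fst z)) / 2"
    have "heat_energy ((real (multi_order \<beta>) - s) * p - 1) p (heat \<beta> g) \<le> ennreal C * difference_energy s p (\<lambda>h x. ?D (h, x))"
    proof (rule C(2))
      show "?D \<in> borel_measurable (borel \<Otimes>\<^sub>M borel)" by measurable
      show "\<bar>heat \<beta> g (x, t)\<bar> \<le> \<bar>\<integral>z. gauss_deriv \<beta> t z * ?D (z, x) \<partial>lborel\<bar>" if "t > 0" for x t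
        by (simp only: heat_second_difference[OF g that \<beta>] fst_conv snd_conv order_refl)
    qed simp
    also have "\<dots> \<le> ennreal C * difference_energy s p (\<lambda>h. fdiff 2 h g)"
      unfolding difference_energy_def
    proof (intro mult_left_mono, rule nn_integral_mono, rule divide_right_mono_ennreal)
      \<comment> \<open>The symmetric second difference at x is \<open>fdiff 2 h g\<close> at x - h.
        Its factor 1/2 is estimated by 1, and translation invariance removes the shift.\<close>
      fix h
      have "(\<integral>\<^sup>+x. ennreal (\<bar>?D (h, x)\<bar> powr p) \<partial>lborel) \<le> (\<integral>\<^sup>+x. ennreal (\<bar>fdiff 2 h g (- h + x)\<bar> powr p) \<partial>lborel)"
        using p by (intro nn_integral_mono ennreal_leI powr_mono2)
          (auto simp: numeral_2_eq_2 algebra_simps)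
      also have "\<dots> = (\<integral>\<^sup>+x. ennreal (\<bar>fdiff 2 h g x\<bar> powr p) \<partial>lborel)"
        by (intro nn_integral_lborel_translation) (auto simp: numeral_2_eq_2)
      finally show "(\<integral>\<^sup>+x. ennreal (\<bar>?D (h, x)\<bar> powr p) \<partial>lborel) \<le> (\<integral>\<^sup>+x. ennreal (\<bar>fdiff 2 h g x\<bar> powr p) \<partial>lborel)" .
    qed auto
    finally show ?thesis .
  qed
  then show ?thesis using C(1) by blast
qed

section \<open>The semigroup property of the heat kernel\<close>

definition gauss_mass :: "'n::finite itself \<Rightarrow> real" where
  "gauss_mass _ = (\<integral>y. gauss_deriv (\<lambda>_::'n. 0) 1 y \<partial>lborel)"

lemma multi_order_zero [simp]: "multi_order (\<lambda>_. 0) = 0"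
  by (simp add: multi_order_def)

lemma gauss_deriv_zero_pos: "t > 0 \<Longrightarrow> gauss_deriv (\<lambda>_. 0) t x > 0"
  by (simp add: gauss_deriv_eq gauss_kernel_1d_def prod_pos)

lemma integral_gauss_deriv_zero:
  fixes x :: "real^'n::finite"
  assumes t: "t > 0"
  shows "(\<integral>y. gauss_deriv (\<lambda>_. 0) t (y - x) \<partial>lborel) = gauss_mass TYPE('n)"
proof -
  have "(\<integral>y. gauss_deriv (\<lambda>_::'n. 0) t y \<partial>lborel) = (\<integral>y. gauss_deriv (\<lambda>_. 0) t (- x + 1 *\<^sub>R y) \<partial>lborel)"
    using integral_lborel_affine[of "gauss_deriv (\<lambda>_. 0) t" 1 "- x"] by simp
  moreover have "(\<integral>y. gauss_deriv (\<lambda>_::'n. 0) t y \<partial>lborel) = gauss_mass TYPE('n)"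
  proof -
    have "\<bar>gauss_deriv (\<lambda>_::'n. 0) r y\<bar> = gauss_deriv (\<lambda>_. 0) r y" if "r > 0" for r y
      using gauss_deriv_zero_pos[OF that, of y] by simp
    then show ?thesis
      using gauss_deriv_abs_integral[OF t, of "\<lambda>_::'n. 0"] t by (simp add: gauss_mass_def)
  qed
  ultimately show ?thesis by (simp add: add.commute)
qed

lemma gauss_mass_pos: "gauss_mass TYPE('n::finite) > 0"
proof -
  have "gauss_mass TYPE('n) \<noteq> 0"
  proof
    assume "gauss_mass TYPE('n) = 0"
    then have "AE y in lborel. gauss_deriv (\<lambda>_::'n. 0) 1 y = 0"
      unfolding gauss_mass_def
      by (subst (asm) integral_nonneg_eq_0_iff_AE) (auto intro!: gauss_deriv_integrable less_imp_le[OF gauss_deriv_zero_pos])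
    then have "AE y in (lborel :: (real^'n) measure). False"
      by eventually_elim (metis gauss_deriv_zero_pos less_irrefl zero_less_one)
    then have "emeasure (lborel :: (real^'n) measure) UNIV = 0"
      using AE_iff_null[of "lborel :: (real^'n) measure" "\<lambda>_. False"] by auto
    then show False by simp
  qed
  moreover have "gauss_mass TYPE('n) \<ge> 0"
    unfolding gauss_mass_def by (intro Bochner_Integration.integral_nonneg less_imp_le[OF gauss_deriv_zero_pos]) auto
  ultimately show ?thesis by simp
qed

text \<open>Completing the square, |x - y|^2 + |y|^2 = |x|^2 / 2 + 2 |y - x / 2|^2. The
  normalisations agree because the product of the squared times is t^4 on both sides.\<close>

lemma gauss_deriv_zero_mult:
  fixes x y :: "real^'n::finite"
  assumes t: "t > 0"
  shows "gauss_deriv (\<lambda>_. 0) t (x - y) * gauss_deriv (\<lambda>_. 0) t y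
     = gauss_deriv (\<lambda>_. 0) (sqrt 2 * t) x * gauss_deriv (\<lambda>_. 0) (t / sqrt 2) (y - (1/2) *\<^sub>R x)"
proof -
  let ?n = "real CARD('n) / 2"
  have e: "(norm (x - y))\<^sup>2 + (norm y)\<^sup>2 = (norm x)\<^sup>2 / 2 + 2 * (norm (y - (1/2) *\<^sub>R x))\<^sup>2"
    by (simp add: power2_norm_eq_inner inner_diff inner_commute algebra_simps)
  have c: "(4 * pi * t\<^sup>2) powr ?n * (4 * pi * t\<^sup>2) powr ?n = (4 * pi * (sqrt 2 * t)\<^sup>2) powr ?n * (4 * pi * (t / sqrt 2)\<^sup>2) powr ?n"
    using t by (simp add: powr_mult[symmetric] power_mult_distrib power_divide)
  have "exp (- (norm (x - y))\<^sup>2 / (4 * t\<^sup>2)) * exp (- (norm y)\<^sup>2 / (4 * t\<^sup>2)) = exp (- ((norm (x - y))\<^sup>2 + (norm y)\<^sup>2) / (4 * t\<^sup>2))"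
    by (simp add: exp_add[symmetric] diff_divide_distrib)
  also have "\<dots> = exp (- (norm x)\<^sup>2 / (4 * (sqrt 2 * t)\<^sup>2)) * exp (- (norm (y - (1/2) *\<^sub>R x))\<^sup>2 / (4 * (t / sqrt 2)\<^sup>2))"
  proof -
    have q: "(sqrt 2 * t)\<^sup>2 = 2 * t\<^sup>2" "(t / sqrt 2)\<^sup>2 = t\<^sup>2 / 2"
      by (simp_all add: power_mult_distrib power_divide)
    have "- (X / 2 + 2 * W) / (4 * T) = - X / (4 * (2 * T)) + - W / (4 * (T / 2))" if "T > 0" for X W T :: real
      using that by (simp add: field_simps)
    from this[of "t\<^sup>2"] t show ?thesis unfolding e q exp_add[symmetric] by simp
  qed
  finally show ?thesis
    using t c by (simp add: gauss_deriv_eq_gauss_kernel gauss_kernel_def times_divide_times_eq)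
qed

lemma gauss_integrable_gauss_deriv:
  fixes \<beta> :: "'n::finite \<Rightarrow> nat"
  assumes t: "t > 0"
  shows "gauss_integrable (gauss_deriv \<beta> t)"
proof -
  obtain C where C: "C > 0"
    "\<And>x. \<bar>gauss_deriv \<beta> t x\<bar> \<le> C / t ^ (CARD('n) + multi_order \<beta>) * exp (- (norm x)\<^sup>2 / (8 * t\<^sup>2))"
    using gauss_deriv_bound[of \<beta>] t by blast
  have "\<bar>gauss_deriv \<beta> t x\<bar> \<le> C / t ^ (CARD('n) + multi_order \<beta>)" for x
    using C t by (intro order.trans[OF C(2)] mult_left_le) auto
  then show ?thesis by (intro gauss_integrable_bounded) auto
qed

lemma multi_index_induct [case_names zero incr]:
  fixes \<beta> :: "'n::finite \<Rightarrow> nat"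
  assumes "P (\<lambda>_. 0)" "\<And>i \<beta>. P \<beta> \<Longrightarrow> P (incr i \<beta>)"
  shows "P \<beta>"
proof (induction "multi_order \<beta>" arbitrary: \<beta>)
  case 0
  then have "\<beta> = (\<lambda>_. 0)" by (auto simp: multi_order_def fun_eq_iff)
  then show ?case using assms(1) by simp
next
  case (Suc k)
  then obtain i \<beta>' where "\<beta> = incr i \<beta>'" using incr_cases[of \<beta>] by auto
  then show ?case using Suc assms(2) by simp
qed

lemma gauss_deriv_semigroup_zero:
  fixes \<beta> :: "'n::finite \<Rightarrow> nat"
  assumes t: "t > 0"
  shows "heat \<beta> (gauss_deriv (\<lambda>_. 0) t) (x, t) = gauss_mass TYPE('n) * gauss_deriv \<beta> (sqrt 2 * t) x"
proof (induction \<beta> arbitrary: x rule: multi_index_induct)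
  case zero
  have "heat (\<lambda>_. 0) (gauss_deriv (\<lambda>_. 0) t) (x, t) = gauss_deriv (\<lambda>_. 0) (sqrt 2 * t) x * (\<integral>y. gauss_deriv (\<lambda>_. 0) (t / sqrt 2) (y - (1/2) *\<^sub>R x) \<partial>lborel)"
    unfolding heat_def by (simp add: gauss_deriv_zero_mult[OF t])
  also have "\<dots> = gauss_mass TYPE('n) * gauss_deriv (\<lambda>_. 0) (sqrt 2 * t) x"
    using t by (subst integral_gauss_deriv_zero) auto
  finally show ?case .
next
  case (incr i \<beta>)
  have "((\<lambda>s. heat \<beta> (gauss_deriv (\<lambda>_. 0) t) (x + s *\<^sub>R axis i 1, t)) has_real_derivative
      heat (incr i \<beta>) (gauss_deriv (\<lambda>_. 0) t) (x + 0 *\<^sub>R axis i 1, t)) (at 0)"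
    by (intro heat_has_derivative_axis gauss_integrable_gauss_deriv t)
  moreover have "((\<lambda>s. gauss_mass TYPE('n) * gauss_deriv \<beta> (sqrt 2 * t) (x + s *\<^sub>R axis i 1)) has_real_derivative
      gauss_mass TYPE('n) * gauss_deriv (incr i \<beta>) (sqrt 2 * t) (x + 0 *\<^sub>R axis i 1)) (at 0)"
    using t by (intro DERIV_cmult gauss_deriv_has_derivative_axis) auto
  ultimately show ?case unfolding incr by (auto dest: DERIV_unique)
qed

text \<open>Commutativity of convolution moves all of \<beta> to the second factor; differentiating
  once more in x then puts exactly one derivative on the first.\<close>

lemma gauss_deriv_semigroup_axis:
  fixes \<beta> :: "'n::finite \<Rightarrow> nat"
  assumes t: "t > 0"
  shows "heat (incr i (\<lambda>_. 0)) (gauss_deriv \<beta> t) (x, t) = gauss_mass TYPE('n) * gauss_deriv (incr i \<beta>) (sqrt 2 * t) x"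
proof -
  have comm: "heat (\<lambda>_. 0) (gauss_deriv \<beta> t) (x, t) = gauss_mass TYPE('n) * gauss_deriv \<beta> (sqrt 2 * t) x" for x
  proof -
    have "heat (\<lambda>_. 0) (gauss_deriv \<beta> t) (x, t) = heat \<beta> (gauss_deriv (\<lambda>_. 0) t) (x, t)"
      unfolding heat_def using integral_lborel_affine[of "\<lambda>y. gauss_deriv (\<lambda>_. 0) t (x - y) * gauss_deriv \<beta> t y" "-1" x]
      by (simp add: mult.commute)
    then show ?thesis using gauss_deriv_semigroup_zero[OF t] by simp
  qed
  have "((\<lambda>s. heat (\<lambda>_. 0) (gauss_deriv \<beta> t) (x + s *\<^sub>R axis i 1, t)) has_real_derivative
      heat (incr i (\<lambda>_. 0)) (gauss_deriv \<beta> t) (x + 0 *\<^sub>R axis i 1, t)) (at 0)"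
    by (intro heat_has_derivative_axis gauss_integrable_gauss_deriv t)
  moreover have "((\<lambda>s. gauss_mass TYPE('n) * gauss_deriv \<beta> (sqrt 2 * t) (x + s *\<^sub>R axis i 1)) has_real_derivative
      gauss_mass TYPE('n) * gauss_deriv (incr i \<beta>) (sqrt 2 * t) (x + 0 *\<^sub>R axis i 1)) (at 0)"
    using t by (intro DERIV_cmult gauss_deriv_has_derivative_axis) auto
  ultimately show ?thesis unfolding comm by (auto dest: DERIV_unique)
qed

lemma integrable_lborel_prod_mult:
  fixes f :: "'a::euclidean_space \<Rightarrow> real" and g :: "'b::euclidean_space \<Rightarrow> real"
  assumes f: "integrable lborel f" and g: "integrable lborel g"
  shows "integrable (lborel \<Otimes>\<^sub>M lborel) (\<lambda>(x, y). f x * g y)"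
proof -
  have [measurable]: "f \<in> borel_measurable borel" "g \<in> borel_measurable borel" using f g by auto
  show ?thesis
  proof (rule lborel_pair.Fubini_integrable)
    show "integrable lborel (\<lambda>x. \<integral>y. norm (case (x, y) of (x, y) \<Rightarrow> f x * g y) \<partial>lborel)"
      using f by (simp add: abs_mult)
  qed (use g in auto)
qed

lemma heat_kernels_integrable:
  fixes g :: "real^'n::finite \<Rightarrow> real"
  assumes g: "gauss_integrable g" and t: "t > 0"
  shows "integrable (lborel \<Otimes>\<^sub>M lborel) (\<lambda>(y, z). gauss_deriv \<gamma> t (x - y) * gauss_deriv \<beta> t (y - z) * g z)"
proof -
  have [measurable]: "g \<in> borel_measurable borel" by (rule gauss_integrable_measurable[OF g])
  obtain C1 where C1: "C1 > 0"
    "\<And>x. \<bar>gauss_deriv \<gamma> t x\<bar> \<le> C1 / t ^ (CARD('n) + multi_order \<gamma>) * exp (- (norm x)\<^sup>2 / (8 * t\<^sup>2))"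
    using gauss_deriv_bound[of \<gamma>] t by blast
  obtain C2 where C2: "C2 > 0"
    "\<And>x. \<bar>gauss_deriv \<beta> t x\<bar> \<le> C2 / t ^ (CARD('n) + multi_order \<beta>) * exp (- (norm x)\<^sup>2 / (8 * t\<^sup>2))"
    using gauss_deriv_bound[of \<beta>] t by blast
  \<comment> \<open>The constants come from |z|^2 \<le> 4 |x - y|^2 + 4 |y - z|^2 + 2 |x|^2, divided
    by 64. Half of the Gaussian in x - y is kept for integration in y; the rest, with the Gaussian
    in y - z, pays for a Gaussian in z and leaves the factor depending on x.\<close>
  define C where "C = C1 / t ^ (CARD('n) + multi_order \<gamma>) * (C2 / t ^ (CARD('n) + multi_order \<beta>)) * exp ((norm x)\<^sup>2 / (32 * t\<^sup>2))"
  have i1: "integrable lborel (\<lambda>y. exp (- (1 / (16 * t\<^sup>2)) * (norm (x - y))\<^sup>2))"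
    using integrable_lborel_affine[OF integrable_gaussian, of "1 / (16 * t\<^sup>2)" "-1" x] t by simp
  have i2: "integrable lborel (\<lambda>z. C * (exp (- (1 / (64 * t\<^sup>2)) * (norm z)\<^sup>2) * \<bar>g z\<bar>))"
    using t by (intro gauss_integrable_abs[OF g]) auto
  show ?thesis
  proof (rule Bochner_Integration.integrable_bound[OF integrable_lborel_prod_mult[OF i1 i2]])
    have "\<bar>gauss_deriv \<gamma> t (x - y) * gauss_deriv \<beta> t (y - z) * g z\<bar>
       \<le> exp (- (1 / (16 * t\<^sup>2)) * (norm (x - y))\<^sup>2) * (C * (exp (- (1 / (64 * t\<^sup>2)) * (norm z)\<^sup>2) * \<bar>g z\<bar>))" for y z
    proof -
      let ?a = "(norm (x - y))\<^sup>2" and ?b = "(norm (y - z))\<^sup>2"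
      have 1: "(norm (x - z))\<^sup>2 \<le> 2 * ?a + 2 * ?b" using norm_add_power2_le[of "x - y" "y - z"] by simp
      have 2: "(norm z)\<^sup>2 \<le> 2 * (norm (x - z))\<^sup>2 + 2 * (norm x)\<^sup>2" using norm_add_power2_le[of "z - x" x] by (simp add: norm_minus_commute)
      have "(?a + ?b) / (8 * t\<^sup>2) = (?a / 8 + ?b / 8) / t\<^sup>2" by (simp add: add_divide_distrib)
      also have "\<dots> \<ge> (?a / 16 + (norm z)\<^sup>2 / 64 - (norm x)\<^sup>2 / 32) / t\<^sup>2"
        using 1 2 zero_le_power2[of "norm (y - z)"] by (intro divide_right_mono) (linarith, simp)
      finally have "exp (- ?a / (8 * t\<^sup>2)) * exp (- ?b / (8 * t\<^sup>2))
         \<le> exp (- (1 / (16 * t\<^sup>2)) * ?a) * exp (- (1 / (64 * t\<^sup>2)) * (norm z)\<^sup>2) * exp ((norm x)\<^sup>2 / (32 * t\<^sup>2))"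
        unfolding exp_add[symmetric] exp_le_cancel_iff by (simp add: add_divide_distrib diff_divide_distrib)
      moreover have "\<bar>gauss_deriv \<gamma> t (x - y)\<bar> * \<bar>gauss_deriv \<beta> t (y - z)\<bar> \<le>
         (C1 / t ^ (CARD('n) + multi_order \<gamma>) * exp (- ?a / (8 * t\<^sup>2))) *
         (C2 / t ^ (CARD('n) + multi_order \<beta>) * exp (- ?b / (8 * t\<^sup>2)))"
        using C1 C2 t by (intro mult_mono) auto
      ultimately have "\<bar>gauss_deriv \<gamma> t (x - y)\<bar> * \<bar>gauss_deriv \<beta> t (y - z)\<bar> \<le>
         C1 / t ^ (CARD('n) + multi_order \<gamma>) * (C2 / t ^ (CARD('n) + multi_order \<beta>)) *
         (exp (- (1 / (16 * t\<^sup>2)) * ?a) * exp (- (1 / (64 * t\<^sup>2)) * (norm z)\<^sup>2) * exp ((norm x)\<^sup>2 / (32 * t\<^sup>2)))"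
      proof -
        have *: "X \<le> K1 * K2 * E" if "E1 * E2 \<le> E" "X \<le> (K1 * E1) * (K2 * E2)" "0 \<le> K1" "0 \<le> K2" for X K1 K2 E1 E2 E :: real
        proof -
          have "K1 * K2 * (E1 * E2) \<le> K1 * K2 * E" using that by (intro mult_left_mono) auto
          then show ?thesis using that(2) by (simp add: mult_ac)
        qed
        assume "exp (- ?a / (8 * t\<^sup>2)) * exp (- ?b / (8 * t\<^sup>2))
          \<le> exp (- (1 / (16 * t\<^sup>2)) * ?a) * exp (- (1 / (64 * t\<^sup>2)) * (norm z)\<^sup>2) * exp ((norm x)\<^sup>2 / (32 * t\<^sup>2))"
          and "\<bar>gauss_deriv \<gamma> t (x - y)\<bar> * \<bar>gauss_deriv \<beta> t (y - z)\<bar> \<le>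
         (C1 / t ^ (CARD('n) + multi_order \<gamma>) * exp (- ?a / (8 * t\<^sup>2))) *
         (C2 / t ^ (CARD('n) + multi_order \<beta>) * exp (- ?b / (8 * t\<^sup>2)))"
        from *[OF this] show ?thesis using C1(1) C2(1) t by simp
      qed
      then have "\<bar>gauss_deriv \<gamma> t (x - y)\<bar> * \<bar>gauss_deriv \<beta> t (y - z)\<bar> * \<bar>g z\<bar> \<le>
         C1 / t ^ (CARD('n) + multi_order \<gamma>) * (C2 / t ^ (CARD('n) + multi_order \<beta>)) *
         (exp (- (1 / (16 * t\<^sup>2)) * ?a) * exp (- (1 / (64 * t\<^sup>2)) * (norm z)\<^sup>2) * exp ((norm x)\<^sup>2 / (32 * t\<^sup>2))) * \<bar>g z\<bar>"
        by (rule mult_right_mono) simp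
      then show ?thesis unfolding C_def abs_mult by (simp only: mult_ac)
    qed
    then show "AE w in lborel \<Otimes>\<^sub>M lborel. norm (case w of (y, z) \<Rightarrow> gauss_deriv \<gamma> t (x - y) * gauss_deriv \<beta> t (y - z) * g z)
       \<le> norm (case w of (y, z) \<Rightarrow> exp (- (1 / (16 * t\<^sup>2)) * (norm (x - y))\<^sup>2) * (C * (exp (- (1 / (64 * t\<^sup>2)) * (norm z)\<^sup>2) * \<bar>g z\<bar>)))"
      by (intro AE_I2) (auto intro: order.trans[OF _ abs_ge_self])
  qed measurable
qed

text \<open>Times add in the variable t^2, and t^2 + t^2 = (sqrt 2 t)^2. One derivative stays on the
  outer kernel, the remaining ones act on g.\<close>

lemma heat_semigroup:
  fixes g :: "real^'n::finite \<Rightarrow> real"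
  assumes g: "gauss_integrable g" and t: "t > 0"
  shows "gauss_mass TYPE('n) * heat (incr i \<beta>) g (x, sqrt 2 * t)
     = (\<integral>y. gauss_deriv (incr i (\<lambda>_. 0)) t (x - y) * heat \<beta> g (y, t) \<partial>lborel)"
proof -
  let ?e = "incr i (\<lambda>_::'n. 0)"
  have "gauss_mass TYPE('n) * heat (incr i \<beta>) g (x, sqrt 2 * t)
     = (\<integral>z. heat ?e (gauss_deriv \<beta> t) (x - z, t) * g z \<partial>lborel)"
    by (simp add: heat_def[of "incr i \<beta>"] gauss_deriv_semigroup_axis[OF t] mult.assoc)
  also have "\<dots> = (\<integral>z. (\<integral>y. gauss_deriv ?e t (x - y) * gauss_deriv \<beta> t (y - z) * g z \<partial>lborel) \<partial>lborel)"
  proof (intro Bochner_Integration.integral_cong refl)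
    fix z
    have "heat ?e (gauss_deriv \<beta> t) (x - z, t) = (\<integral>y. gauss_deriv ?e t (x - y) * gauss_deriv \<beta> t (y - z) \<partial>lborel)"
      using integral_lborel_affine[of "\<lambda>y. gauss_deriv ?e t (x - z - y) * gauss_deriv \<beta> t y" 1 "- z"]
      by (simp add: heat_def add.commute)
    then show "heat ?e (gauss_deriv \<beta> t) (x - z, t) * g z = (\<integral>y. gauss_deriv ?e t (x - y) * gauss_deriv \<beta> t (y - z) * g z \<partial>lborel)"
      by simp
  qed
  also have "\<dots> = (\<integral>y. (\<integral>z. gauss_deriv ?e t (x - y) * gauss_deriv \<beta> t (y - z) * g z \<partial>lborel) \<partial>lborel)"
    by (rule lborel_pair.Fubini_integral[OF heat_kernels_integrable[OF g t]])
  also have "\<dots> = (\<integral>y. gauss_deriv ?e t (x - y) * heat \<beta> g (y, t) \<partial>lborel)"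
    by (simp add: heat_def mult.assoc)
  finally show ?thesis .
qed

text \<open>A Young-type inequality: a first derivative of the kernel at time s has L^1 norm A / s,
  and the factor s^(-p) cancels the extra weight s^p. The powers of sqrt 2 come from the
  substitution t = sqrt 2 s and from the weight, c0 from the mass in the semigroup identity.\<close>

lemma heat_energy_incr:
  fixes \<beta> :: "'n::finite \<Rightarrow> nat"
  assumes p: "1 \<le> p"
  shows "\<exists>C\<ge>0. \<forall>g. gauss_integrable g \<longrightarrow> heat_energy (b + p) p (heat (incr i \<beta>) g) \<le> ennreal C * heat_energy b p (heat \<beta> g)"
proof -
  let ?e = "incr i (\<lambda>_::'n. 0)"
  define A where "A = (\<integral>y. \<bar>gauss_deriv ?e 1 y\<bar> \<partial>lborel)"
  define c0 where "c0 = gauss_mass TYPE('n)"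
  have A: "A \<ge> 0" by (simp add: A_def)
  have c0: "c0 > 0" by (simp add: c0_def gauss_mass_pos)
  have At: "(\<integral>y. \<bar>gauss_deriv ?e t y\<bar> \<partial>lborel) = A / t" if "t > 0" for t
    using gauss_deriv_abs_integral[OF that, of ?e] by (simp add: A_def)
  let ?C = "sqrt 2 * (sqrt 2 powr (b + p) * (A / c0) powr p)"
  have "heat_energy (b + p) p (heat (incr i \<beta>) g) \<le> ennreal ?C * heat_energy b p (heat \<beta> g)"
    if g: "gauss_integrable g" for g
  proof -
    have [measurable]: "g \<in> borel_measurable borel" by (rule gauss_integrable_measurable[OF g])
    have slice: "(\<integral>\<^sup>+x. ennreal (\<bar>heat (incr i \<beta>) g (x, sqrt 2 * s)\<bar> powr p) \<partial>lborel)
      \<le> ennreal ((A / (c0 * s)) powr p) * (\<integral>\<^sup>+y. ennreal (\<bar>heat \<beta> g (y, s)\<bar> powr p) \<partial>lborel)" if s: "s > 0" for s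
    proof -
      have [measurable]: "(\<lambda>y. heat \<beta> g (y, s)) \<in> borel_measurable borel"
        unfolding heat_def by simp
      have "(\<integral>\<^sup>+x. ennreal (\<bar>heat (incr i \<beta>) g (x, sqrt 2 * s)\<bar> powr p) \<partial>lborel)
        \<le> (\<integral>\<^sup>+x. ennreal (inverse c0 powr p * (A / s) powr (p - 1)) *
            (\<integral>\<^sup>+y. ennreal (\<bar>gauss_deriv ?e s (x - y)\<bar> * \<bar>heat \<beta> g (y, s)\<bar> powr p) \<partial>lborel) \<partial>lborel)"
      proof (intro nn_integral_mono)
        fix x
        have int: "integrable lborel (\<lambda>y. gauss_deriv ?e s (x - y))"
          using integrable_lborel_affine[OF gauss_deriv_integrable[OF s, of ?e], of "-1" x] by simp
        have iA: "(\<integral>y. \<bar>gauss_deriv ?e s (x - y)\<bar> \<partial>lborel) = A / s"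
          using integral_lborel_affine[of "\<lambda>y. \<bar>gauss_deriv ?e s y\<bar>" "-1" x] At[OF s] by simp
        have "heat (incr i \<beta>) g (x, sqrt 2 * s) = inverse c0 * (\<integral>y. gauss_deriv ?e s (x - y) * heat \<beta> g (y, s) \<partial>lborel)"
          using heat_semigroup[OF g s, of i \<beta> x] c0 unfolding c0_def[symmetric] by (simp add: field_simps)
        then have "ennreal (\<bar>heat (incr i \<beta>) g (x, sqrt 2 * s)\<bar> powr p)
           = ennreal (inverse c0 powr p) * ennreal (\<bar>\<integral>y. gauss_deriv ?e s (x - y) * heat \<beta> g (y, s) \<partial>lborel\<bar> powr p)"
          using c0 by (simp add: abs_mult powr_mult ennreal_mult[symmetric])
        also have "\<dots> \<le> ennreal (inverse c0 powr p) * (ennreal ((A / s) powr (p - 1)) *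
            (\<integral>\<^sup>+y. ennreal (\<bar>gauss_deriv ?e s (x - y)\<bar> * \<bar>heat \<beta> g (y, s)\<bar> powr p) \<partial>lborel))"
          using jensen_kernel[OF p int, of "\<lambda>y. heat \<beta> g (y, s)"] iA by (intro mult_left_mono) auto
        finally show "ennreal (\<bar>heat (incr i \<beta>) g (x, sqrt 2 * s)\<bar> powr p)
          \<le> ennreal (inverse c0 powr p * (A / s) powr (p - 1)) *
            (\<integral>\<^sup>+y. ennreal (\<bar>gauss_deriv ?e s (x - y)\<bar> * \<bar>heat \<beta> g (y, s)\<bar> powr p) \<partial>lborel)"
          by (simp add: ennreal_mult mult.assoc)
      qed
      also have "\<dots> = ennreal (inverse c0 powr p * (A / s) powr (p - 1)) *
           (\<integral>\<^sup>+x. (\<integral>\<^sup>+y. ennreal (\<bar>gauss_deriv ?e s (x - y)\<bar> * \<bar>heat \<beta> g (y, s)\<bar> powr p) \<partial>lborel) \<partial>lborel)"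
        by (intro nn_integral_cmult) auto
      also have "(\<integral>\<^sup>+x. (\<integral>\<^sup>+y. ennreal (\<bar>gauss_deriv ?e s (x - y)\<bar> * \<bar>heat \<beta> g (y, s)\<bar> powr p) \<partial>lborel) \<partial>lborel)
         = (\<integral>\<^sup>+y. (\<integral>\<^sup>+x. ennreal (\<bar>gauss_deriv ?e s (x - y)\<bar> * \<bar>heat \<beta> g (y, s)\<bar> powr p) \<partial>lborel) \<partial>lborel)"
        by (intro lborel_pair.Fubini') auto
      also have "\<dots> = (\<integral>\<^sup>+y. ennreal (A / s) * ennreal (\<bar>heat \<beta> g (y, s)\<bar> powr p) \<partial>lborel)"
      proof (intro nn_integral_cong)
        fix y
        have "(\<integral>\<^sup>+x. ennreal \<bar>gauss_deriv ?e s (x - y)\<bar> \<partial>lborel) = (\<integral>\<^sup>+x. ennreal \<bar>gauss_deriv ?e s x\<bar> \<partial>lborel)"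
          using nn_integral_lborel_translation[of "\<lambda>x. ennreal \<bar>gauss_deriv ?e s x\<bar>" "- y"] by simp
        also have "\<dots> = ennreal (A / s)"
          using nn_integral_eq_integral[OF integrable_abs[OF gauss_deriv_integrable[OF s, of ?e]]] At[OF s] by simp
        finally show "(\<integral>\<^sup>+x. ennreal (\<bar>gauss_deriv ?e s (x - y)\<bar> * \<bar>heat \<beta> g (y, s)\<bar> powr p) \<partial>lborel)
          = ennreal (A / s) * ennreal (\<bar>heat \<beta> g (y, s)\<bar> powr p)"
          by (simp add: ennreal_mult nn_integral_multc)
      qed
      also have "\<dots> = ennreal (A / s) * (\<integral>\<^sup>+y. ennreal (\<bar>heat \<beta> g (y, s)\<bar> powr p) \<partial>lborel)"
        by (intro nn_integral_cmult) auto
      also have "ennreal (inverse c0 powr p * (A / s) powr (p - 1)) * (ennreal (A / s) * (\<integral>\<^sup>+y. ennreal (\<bar>heat \<beta> g (y, s)\<bar> powr p) \<partial>lborel))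
        = ennreal ((A / (c0 * s)) powr p) * (\<integral>\<^sup>+y. ennreal (\<bar>heat \<beta> g (y, s)\<bar> powr p) \<partial>lborel)"
      proof -
        have "A / s \<ge> 0" using A s by simp
        moreover have "(A / s) powr (p - 1) * (A / s) = (A / s) powr p"
        proof -
          have "r powr (p - 1) * r = r powr p" if "r \<ge> 0" for r :: real
            using that p by (cases "r = 0") (auto simp: powr_diff)
          then show ?thesis using \<open>A / s \<ge> 0\<close> by blast
        qed
        moreover have "inverse c0 powr p * (A / s) powr p = (A / (c0 * s)) powr p"
          using c0 A s by (simp add: powr_mult[symmetric] field_simps)
        ultimately have "inverse c0 powr p * (A / s) powr (p - 1) * (A / s) = (A / (c0 * s)) powr p"
          by (simp only: mult.assoc)
        then show ?thesis using \<open>A / s \<ge> 0\<close>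
          by (simp only: mult.assoc[symmetric] ennreal_mult[symmetric] mult_nonneg_nonneg powr_ge_zero)
      qed
      finally show ?thesis .
    qed
    have [measurable]: "heat \<gamma> g \<in> borel_measurable (borel \<Otimes>\<^sub>M borel)" for \<gamma>
      using heat_measurable[of g \<gamma>] by (simp add: borel_prod)
    let ?P = "\<lambda>t. (\<integral>\<^sup>+x. ennreal (t powr (b + p) * \<bar>heat (incr i \<beta>) g (x, t)\<bar> powr p) \<partial>lborel) * indicator {0<..} t"
    have "heat_energy (b + p) p (heat (incr i \<beta>) g) = (\<integral>\<^sup>+t. ?P t \<partial>lborel)"
      by (intro heat_energy_eq heat_measurable) auto
    also have "\<dots> = ennreal (sqrt 2) * (\<integral>\<^sup>+s. ?P (0 + sqrt 2 * s) \<partial>lborel)"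
      using nn_integral_real_affine[of ?P "sqrt 2" 0] by simp
    also have "\<dots> \<le> ennreal (sqrt 2) * (\<integral>\<^sup>+s. ennreal (sqrt 2 powr (b + p) * (A / c0) powr p) *
       ((\<integral>\<^sup>+x. ennreal (s powr b * \<bar>heat \<beta> g (x, s)\<bar> powr p) \<partial>lborel) * indicator {0<..} s) \<partial>lborel)"
    proof (intro mult_left_mono, rule nn_integral_mono)
      fix s :: real
      show "?P (0 + sqrt 2 * s) \<le> ennreal (sqrt 2 powr (b + p) * (A / c0) powr p) *
       ((\<integral>\<^sup>+x. ennreal (s powr b * \<bar>heat \<beta> g (x, s)\<bar> powr p) \<partial>lborel) * indicator {0<..} s)"
      proof (cases "s > 0")
        case True
        let ?I = "\<integral>\<^sup>+y. ennreal (\<bar>heat \<beta> g (y, s)\<bar> powr p) \<partial>lborel"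
        have "?P (0 + sqrt 2 * s) = ennreal ((sqrt 2 * s) powr (b + p)) * (\<integral>\<^sup>+x. ennreal (\<bar>heat (incr i \<beta>) g (x, sqrt 2 * s)\<bar> powr p) \<partial>lborel)"
          using True by (simp add: ennreal_mult nn_integral_cmult)
        also have "\<dots> \<le> ennreal ((sqrt 2 * s) powr (b + p)) * (ennreal ((A / (c0 * s)) powr p) * ?I)"
          by (intro mult_left_mono slice True) auto
        also have "\<dots> = ennreal (sqrt 2 powr (b + p) * (A / c0) powr p * s powr b) * ?I"
        proof -
          have "(sqrt 2 * s) powr (b + p) * (A / (c0 * s)) powr p = sqrt 2 powr (b + p) * (A / c0) powr p * s powr b"
            using True A c0 by (simp add: powr_mult powr_divide powr_add)
          then show ?thesis by (simp add: ennreal_mult[symmetric] mult.assoc[symmetric])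
        qed
        also have "\<dots> = ennreal (sqrt 2 powr (b + p) * (A / c0) powr p) * (\<integral>\<^sup>+x. ennreal (s powr b * \<bar>heat \<beta> g (x, s)\<bar> powr p) \<partial>lborel)"
          by (simp add: ennreal_mult nn_integral_cmult mult.assoc)
        finally show ?thesis using True by simp
      qed (simp add: zero_less_mult_iff)
    qed simp
    also have "\<dots> = ennreal (sqrt 2) * (ennreal (sqrt 2 powr (b + p) * (A / c0) powr p) * heat_energy b p (heat \<beta> g))"
      by (subst heat_energy_eq, rule heat_measurable, simp, subst nn_integral_cmult) auto
    also have "\<dots> = ennreal ?C * heat_energy b p (heat \<beta> g)"
      by (simp add: ennreal_mult mult.assoc)
    finally show ?thesis .
  qed
  then show ?thesis by (intro exI[of _ ?C]) auto
qed

theorem heat_energy_bound: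
  fixes \<beta> :: "'n::finite \<Rightarrow> nat"
  assumes p: "1 \<le> p" and s: "0 < s" "s \<le> 1" and \<beta>: "s < real (multi_order \<beta>)"
  shows "\<exists>C\<ge>0. \<forall>g. gauss_integrable g \<longrightarrow>
     heat_energy ((real (multi_order \<beta>) - s) * p - 1) p (heat \<beta> g) \<le> ennreal C * difference_energy s p (\<lambda>h. fdiff (nat \<lfloor>s\<rfloor> + 1) h g)"
proof -
  have pos: "multi_order \<beta> > 0" using \<beta> s by (auto intro: gr0I)
  consider "s < 1" | "s = 1" "even (multi_order \<beta>)" | "s = 1" "odd (multi_order \<beta>)" using s by linarith
  then show ?thesis
  proof cases
    case 1
    then have "nat \<lfloor>s\<rfloor> + 1 = 1" using s by (simp add: floor_unique)
    then show ?thesis using heat_energy_first_difference[OF p s(1) pos] by simp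
  next
    case 2
    then show ?thesis using heat_energy_second_difference_even[OF p s(1) pos] by (simp add: numeral_2_eq_2)
  next
    case 3
    obtain i \<beta>' where i: "\<beta> = incr i \<beta>'" using incr_cases[OF pos] .
    \<comment> \<open>An odd order above s = 1 is at least 3, so an even positive order remains
      after one derivative is split off.\<close>
    have \<beta>': "multi_order \<beta>' > 0" "even (multi_order \<beta>')" using 3 \<beta> i by auto
    obtain C where C: "C \<ge> 0" "\<And>g. gauss_integrable g \<Longrightarrow>
       heat_energy ((real (multi_order \<beta>') - s) * p - 1) p (heat \<beta>' g) \<le> ennreal C * difference_energy s p (\<lambda>h. fdiff 2 h g)"
      using heat_energy_second_difference_even[OF p s(1) \<beta>'] by blast
    obtain C' where C': "C' \<ge> 0" "\<And>g. gauss_integrable g \<Longrightarrow>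
       heat_energy ((real (multi_order \<beta>') - s) * p - 1 + p) p (heat \<beta> g) \<le> ennreal C' * heat_energy ((real (multi_order \<beta>') - s) * p - 1) p (heat \<beta>' g)"
      using heat_energy_incr[OF p, of "(real (multi_order \<beta>') - s) * p - 1" i \<beta>'] unfolding i by blast
    have e: "(real (multi_order \<beta>') - s) * p - 1 + p = (real (multi_order \<beta>) - s) * p - 1"
      unfolding i by (simp add: algebra_simps)
    have "heat_energy ((real (multi_order \<beta>) - s) * p - 1) p (heat \<beta> g) \<le> ennreal (C' * C) * difference_energy s p (\<lambda>h. fdiff 2 h g)"
      if "gauss_integrable g" for g
    proof -
      have "heat_energy ((real (multi_order \<beta>) - s) * p - 1) p (heat \<beta> g) \<le> ennreal C' * (ennreal C * difference_energy s p (\<lambda>h. fdiff 2 h g))"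
        using C'(2)[OF that] C(2)[OF that] unfolding e by (meson mult_left_mono order.trans zero_le)
      then show ?thesis using C C' by (simp add: ennreal_mult mult.assoc)
    qed
    then show ?thesis using C(1) C'(1) 3 by (intro exI[of _ "C' * C"]) (auto simp: numeral_2_eq_2)
  qed
qed

section \<open>Growth of functions with finite difference energy\<close>

lemma ball_borel [measurable, simp]: "ball c r \<in> sets borel"
  by (rule borel_open) simp

lemma AE_lborel_ex:
  assumes "AE x in (lborel :: 'a::euclidean_space measure). P x"
  shows "\<exists>x. P x"
proof (rule ccontr)
  assume "\<nexists>x. P x"
  then have "AE x in (lborel :: 'a measure). False" using assms by auto
  then have "emeasure (lborel :: 'a measure) UNIV = 0"
    using AE_iff_null[of "lborel :: 'a measure" "\<lambda>_. False"] by auto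
  then show False by simp
qed

lemma nn_integral_le_exhaustion:
  assumes [measurable]: "f \<in> borel_measurable M" "\<And>n. A n \<in> sets M"
    and inc: "incseq A" "space M \<subseteq> (\<Union>n. A n)"
    and le: "\<And>n. (\<integral>\<^sup>+x. f x * indicator (A n) x \<partial>M) \<le> B"
  shows "(\<integral>\<^sup>+x. f x \<partial>M) \<le> B"
proof -
  have "(\<integral>\<^sup>+x. f x \<partial>M) = (\<integral>\<^sup>+x. (SUP n. f x * indicator (A n) x) \<partial>M)"
  proof (intro nn_integral_cong antisym)
    fix x assume "x \<in> space M"
    then obtain n where "x \<in> A n" using inc by blast
    then show "f x \<le> (SUP n. f x * indicator (A n) x)" by (intro SUP_upper2[of n]) auto
    show "(SUP n. f x * indicator (A n) x) \<le> f x" by (intro SUP_least) (auto simp: indicator_def)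
  qed
  also have "\<dots> = (SUP n. \<integral>\<^sup>+x. f x * indicator (A n) x \<partial>M)"
  proof (intro nn_integral_monotone_convergence_SUP)
    show "incseq (\<lambda>n x. f x * indicator (A n) x)"
      using inc(1) by (auto simp: incseq_def le_fun_def indicator_def subset_eq)
  qed measurable
  also have "\<dots> \<le> B" by (intro SUP_least le)
  finally show ?thesis .
qed

text \<open>Finiteness of x is essential, since x = \<infinity> satisfies the second hypothesis for
  every a. This is why absorption is carried out on bounded sets, uniformly, before passing to the
  whole space.\<close>

lemma ennreal_absorb_half:
  fixes x a :: ennreal
  assumes "x < \<infinity>" "x \<le> a + ennreal (1/2) * x"
  shows "x \<le> 2 * a"
proof (cases a)
  case (real r)
  obtain y where y: "x = ennreal y" "y \<ge> 0" using assms(1) by (cases x) auto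
  have "ennreal y \<le> ennreal (r + 1/2 * y)"
  proof -
    have "ennreal (1/2) * ennreal y = ennreal (1/2 * y)" by (rule ennreal_mult[symmetric]) (use y in auto)
    moreover have "ennreal (r + 1/2 * y) = ennreal r + ennreal (1/2 * y)" by (rule ennreal_plus) (use real y in auto)
    ultimately show ?thesis using assms(2) by (simp only: y real)
  qed
  then have "y \<le> r + 1/2 * y" using real y by (subst (asm) ennreal_le_iff) auto
  then have "ennreal y \<le> ennreal (2 * r)" by (intro ennreal_leI) simp
  then show ?thesis using y real by (simp add: ennreal_mult)
next
  case top
  then show ?thesis by (simp add: ennreal_mult_top)
qed

lemma powr_add_le: "\<bar>a + b\<bar> powr p \<le> 2 powr p * (\<bar>a\<bar> powr p + \<bar>b\<bar> powr p)" if "p \<ge> 0" for a b p :: real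
proof -
  have "\<bar>a + b\<bar> powr p \<le> (2 * max \<bar>a\<bar> \<bar>b\<bar>) powr p" using that by (intro powr_mono2) auto
  also have "\<dots> = 2 powr p * (max \<bar>a\<bar> \<bar>b\<bar>) powr p" by (simp add: powr_mult)
  also have "\<dots> \<le> 2 powr p * (\<bar>a\<bar> powr p + \<bar>b\<bar> powr p)"
    by (intro mult_left_mono) (auto simp: max_def)
  finally show ?thesis .
qed

text \<open>Up to a constant the Besov weight r^(-q) dominates every Gaussian: it is unbounded at 0
  and decays more slowly at infinity.\<close>

lemma gaussian_le_powr:
  fixes \<epsilon> q :: real
  assumes "\<epsilon> > 0" "q > 0"
  shows "\<exists>C>0. \<forall>r>0. exp (- \<epsilon> * r\<^sup>2) \<le> C / r powr q"
proof -
  have "((\<lambda>r::real. r powr q * exp (- \<epsilon> * r\<^sup>2)) \<longlongrightarrow> 0) at_top" using assms by real_asymp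
  then have "eventually (\<lambda>r. r powr q * exp (- \<epsilon> * r\<^sup>2) < 1) at_top" by (rule order_tendstoD) simp
  then obtain M where M: "\<And>r. r \<ge> M \<Longrightarrow> r powr q * exp (- \<epsilon> * r\<^sup>2) < 1"
    by (auto simp: eventually_at_top_linorder)
  show ?thesis
  proof (intro exI[of _ "max 1 (\<bar>M\<bar> powr q)"] conjI allI impI)
    fix r :: real assume r: "r > 0"
    have "r powr q * exp (- \<epsilon> * r\<^sup>2) \<le> max 1 (\<bar>M\<bar> powr q)"
    proof (cases "r \<ge> M")
      case True
      then show ?thesis using M[of r] by (intro max.coboundedI1) auto
    next
      case False
      then have "r powr q * exp (- \<epsilon> * r\<^sup>2) \<le> \<bar>M\<bar> powr q * 1"
        using r assms by (intro mult_mono powr_mono2) auto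
      then show ?thesis by simp
    qed
    then show "exp (- \<epsilon> * r\<^sup>2) \<le> max 1 (\<bar>M\<bar> powr q) / r powr q"
      using r by (simp add: pos_le_divide_eq mult.commute)
  qed auto
qed

section \<open>Stability of integrability against Gaussians\<close>

lemma gauss_integrable_iff_nn:
  fixes f :: "real^'n::finite \<Rightarrow> real"
  shows "gauss_integrable f \<longleftrightarrow> f \<in> borel_measurable borel \<and>
     (\<forall>\<epsilon>>0. (\<integral>\<^sup>+y. ennreal (exp (- \<epsilon> * (norm y)\<^sup>2) * \<bar>f y\<bar>) \<partial>lborel) < \<infinity>)"
  unfolding gauss_integrable_def by (auto simp: integrable_iff_bounded abs_mult)

lemma gauss_integrable_add:
  assumes f: "gauss_integrable f" and g: "gauss_integrable g"
  shows "gauss_integrable (\<lambda>x. f x + g x)"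
  using assms unfolding gauss_integrable_def
  by (auto simp: distrib_left intro!: Bochner_Integration.integrable_add)

lemma gauss_integrable_const: "gauss_integrable (\<lambda>_. c)"
  by (rule gauss_integrable_bounded[of _ "\<bar>c\<bar>"]) auto

lemma gauss_integrable_bound:
  assumes f: "gauss_integrable f" and [measurable]: "g \<in> borel_measurable borel" and le: "\<And>x. \<bar>g x\<bar> \<le> \<bar>f x\<bar>"
  shows "gauss_integrable g"
  unfolding gauss_integrable_def
proof (intro conjI allI impI)
  fix \<epsilon> :: real assume "\<epsilon> > 0"
  then have "integrable lborel (\<lambda>y. exp (- \<epsilon> * (norm y)\<^sup>2) * f y)" using f by (simp add: gauss_integrable_def)
  then show "integrable lborel (\<lambda>y. exp (- \<epsilon> * (norm y)\<^sup>2) * g y)"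
    by (rule Bochner_Integration.integrable_bound) (auto simp: abs_mult le)
qed fact

lemma gauss_integrable_translate:
  fixes f :: "real^'n::finite \<Rightarrow> real"
  assumes f: "gauss_integrable f"
  shows "gauss_integrable (\<lambda>y. f (a + y))"
  unfolding gauss_integrable_def
proof (intro conjI allI impI)
  have [measurable]: "f \<in> borel_measurable borel" by (rule gauss_integrable_measurable[OF f])
  show "(\<lambda>y. f (a + y)) \<in> borel_measurable borel" by measurable
  fix \<epsilon> :: real assume e: "\<epsilon> > 0"
  have "integrable lborel (\<lambda>y. exp (- \<epsilon> * (norm (y - a))\<^sup>2) * f y)"
  proof (rule Bochner_Integration.integrable_bound[OF gauss_integrable_abs[OF f, of "\<epsilon> / 2" "exp (\<epsilon> * (norm a)\<^sup>2)"]])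
    have "exp (- \<epsilon> * (norm (y - a))\<^sup>2) \<le> exp (\<epsilon> * (norm a)\<^sup>2) * exp (- (\<epsilon> / 2) * (norm y)\<^sup>2)" for y
    proof -
      have "(norm y)\<^sup>2 \<le> 2 * (norm (y - a))\<^sup>2 + 2 * (norm a)\<^sup>2"
        using norm_add_power2_le[of "y - a" a] by simp
      then have "\<epsilon> * ((norm y)\<^sup>2 / 2 - (norm a)\<^sup>2) \<le> \<epsilon> * (norm (y - a))\<^sup>2"
        using e by (intro mult_left_mono) auto
      then show ?thesis unfolding exp_add[symmetric] by (simp add: right_diff_distrib)
    qed
    from mult_right_mono[OF this abs_ge_zero]
    show "AE y in lborel. norm (exp (- \<epsilon> * (norm (y - a))\<^sup>2) * f y)
       \<le> norm (exp (\<epsilon> * (norm a)\<^sup>2) * (exp (- (\<epsilon> / 2) * (norm y)\<^sup>2) * \<bar>f y\<bar>))"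
      by (intro AE_I2) (simp add: abs_mult mult.assoc)
  qed (use e in auto)
  from integrable_lborel_affine[OF this, of 1 a]
  show "integrable lborel (\<lambda>y. exp (- \<epsilon> * (norm y)\<^sup>2) * f (a + y))" by simp
qed

text \<open>|f| \<le> 1 + |f|^p, and constants are integrable against every Gaussian.\<close>

lemma gauss_integrable_of_powr:
  fixes f :: "real^'n::finite \<Rightarrow> real"
  assumes p: "1 \<le> p" and [measurable]: "f \<in> borel_measurable borel"
    and fin: "\<And>\<epsilon>. \<epsilon> > 0 \<Longrightarrow> (\<integral>\<^sup>+y. ennreal (exp (- \<epsilon> * (norm y)\<^sup>2) * \<bar>f y\<bar> powr p) \<partial>lborel) < \<infinity>"
  shows "gauss_integrable f"
proof -
  have "gauss_integrable (\<lambda>y. \<bar>f y\<bar> powr p)"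
    using fin by (auto simp: gauss_integrable_iff_nn)
  from gauss_integrable_add[OF gauss_integrable_const[of 1] this] show ?thesis
    by (rule gauss_integrable_bound) (use p in \<open>auto intro: order.trans[OF le_one_plus_powr]\<close>)
qed

text \<open>By Tonelli the integral over h against the Besov weight is finite for almost every x.
  One such x is fixed before \<epsilon>, because only the comparison of the Gaussian with the Besov
  weight depends on \<epsilon>.\<close>

lemma difference_energy_finite_slice:
  fixes D :: "(real^'n::finite) \<times> (real^'n) \<Rightarrow> real"
  assumes p: "1 \<le> p" and s: "s > 0" and [measurable]: "D \<in> borel_measurable (borel \<Otimes>\<^sub>M borel)"
    and fin: "difference_energy s p (\<lambda>h x. D (h, x)) < \<infinity>"
  shows "\<exists>x. \<forall>\<epsilon>>0. (\<integral>\<^sup>+h. ennreal (exp (- \<epsilon> * (norm h)\<^sup>2) * \<bar>D (h, x)\<bar> powr p) \<partial>lborel) < \<infinity>"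
proof -
  let ?q = "real CARD('n) + s * p"
  have q: "?q > 0" using p s by (intro add_pos_pos mult_pos_pos) auto
  have "difference_energy s p (\<lambda>h x. D (h, x)) = (\<integral>\<^sup>+h. (\<integral>\<^sup>+x. ennreal (\<bar>D (h, x)\<bar> powr p) / ennreal (norm h powr ?q) \<partial>lborel) \<partial>lborel)"
    unfolding difference_energy_def by (intro nn_integral_cong nn_integral_divide[symmetric]) auto
  also have "\<dots> = (\<integral>\<^sup>+x. (\<integral>\<^sup>+h. ennreal (\<bar>D (h, x)\<bar> powr p) / ennreal (norm h powr ?q) \<partial>lborel) \<partial>lborel)"
    by (intro lborel_pair.Fubini') auto
  finally have "(\<integral>\<^sup>+x. (\<integral>\<^sup>+h. ennreal (\<bar>D (h, x)\<bar> powr p) / ennreal (norm h powr ?q) \<partial>lborel) \<partial>lborel) \<noteq> \<infinity>"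
    using fin by simp
  then have "AE x in lborel. (\<integral>\<^sup>+h. ennreal (\<bar>D (h, x)\<bar> powr p) / ennreal (norm h powr ?q) \<partial>lborel) \<noteq> \<infinity>"
    by (intro nn_integral_PInf_AE) auto
  from AE_lborel_ex[OF this] obtain x
    where x: "(\<integral>\<^sup>+h. ennreal (\<bar>D (h, x)\<bar> powr p) / ennreal (norm h powr ?q) \<partial>lborel) < \<infinity>"
    by (auto simp: less_top)
  show ?thesis
  proof (intro exI[of _ x] allI impI)
    fix \<epsilon> :: real assume "\<epsilon> > 0"
    from gaussian_le_powr[OF this q] obtain C where C: "C > 0" "\<And>r. r > 0 \<Longrightarrow> exp (- \<epsilon> * r\<^sup>2) \<le> C / r powr ?q"
      by blast
    have "(\<integral>\<^sup>+h. ennreal (exp (- \<epsilon> * (norm h)\<^sup>2) * \<bar>D (h, x)\<bar> powr p) \<partial>lborel)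
      \<le> (\<integral>\<^sup>+h. ennreal C * (ennreal (\<bar>D (h, x)\<bar> powr p) / ennreal (norm h powr ?q)) \<partial>lborel)"
    proof (rule nn_integral_mono_AE)
      show "AE h in lborel. ennreal (exp (- \<epsilon> * (norm h)\<^sup>2) * \<bar>D (h, x)\<bar> powr p)
        \<le> ennreal C * (ennreal (\<bar>D (h, x)\<bar> powr p) / ennreal (norm h powr ?q))"
        using AE_lborel_singleton[of "0::real^'n"]
      proof eventually_elim
        case (elim h)
        have "exp (- \<epsilon> * (norm h)\<^sup>2) * \<bar>D (h, x)\<bar> powr p \<le> (C / norm h powr ?q) * \<bar>D (h, x)\<bar> powr p"
          using elim by (intro mult_right_mono C(2)) auto
        also have "\<dots> = C * (\<bar>D (h, x)\<bar> powr p / norm h powr ?q)" by simp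
        finally have "ennreal (exp (- \<epsilon> * (norm h)\<^sup>2) * \<bar>D (h, x)\<bar> powr p) \<le> ennreal (C * (\<bar>D (h, x)\<bar> powr p / norm h powr ?q))"
          by (rule ennreal_leI)
        also have "\<dots> = ennreal C * (ennreal (\<bar>D (h, x)\<bar> powr p) / ennreal (norm h powr ?q))"
        proof -
          have "ennreal (\<bar>D (h, x)\<bar> powr p) / ennreal (norm h powr ?q) = ennreal (\<bar>D (h, x)\<bar> powr p / norm h powr ?q)"
            using elim by (intro divide_ennreal) auto
          then show ?thesis using C(1) by (simp only: ennreal_mult less_imp_le divide_nonneg_nonneg powr_ge_zero)
        qed
        finally show ?case .
      qed
    qed
    also have "\<dots> = ennreal C * (\<integral>\<^sup>+h. ennreal (\<bar>D (h, x)\<bar> powr p) / ennreal (norm h powr ?q) \<partial>lborel)"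
      by (intro nn_integral_cmult) auto
    also have "\<dots> < \<infinity>" using x by (simp add: ennreal_mult_less_top)
    finally show "(\<integral>\<^sup>+h. ennreal (exp (- \<epsilon> * (norm h)\<^sup>2) * \<bar>D (h, x)\<bar> powr p) \<partial>lborel) < \<infinity>" .
  qed
qed

lemma gauss_integrable_first_difference:
  fixes g :: "real^'n::finite \<Rightarrow> real"
  assumes p: "1 \<le> p" and s: "s > 0" and [measurable]: "g \<in> borel_measurable borel"
    and fin: "difference_energy s p (\<lambda>h. fdiff 1 h g) < \<infinity>"
  shows "gauss_integrable g"
proof -
  have "(\<lambda>z. g (snd z + fst z) - g (snd z)) \<in> borel_measurable (borel \<Otimes>\<^sub>M borel)" by measurable
  from difference_energy_finite_slice[OF p s this] fin
  obtain x where x: "\<And>\<epsilon>. \<epsilon> > 0 \<Longrightarrow> (\<integral>\<^sup>+h. ennreal (exp (- \<epsilon> * (norm h)\<^sup>2) * \<bar>g (x + h) - g x\<bar> powr p) \<partial>lborel) < \<infinity>"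
    by auto
  have "gauss_integrable (\<lambda>h. g (x + h) - g x)"
    by (rule gauss_integrable_of_powr[OF p _ x]) auto
  from gauss_integrable_add[OF this gauss_integrable_const[of "g x"]]
  have "gauss_integrable (\<lambda>h. g (x + h))" by simp
  from gauss_integrable_translate[OF this, of "- x"] show ?thesis by simp
qed

lemma exists_gaussian_small:
  assumes "\<epsilon> > 0" "c > 0"
  shows "\<exists>M>0. c * exp (- \<epsilon> * M\<^sup>2) \<le> 1 / (2::real)"
proof -
  have "((\<lambda>M. c * exp (- \<epsilon> * M\<^sup>2)) \<longlongrightarrow> 0) at_top" using assms by real_asymp
  then have "eventually (\<lambda>M. c * exp (- \<epsilon> * M\<^sup>2) < 1/2) at_top" by (rule order_tendstoD) simp
  from eventually_happens[OF eventually_conj[OF this eventually_gt_at_top[of 0]]]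
  show ?thesis by (auto intro: less_imp_le)
qed

text \<open>Subtracting \<open>g x\<close> at a point \<open>x\<close> where the second differences are integrable turns them into a
  quasi-linearity \<open>k (2 h) = 2 k h + D h\<close>; the dilation by 2 then gains more from the Gaussian weight than
  it loses from the factor 2, so the weighted integrals over balls absorb themselves.\<close>

lemma gauss_integrable_quasi_linear:
  fixes k D :: "real^'n::finite \<Rightarrow> real"
  assumes p: "1 \<le> p" and [measurable]: "k \<in> borel_measurable borel" "D \<in> borel_measurable borel"
    and eq: "\<And>h. k (2 *\<^sub>R h) = 2 * k h + D h"
    and loc: "\<And>R. (\<integral>\<^sup>+h. ennreal (\<bar>k h\<bar> powr p) * indicator (ball 0 R) h \<partial>lborel) < \<infinity>"
    and D: "\<And>\<epsilon>. \<epsilon> > 0 \<Longrightarrow> (\<integral>\<^sup>+h. ennreal (exp (- \<epsilon> * (norm h)\<^sup>2) * \<bar>D h\<bar> powr p) \<partial>lborel) < \<infinity>"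
  shows "gauss_integrable k"
proof (rule gauss_integrable_of_powr[OF p])
  fix \<epsilon> :: real assume e: "\<epsilon> > 0"
  \<comment> \<open>2^n is the Jacobian of the dilation, one 2^p comes from splitting the sum, the
    other from |2 k h|^p. At 2 h the exponent 4 \<epsilon> splits as 3 \<epsilon> + \<epsilon>:
    outside the ball of radius M the first part is at most exp (-3 \<epsilon> M^2), and M makes its
    product with c at most 1/2.\<close>
  define c where "c = 2 ^ CARD('n) * (2 powr p * 2 powr p)"
  have c: "c > 0" by (simp add: c_def)
  obtain M where M: "M > 0" "c * exp (- (3 * \<epsilon>) * M\<^sup>2) \<le> 1/2"
    using exists_gaussian_small[of "3 * \<epsilon>" c] e c by auto
  let ?w = "\<lambda>h. ennreal (exp (- \<epsilon> * (norm h)\<^sup>2) * \<bar>k h\<bar> powr p)"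
  define J where "J R = (\<integral>\<^sup>+h. ?w h * indicator (ball 0 R) h \<partial>lborel)" for R
  define L where "L = (\<integral>\<^sup>+h. ennreal (\<bar>k h\<bar> powr p) * indicator (ball 0 M) h \<partial>lborel)"
  define S where "S = (\<integral>\<^sup>+h. ennreal (exp (- (4 * \<epsilon>) * (norm h)\<^sup>2) * \<bar>D h\<bar> powr p) \<partial>lborel)"
  define A where "A = ennreal c * L + ennreal c * S"
  have [measurable]: "(\<lambda>h. ?w h * indicator (ball 0 R) h) \<in> borel_measurable borel" for R
    by measurable
  have S: "S < \<infinity>" unfolding S_def by (rule D) (use e in auto)
  have L: "L < \<infinity>" unfolding L_def by (rule loc)
  have fin: "J R < \<infinity>" for R
  proof -
    have "J R \<le> (\<integral>\<^sup>+h. ennreal (\<bar>k h\<bar> powr p) * indicator (ball 0 R) h \<partial>lborel)"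
      unfolding J_def using e by (intro nn_integral_mono mult_right_mono ennreal_leI mult_left_le_one_le) auto
    then show ?thesis using loc[of R] by simp
  qed
  have rec: "J (2 * R) \<le> A + ennreal (1/2) * J (2 * R)" if R: "R > 0" for R
  proof -
    have "J (2 * R) = ennreal (2 ^ CARD('n)) * (\<integral>\<^sup>+h. ?w (0 + 2 *\<^sub>R h) * indicator (ball 0 (2 * R)) (0 + 2 *\<^sub>R h) \<partial>lborel)"
      unfolding J_def
      by (subst nn_integral_lborel_affine[of "\<lambda>h. ?w h * indicator (ball 0 (2 * R)) h" 2 0]) auto
    also have "\<dots> \<le> ennreal (2 ^ CARD('n)) * (\<integral>\<^sup>+h. ennreal (2 powr p * 2 powr p) *
        (ennreal (\<bar>k h\<bar> powr p) * indicator (ball 0 M) h + ennreal (exp (- (3 * \<epsilon>) * M\<^sup>2)) * (?w h * indicator (ball 0 (2 * R)) h)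
          + ennreal (exp (- (4 * \<epsilon>) * (norm h)\<^sup>2) * \<bar>D h\<bar> powr p)) \<partial>lborel)"
    proof (intro mult_left_mono, rule nn_integral_mono)
      fix h :: "real^'n"
      show "?w (0 + 2 *\<^sub>R h) * indicator (ball 0 (2 * R)) (0 + 2 *\<^sub>R h) \<le> ennreal (2 powr p * 2 powr p) *
        (ennreal (\<bar>k h\<bar> powr p) * indicator (ball 0 M) h + ennreal (exp (- (3 * \<epsilon>) * M\<^sup>2)) * (?w h * indicator (ball 0 (2 * R)) h)
          + ennreal (exp (- (4 * \<epsilon>) * (norm h)\<^sup>2) * \<bar>D h\<bar> powr p))"
      proof (cases "norm h < R")
        case True
        let ?E = "exp (- (4 * \<epsilon>) * (norm h)\<^sup>2)"
        have one: "2 powr p \<ge> 1" using p by (simp add: ge_one_powr_ge_zero)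
        have "\<bar>k (2 *\<^sub>R h)\<bar> powr p \<le> 2 powr p * (\<bar>2 * k h\<bar> powr p + \<bar>D h\<bar> powr p)"
          unfolding eq using p by (intro powr_add_le) auto
        also have "\<dots> = 2 powr p * (2 powr p * \<bar>k h\<bar> powr p + \<bar>D h\<bar> powr p)"
          by (simp add: abs_mult powr_mult)
        also have "\<dots> \<le> 2 powr p * (2 powr p * \<bar>k h\<bar> powr p + 2 powr p * \<bar>D h\<bar> powr p)"
          using mult_right_mono[OF one, of "\<bar>D h\<bar> powr p"] by (intro mult_left_mono) auto
        finally have "?E * \<bar>k (2 *\<^sub>R h)\<bar> powr p \<le> ?E * (2 powr p * (2 powr p * \<bar>k h\<bar> powr p + 2 powr p * \<bar>D h\<bar> powr p))"
          by (intro mult_left_mono) auto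
        also have "\<dots> = 2 powr p * 2 powr p * (?E * \<bar>k h\<bar> powr p + ?E * \<bar>D h\<bar> powr p)"
          by (simp add: algebra_simps)
        also have "?E * \<bar>k h\<bar> powr p \<le> \<bar>k h\<bar> powr p * indicator (ball 0 M) h
            + exp (- (3 * \<epsilon>) * M\<^sup>2) * (exp (- \<epsilon> * (norm h)\<^sup>2) * \<bar>k h\<bar> powr p)"
        proof (cases "norm h < M")
          case True
          have "?E * \<bar>k h\<bar> powr p \<le> \<bar>k h\<bar> powr p" using e by (intro mult_left_le_one_le) auto
          also have "\<dots> \<le> \<bar>k h\<bar> powr p * indicator (ball 0 M) h
            + exp (- (3 * \<epsilon>) * M\<^sup>2) * (exp (- \<epsilon> * (norm h)\<^sup>2) * \<bar>k h\<bar> powr p)"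
            using True by simp
          finally show ?thesis .
        next
          case False
          then have "3 * \<epsilon> * M\<^sup>2 \<le> 3 * \<epsilon> * (norm h)\<^sup>2"
            using e M by (intro mult_left_mono power_mono) auto
          then have "?E \<le> exp (- (3 * \<epsilon>) * M\<^sup>2) * exp (- \<epsilon> * (norm h)\<^sup>2)"
            unfolding exp_add[symmetric] exp_le_cancel_iff by simp
          from mult_right_mono[OF this, of "\<bar>k h\<bar> powr p"] show ?thesis using False by (simp add: mult.assoc)
        qed
        finally have "?E * \<bar>k (2 *\<^sub>R h)\<bar> powr p \<le> 2 powr p * 2 powr p * (\<bar>k h\<bar> powr p * indicator (ball 0 M) h
            + exp (- (3 * \<epsilon>) * M\<^sup>2) * (exp (- \<epsilon> * (norm h)\<^sup>2) * \<bar>k h\<bar> powr p) + ?E * \<bar>D h\<bar> powr p)"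
          by simp
        then have "ennreal (?E * \<bar>k (2 *\<^sub>R h)\<bar> powr p) \<le> ennreal (2 powr p * 2 powr p) * (ennreal (\<bar>k h\<bar> powr p * indicator (ball 0 M) h)
            + ennreal (exp (- (3 * \<epsilon>) * M\<^sup>2) * (exp (- \<epsilon> * (norm h)\<^sup>2) * \<bar>k h\<bar> powr p)) + ennreal (?E * \<bar>D h\<bar> powr p))"
          by (simp add: ennreal_mult[symmetric] ennreal_plus[symmetric] ennreal_leI del: ennreal_plus)
        moreover have "ennreal (\<bar>k h\<bar> powr p * indicator (ball 0 M) h) = ennreal (\<bar>k h\<bar> powr p) * indicator (ball 0 M) h"
          by (simp add: indicator_def)
        \<comment> \<open>The dilated indicator restricts h to norm h < R; enlarging this to the
          ball of radius 2 R makes the same integral J (2 R) reappear on the right.\<close>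
        moreover have "indicator (ball 0 (2 * R)) h = (1::ennreal)" "indicator (ball 0 (2 * R)) (0 + 2 *\<^sub>R h) = (1::ennreal)"
          using True R by simp_all
        moreover have "- \<epsilon> * (norm (0 + 2 *\<^sub>R h))\<^sup>2 = - (4 * \<epsilon>) * (norm h)\<^sup>2" by (simp add: power_mult_distrib)
        moreover have "ennreal (exp (- (3 * \<epsilon>) * M\<^sup>2) * (exp (- \<epsilon> * (norm h)\<^sup>2) * \<bar>k h\<bar> powr p))
          = ennreal (exp (- (3 * \<epsilon>) * M\<^sup>2)) * ennreal (exp (- \<epsilon> * (norm h)\<^sup>2) * \<bar>k h\<bar> powr p)"
          by (rule ennreal_mult) auto
        ultimately show ?thesis by (simp only: mult_1_right add_0)
      qed simp
    qed simp
    also have "\<dots> = ennreal c * (L + ennreal (exp (- (3 * \<epsilon>) * M\<^sup>2)) * J (2 * R) + S)"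
      by (simp add: nn_integral_cmult nn_integral_add J_def L_def S_def c_def ennreal_mult mult.assoc)
    also have "\<dots> = A + ennreal (c * exp (- (3 * \<epsilon>) * M\<^sup>2)) * J (2 * R)"
      using c by (simp add: A_def distrib_left ennreal_mult mult.assoc add_ac)
    also have "\<dots> \<le> A + ennreal (1/2) * J (2 * R)"
      using M by (intro add_left_mono mult_right_mono ennreal_leI) auto
    finally show ?thesis .
  qed
  have "(\<integral>\<^sup>+h. ?w h \<partial>lborel) \<le> 2 * A"
  proof (rule nn_integral_le_exhaustion[where A = "\<lambda>n. ball 0 (2 * (real n + 1))"])
    show "(\<integral>\<^sup>+h. ?w h * indicator (ball 0 (2 * (real n + 1))) h \<partial>lborel) \<le> 2 * A" for n
      using ennreal_absorb_half[OF fin rec[of "real n + 1"]] by (simp add: J_def)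
    show "space (lborel :: (real^'n) measure) \<subseteq> (\<Union>n. ball 0 (2 * (real n + 1)))"
    proof
      fix x :: "real^'n"
      obtain n where "norm x < real n" using reals_Archimedean2 by blast
      then show "x \<in> (\<Union>n. ball 0 (2 * (real n + 1)))" by (intro UN_I[of n]) auto
    qed
  qed (auto simp: incseq_def intro!: subset_ball)
  also have "\<dots> < \<infinity>" using S L by (simp add: A_def ennreal_mult_less_top)
  finally show "(\<integral>\<^sup>+h. ?w h \<partial>lborel) < \<infinity>" .
qed fact

lemma gauss_integrable_second_difference:
  fixes g :: "real^'n::finite \<Rightarrow> real"
  assumes p: "1 \<le> p" and s: "s > 0" and [measurable]: "g \<in> borel_measurable borel"
    and loc: "\<And>R. (\<integral>\<^sup>+h. ennreal (\<bar>g h\<bar> powr p) * indicator (ball 0 R) h \<partial>lborel) < \<infinity>"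
    and fin: "difference_energy s p (\<lambda>h. fdiff 2 h g) < \<infinity>"
  shows "gauss_integrable g"
proof -
  let ?D = "\<lambda>h x. (g (x + h + h) - g (x + h)) - (g (x + h) - g x)"
  have "(\<lambda>z. ?D (fst z) (snd z)) \<in> borel_measurable (borel \<Otimes>\<^sub>M borel)" by measurable
  from difference_energy_finite_slice[OF p s this] fin
  obtain x where x: "\<And>\<epsilon>. \<epsilon> > 0 \<Longrightarrow> (\<integral>\<^sup>+h. ennreal (exp (- \<epsilon> * (norm h)\<^sup>2) * \<bar>?D h x\<bar> powr p) \<partial>lborel) < \<infinity>"
    by (auto simp: numeral_2_eq_2)
  have "gauss_integrable (\<lambda>h. g (x + h) - g x)"
  proof (rule gauss_integrable_quasi_linear[OF p _ _ _ _ x])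
    show "g (x + 2 *\<^sub>R h) - g x = 2 * (g (x + h) - g x) + ?D h x" for h
      by (simp add: scaleR_2 add.assoc)
    fix R
    have "(\<integral>\<^sup>+h. ennreal (\<bar>g (x + h) - g x\<bar> powr p) * indicator (ball 0 R) h \<partial>lborel)
      \<le> (\<integral>\<^sup>+h. ennreal (2 powr p) * (ennreal (\<bar>g (x + h)\<bar> powr p) * indicator (ball 0 (R + norm x)) (x + h)
           + ennreal (\<bar>g x\<bar> powr p) * indicator (ball 0 R) h) \<partial>lborel)"
    proof (rule nn_integral_mono)
      fix h
      show "ennreal (\<bar>g (x + h) - g x\<bar> powr p) * indicator (ball 0 R) h
        \<le> ennreal (2 powr p) * (ennreal (\<bar>g (x + h)\<bar> powr p) * indicator (ball 0 (R + norm x)) (x + h)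
           + ennreal (\<bar>g x\<bar> powr p) * indicator (ball 0 R) h)"
      proof (cases "norm h < R")
        case True
        have "norm (x + h) < R + norm x" using norm_triangle_ineq[of x h] True by simp
        moreover have "ennreal (\<bar>g (x + h) - g x\<bar> powr p) \<le> ennreal (2 powr p * (\<bar>g (x + h)\<bar> powr p + \<bar>g x\<bar> powr p))"
          using powr_add_le[of p "g (x + h)" "- g x"] p by (intro ennreal_leI) auto
        ultimately show ?thesis using True by (simp add: ennreal_mult)
      qed simp
    qed
    also have "\<dots> = ennreal (2 powr p) * ((\<integral>\<^sup>+h. ennreal (\<bar>g (x + h)\<bar> powr p) * indicator (ball 0 (R + norm x)) (x + h) \<partial>lborel)
       + ennreal (\<bar>g x\<bar> powr p) * emeasure lborel (ball (0::real^'n) R))"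
    proof -
      have [measurable]: "(\<lambda>h. indicator (ball 0 (R + norm x)) (x + h) :: ennreal) \<in> borel_measurable borel"
        by (rule measurable_compose[where g = "indicator (ball 0 (R + norm x))" and N = borel])
          (auto intro!: borel_measurable_indicator borel_open)
      show ?thesis
        by (subst nn_integral_cmult, measurable, subst nn_integral_add, measurable, subst nn_integral_cmult_indicator)
          simp_all
    qed
    also have "(\<integral>\<^sup>+h. ennreal (\<bar>g (x + h)\<bar> powr p) * indicator (ball 0 (R + norm x)) (x + h) \<partial>lborel)
       = (\<integral>\<^sup>+h. ennreal (\<bar>g h\<bar> powr p) * indicator (ball 0 (R + norm x)) h \<partial>lborel)"
      by (rule nn_integral_lborel_translation) auto
    finally have "(\<integral>\<^sup>+h. ennreal (\<bar>g (x + h) - g x\<bar> powr p) * indicator (ball 0 R) h \<partial>lborel)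
      \<le> ennreal (2 powr p) * ((\<integral>\<^sup>+h. ennreal (\<bar>g h\<bar> powr p) * indicator (ball 0 (R + norm x)) h \<partial>lborel)
       + ennreal (\<bar>g x\<bar> powr p) * emeasure lborel (ball (0::real^'n) R))" .
    also have "\<dots> < \<infinity>"
      using loc[of "R + norm x"] emeasure_lborel_ball_finite[of "0::real^'n" R]
      by (simp add: ennreal_mult_less_top)
    finally show "(\<integral>\<^sup>+h. ennreal (\<bar>g (x + h) - g x\<bar> powr p) * indicator (ball 0 R) h \<partial>lborel) < \<infinity>" .
  qed measurable
  from gauss_integrable_add[OF this gauss_integrable_const[of "g x"]]
  have "gauss_integrable (\<lambda>h. g (x + h))" by simp
  from gauss_integrable_translate[OF this, of "- x"] show ?thesis by simp
qed

theorem gauss_integrable_difference_energy: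
  fixes g :: "real^'n::finite \<Rightarrow> real"
  assumes p: "1 \<le> p" and s: "0 < s" "s \<le> 1" and g: "g \<in> borel_measurable borel"
    and loc: "\<And>R. (\<integral>\<^sup>+h. ennreal (\<bar>g h\<bar> powr p) * indicator (ball 0 R) h \<partial>lborel) < \<infinity>"
    and fin: "difference_energy s p (\<lambda>h. fdiff (nat \<lfloor>s\<rfloor> + 1) h g) < \<infinity>"
  shows "gauss_integrable g"
proof (cases "s = 1")
  case True
  then show ?thesis
    using gauss_integrable_second_difference[OF p s(1) g loc] fin by (simp add: numeral_2_eq_2)
next
  case False
  then have "nat \<lfloor>s\<rfloor> + 1 = 1" using s by (simp add: floor_unique)
  then show ?thesis using gauss_integrable_first_difference[OF p s(1) g] fin by simp
qed

section \<open>Compactly supported smooth functions of product form\<close>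

text \<open>A test function of one variable with all its derivatives. One R serves every order, as
  derivatives do not enlarge the support.\<close>

definition compact_jet :: "(nat \<Rightarrow> real \<Rightarrow> real) \<Rightarrow> bool" where
  "compact_jet A \<longleftrightarrow> jet A \<and> (\<exists>R. \<forall>k s. R \<le> \<bar>s\<bar> \<longrightarrow> A k s = 0)"

lemma compact_jet_jet [simp]: "compact_jet A \<Longrightarrow> jet A"
  by (simp add: compact_jet_def)

lemma jet_continuous: "jet A \<Longrightarrow> continuous_on S (A k)"
  by (rule continuous_at_imp_continuous_on) (blast intro: DERIV_isCont jetD)

lemma jet_measurable: "jet A \<Longrightarrow> A k \<in> borel_measurable borel"
  by (intro borel_measurable_continuous_onI jet_continuous)

lemma compact_jet_bounded:
  assumes "compact_jet A"
  shows "\<exists>B\<ge>0. \<forall>s. \<bar>A k s\<bar> \<le> B"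
proof -
  obtain R where R: "\<And>s. R \<le> \<bar>s\<bar> \<Longrightarrow> A k s = 0" using assms by (auto simp: compact_jet_def)
  have "compact (A k ` {- \<bar>R\<bar>..\<bar>R\<bar>})"
    using assms by (intro compact_continuous_image jet_continuous) auto
  then obtain B where B: "\<And>s. s \<in> {- \<bar>R\<bar>..\<bar>R\<bar>} \<Longrightarrow> \<bar>A k s\<bar> \<le> B"
    by (meson compact_imp_bounded bounded_real imageI)
  have "\<bar>A k s\<bar> \<le> max B 0" for s
    using B[of s] R[of s] by (cases "s \<in> {- \<bar>R\<bar>..\<bar>R\<bar>}") (auto simp: max_def)
  then show ?thesis by (intro exI[of _ "max B 0"]) auto
qed

lemma jet_affine:
  assumes "jet A"
  shows "jet (\<lambda>k s. c ^ k * A k (c * s + d))"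
  unfolding jet_def
proof (intro allI)
  fix k s
  have "((\<lambda>s. A k (c * s + d)) has_real_derivative A (Suc k) (c * s + d) * c) (at s)"
    by (rule DERIV_chain2[where f = "A k", OF jetD[OF assms]]) (auto intro!: derivative_eq_intros)
  from DERIV_cmult[OF this, of "c ^ k"]
  show "((\<lambda>s. c ^ k * A k (c * s + d)) has_real_derivative c ^ Suc k * A (Suc k) (c * s + d)) (at s)"
    by (simp add: mult_ac)
qed

lemma jet_cmult: "jet A \<Longrightarrow> jet (\<lambda>k s. c * A k s)"
  by (auto simp: jet_def intro!: DERIV_cmult)

definition jet_mult :: "(nat \<Rightarrow> real \<Rightarrow> real) \<Rightarrow> (nat \<Rightarrow> real \<Rightarrow> real) \<Rightarrow> nat \<Rightarrow> real \<Rightarrow> real" where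
  "jet_mult A B m s = (\<Sum>i\<le>m. real (m choose i) * A i s * B (m - i) s)"

text \<open>Pascal's rule in the form needed to differentiate the Leibniz sum once more.\<close>

lemma sum_choose_Suc:
  fixes F :: "nat \<Rightarrow> nat \<Rightarrow> real"
  shows "(\<Sum>i\<le>m. real (m choose i) * (F (Suc i) (m - i) + F i (Suc (m - i)))) = (\<Sum>i\<le>Suc m. real (Suc m choose i) * F i (Suc m - i))"
proof -
  have "(\<Sum>i\<le>Suc m. real (Suc m choose i) * F i (Suc m - i))
     = F 0 (Suc m) + (\<Sum>i\<le>m. real (Suc m choose Suc i) * F (Suc i) (m - i))"
    by (subst sum.atMost_Suc_shift) simp
  also have "(\<Sum>i\<le>m. real (Suc m choose Suc i) * F (Suc i) (m - i))
     = (\<Sum>i\<le>m. real (m choose i) * F (Suc i) (m - i)) + (\<Sum>i\<le>m. real (m choose Suc i) * F (Suc i) (m - i))"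
    by (simp add: sum.distrib[symmetric] distrib_right)
  also have "F 0 (Suc m) + (\<dots>) = (\<Sum>i\<le>m. real (m choose i) * F (Suc i) (m - i)) +
      (F 0 (Suc m) + (\<Sum>i\<le>m. real (m choose Suc i) * F (Suc i) (m - i)))" by simp
  also have "F 0 (Suc m) + (\<Sum>i\<le>m. real (m choose Suc i) * F (Suc i) (m - i))
      = (\<Sum>i\<le>Suc m. real (m choose i) * F i (Suc m - i))"
    by (subst sum.atMost_Suc_shift) simp
  also have "\<dots> = (\<Sum>i\<le>m. real (m choose i) * F i (Suc m - i))" by simp
  also have "\<dots> = (\<Sum>i\<le>m. real (m choose i) * F i (Suc (m - i)))"
    by (intro sum.cong) (auto simp: Suc_diff_le)
  finally show ?thesis by (simp add: sum.distrib distrib_left)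
qed

lemma jet_jet_mult:
  assumes A: "jet A" and B: "jet B"
  shows "jet (jet_mult A B)"
  unfolding jet_def
proof (intro allI)
  fix m s
  have "((\<lambda>s. \<Sum>i\<le>m. real (m choose i) * (A i s * B (m - i) s)) has_real_derivative
     (\<Sum>i\<le>m. real (m choose i) * (A (Suc i) s * B (m - i) s + B (Suc (m - i)) s * A i s))) (at s)"
    by (intro DERIV_sum DERIV_cmult DERIV_mult jetD A B)
  also have "(\<Sum>i\<le>m. real (m choose i) * (A (Suc i) s * B (m - i) s + B (Suc (m - i)) s * A i s)) = jet_mult A B (Suc m) s"
    using sum_choose_Suc[of m "\<lambda>i j. A i s * B j s"] by (simp add: jet_mult_def mult.assoc mult.commute[of "B _ _" "A _ _"])
  finally show "(jet_mult A B m has_real_derivative jet_mult A B (Suc m) s) (at s)"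
    by (simp add: jet_mult_def[abs_def] mult.assoc)
qed

lemma jet_mult_0: "jet_mult A B 0 s = A 0 s * B 0 s"
  by (simp add: jet_mult_def)

lemma compact_jet_mult:
  assumes "jet A" "compact_jet B"
  shows "compact_jet (jet_mult A B)"
proof -
  obtain R where "\<And>k s. R \<le> \<bar>s\<bar> \<Longrightarrow> B k s = 0" using assms by (auto simp: compact_jet_def)
  then have "jet_mult A B k s = 0" if "R \<le> \<bar>s\<bar>" for k s using that by (simp add: jet_mult_def)
  then show ?thesis using assms by (auto simp: compact_jet_def intro!: jet_jet_mult)
qed

text \<open>The derivatives of \<open>exp (-1/s)\<close> at \<open>s > 0\<close> are polynomials in \<open>1/s\<close> times \<open>exp (-1/s)\<close>.\<close>

primrec bump_poly :: "nat \<Rightarrow> real poly" where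
  "bump_poly 0 = 1"
| "bump_poly (Suc k) = [:0, 0, 1:] * (bump_poly k - pderiv (bump_poly k))"

definition bump :: "nat \<Rightarrow> real \<Rightarrow> real" where
  "bump k s = (if s \<le> 0 then 0 else poly (bump_poly k) (1 / s) * exp (- (1 / s)))"

lemma tendsto_poly_exp_0: "((\<lambda>y. poly P y * exp (- y)) \<longlongrightarrow> (0::real)) at_top"
proof -
  have "((\<lambda>y. \<Sum>i\<le>degree P. coeff P i * (y ^ i / exp y)) \<longlongrightarrow> (\<Sum>i\<le>degree P. coeff P i * 0)) at_top"
    by (intro tendsto_intros tendsto_power_div_exp_0)
  then show ?thesis by (simp add: poly_altdef exp_minus sum_distrib_right divide_inverse mult.assoc)
qed

lemma jet_bump: "jet bump"
  unfolding jet_def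
proof (intro allI)
  fix k and s :: real
  consider "s < 0" | "s > 0" | "s = 0" by linarith
  then show "(bump k has_real_derivative bump (Suc k) s) (at s)"
  proof cases
    case 1
    have "((\<lambda>_. 0) has_real_derivative bump (Suc k) s) (at s)" using 1 by (simp add: bump_def)
    then show ?thesis
      by (rule has_field_derivative_transform_within_open[where S = "{..<0}"]) (use 1 in \<open>auto simp: bump_def\<close>)
  next
    case 2
    have inv: "((\<lambda>s. 1 / s) has_real_derivative - (1 / s)\<^sup>2) (at s)"
      using 2 by (auto intro!: derivative_eq_intros simp: power2_eq_square)
    have "((\<lambda>s. poly (bump_poly k) (1 / s) * exp (- (1 / s))) has_real_derivative
        poly (pderiv (bump_poly k)) (1 / s) * (- (1 / s)\<^sup>2) * exp (- (1 / s)) +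
        exp (- (1 / s)) * - (- (1 / s)\<^sup>2) * poly (bump_poly k) (1 / s)) (at s)"
      by (intro DERIV_mult DERIV_chain2[where f = "poly (bump_poly k)", OF poly_DERIV inv]
          DERIV_chain2[where f = exp, OF DERIV_exp] DERIV_minus inv)
    also have "poly (pderiv (bump_poly k)) (1 / s) * (- (1 / s)\<^sup>2) * exp (- (1 / s)) +
        exp (- (1 / s)) * - (- (1 / s)\<^sup>2) * poly (bump_poly k) (1 / s) = bump (Suc k) s"
      using 2 by (simp add: bump_def power2_eq_square algebra_simps)
    finally show ?thesis
      by (rule has_field_derivative_transform_within_open[where S = "{0<..}"]) (use 2 in \<open>auto simp: bump_def\<close>)
  next
    case 3
    have "((\<lambda>h. (bump k (0 + h) - bump k 0) / h) \<longlongrightarrow> 0) (at 0)"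
    proof (rule filterlim_split_at)
      have "eventually (\<lambda>h. h < 0) (at_left (0::real))" by (simp add: eventually_at_filter)
      then have "eventually (\<lambda>h. (bump k (0 + h) - bump k 0) / h = 0) (at_left 0)"
        by eventually_elim (simp add: bump_def)
      then show "((\<lambda>h. (bump k (0 + h) - bump k 0) / h) \<longlongrightarrow> 0) (at_left 0)"
        by (rule tendsto_eventually)
      \<comment> \<open>With y = 1 / h the right difference quotient at 0 is y P(y) exp (-y); the
        polynomial [:0, 1:] supplies the factor y from the division by h.\<close>
      have "((\<lambda>y. poly ([:0, 1:] * bump_poly k) y * exp (- y)) \<longlongrightarrow> 0) at_top" by (rule tendsto_poly_exp_0)
      from filterlim_compose[OF this filterlim_inverse_at_top_right]
      have "((\<lambda>h. poly ([:0, 1:] * bump_poly k) (inverse h) * exp (- inverse h)) \<longlongrightarrow> 0) (at_right 0)" .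
      moreover have "eventually (\<lambda>h. h > 0) (at_right (0::real))" by (simp add: eventually_at_filter)
      then have "eventually (\<lambda>h. poly ([:0, 1:] * bump_poly k) (inverse h) * exp (- inverse h) = (bump k (0 + h) - bump k 0) / h) (at_right 0)"
        by eventually_elim (simp add: bump_def divide_inverse mult_ac)
      ultimately show "((\<lambda>h. (bump k (0 + h) - bump k 0) / h) \<longlongrightarrow> 0) (at_right 0)"
        by (rule Lim_transform_eventually)
    qed
    then show ?thesis using 3 by (simp add: DERIV_def bump_def)
  qed
qed

lemma bump_0: "bump 0 s = (if s \<le> 0 then 0 else exp (- (1 / s)))"
  by (simp add: bump_def)

text \<open>A smooth bump supported in [a, b]; c > 0 is its steepness. At order 0 it lies between 0
  and 1 and tends to the indicator of the open interval as c grows.\<close>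

definition bump_between :: "real \<Rightarrow> real \<Rightarrow> real \<Rightarrow> nat \<Rightarrow> real \<Rightarrow> real" where
  "bump_between c a b = jet_mult (\<lambda>k s. c ^ k * bump k (c * s + (- c * a))) (\<lambda>k s. (- c) ^ k * bump k (- c * s + c * b))"

lemma compact_jet_bump_between:
  assumes "c > 0"
  shows "compact_jet (bump_between c a b)"
  unfolding compact_jet_def
proof (intro conjI exI allI impI)
  show "jet (bump_between c a b)"
    unfolding bump_between_def by (intro jet_jet_mult jet_affine jet_bump)
  fix k s assume "\<bar>a\<bar> + \<bar>b\<bar> \<le> \<bar>s\<bar>"
  then have "s \<le> a \<or> b \<le> s" by linarith
  then have "c * s + (- c * a) \<le> 0 \<or> - c * s + c * b \<le> 0"
    using assms by (auto simp: mult_le_cancel_left)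
  then show "bump_between c a b k s = 0"
    by (auto simp: bump_between_def jet_mult_def bump_def)
qed

lemma bump_between_0:
  assumes "c > 0"
  shows "bump_between c a b 0 s = (if a < s \<and> s < b then exp (- (1 / (c * (s - a)))) * exp (- (1 / (c * (b - s)))) else 0)"
  using assms by (auto simp: bump_between_def jet_mult_0 bump_0 algebra_simps mult_le_cancel_left)

text \<open>Both exponentials of the bump on (-1, 1) equal exp (-1) at 0, so the factor exp 2
  normalises the value there to 1.\<close>

definition cutoff :: "nat \<Rightarrow> real \<Rightarrow> real" where
  "cutoff k s = exp 2 * bump_between 1 (-1) 1 k s"

lemma compact_jet_cutoff: "compact_jet cutoff"
  using compact_jet_bump_between[of 1 "-1" 1] by (auto simp: compact_jet_def cutoff_def[abs_def] intro!: jet_cmult)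

lemma cutoff_0_0: "cutoff 0 0 = 1"
  by (simp add: cutoff_def bump_between_0 exp_add[symmetric])

section \<open>Products of functions of one variable as test functions\<close>

lemma tensor_continuous:
  assumes "\<And>i. jet (D i)"
  shows "continuous_on S (tensor D \<beta>)"
proof -
  have "continuous_on S (\<lambda>x. D i (\<beta> i) (x $ i))" for i
    by (rule continuous_on_compose2[OF jet_continuous[OF assms, of UNIV]]) (auto intro!: continuous_intros)
  then show ?thesis unfolding tensor_def[abs_def] by (intro continuous_on_prod) auto
qed

lemma tensor_measurable:
  assumes "\<And>i. jet (D i)"
  shows "tensor D \<beta> \<in> borel_measurable borel"
  by (intro borel_measurable_continuous_onI tensor_continuous assms)

text \<open>Translates the coordinate lists of \<open>has_weak_deriv\<close> into multi-indices; for
  products only the multiplicities in the list matter.\<close>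

lemma partials_tensor:
  fixes D :: "'n::finite \<Rightarrow> nat \<Rightarrow> real \<Rightarrow> real"
  assumes "\<And>i. jet (D i)"
  shows "partials (map (\<lambda>i. axis i 1) is) (tensor D (\<lambda>_. 0)) = tensor D (count_list is)"
proof (induction "is")
  case (Cons i "is")
  have inc: "count_list (i # is) = incr i (count_list is)" by (auto simp: incr_def fun_eq_iff)
  show ?case
  proof
    fix x
    have "partials (map (\<lambda>i. axis i 1) (i # is)) (tensor D (\<lambda>_. 0)) x = deriv (\<lambda>s. tensor D (count_list is) (x + s *\<^sub>R axis i 1)) 0"
      using Cons by (simp add: partial_def)
    also have "\<dots> = tensor D (count_list (i # is)) x"
      unfolding inc using tensor_has_derivative_axis[of D i "count_list is" x 0, OF assms]
      by (intro DERIV_imp_deriv) simp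
    finally show "partials (map (\<lambda>i. axis i 1) (i # is)) (tensor D (\<lambda>_. 0)) x = tensor D (count_list (i # is)) x" .
  qed
next
  case Nil
  have "count_list ([]::'n list) = (\<lambda>_. 0)" by auto
  then show ?case by simp
qed

lemma compact_jets_uniform:
  fixes D :: "'n::finite \<Rightarrow> nat \<Rightarrow> real \<Rightarrow> real"
  assumes "\<And>i. compact_jet (D i)"
  obtains R where "R > 0" "\<And>i k s. R \<le> \<bar>s\<bar> \<Longrightarrow> D i k s = 0"
proof -
  have "\<forall>i. \<exists>R. \<forall>k s. R \<le> \<bar>s\<bar> \<longrightarrow> D i k s = 0" using assms by (auto simp: compact_jet_def)
  then obtain R where R: "\<And>i k s. R i \<le> \<bar>s\<bar> \<Longrightarrow> D i k s = 0" by metis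
  have "R i \<le> Max (insert 1 (range R))" for i by (intro Max_ge) auto
  moreover have "Max (insert 1 (range R)) > 0" by (simp add: Max_gr_iff)
  ultimately show thesis using R by (intro that[of "Max (insert 1 (range R))"]) (auto intro: order.trans)
qed

lemma tensor_support:
  fixes D :: "'n::finite \<Rightarrow> nat \<Rightarrow> real \<Rightarrow> real"
  assumes "\<And>i. compact_jet (D i)"
  shows "\<exists>R>0. \<forall>\<beta> x. R \<le> norm x \<longrightarrow> tensor D \<beta> x = 0"
proof -
  obtain R where R: "R > 0" "\<And>i k s. R \<le> \<bar>s\<bar> \<Longrightarrow> D i k s = 0" using compact_jets_uniform[of D] assms by blast
  have "tensor D \<beta> x = 0" if "real CARD('n) * R \<le> norm x" for \<beta> x
  proof -
    have "\<exists>i. R \<le> \<bar>x $ i\<bar>"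
    proof (rule ccontr)
      assume "\<nexists>i. R \<le> \<bar>x $ i\<bar>"
      then have "(\<Sum>i\<in>UNIV. \<bar>x $ i\<bar>) < (\<Sum>i\<in>(UNIV::'n set). R)" by (intro sum_strict_mono) (auto simp: not_le)
      then show False using that norm_le_l1_cart[of x] by simp
    qed
    then obtain i where "R \<le> \<bar>x $ i\<bar>" ..
    then show ?thesis unfolding tensor_def using R(2) by (intro prod_zero) auto
  qed
  moreover have "real CARD('n) * R > 0" using R by simp
  ultimately show ?thesis by blast
qed

lemma tensor_bounded:
  fixes D :: "'n::finite \<Rightarrow> nat \<Rightarrow> real \<Rightarrow> real"
  assumes "\<And>i. compact_jet (D i)"
  shows "\<exists>B\<ge>0. \<forall>x. \<bar>tensor D \<beta> x\<bar> \<le> B"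
proof -
  have "\<forall>i. \<exists>B\<ge>0. \<forall>s. \<bar>D i (\<beta> i) s\<bar> \<le> B" using compact_jet_bounded[OF assms] by blast
  then obtain B where B: "\<And>i. B i \<ge> 0" "\<And>i s. \<bar>D i (\<beta> i) s\<bar> \<le> B i" by metis
  show ?thesis
    unfolding tensor_def abs_prod
    by (intro exI[of _ "\<Prod>i\<in>UNIV. B i"] conjI allI prod_nonneg prod_mono) (use B in auto)
qed

lemma Basis_list_vec:
  fixes bs :: "(real^'n::finite) list"
  assumes "set bs \<subseteq> Basis"
  shows "\<exists>is. bs = map (\<lambda>i. axis i 1) is"
  unfolding ex_map_conv using assms by (auto simp: Basis_vec_def)

lemma test_function_tensor:
  fixes D :: "'n::finite \<Rightarrow> nat \<Rightarrow> real \<Rightarrow> real"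
  assumes D: "\<And>i. compact_jet (D i)"
  shows "test_function (tensor D (\<lambda>_. 0))"
  unfolding test_function_def
proof (intro conjI allI)
  have jet: "\<And>i. jet (D i)" using D by simp
  show "Ck_on k (tensor D (\<lambda>_. 0)) UNIV" for k
    unfolding Ck_on_def
  proof (intro allI impI conjI ballI)
    fix bs :: "(real^'n) list" assume "set bs \<subseteq> Basis"
    then obtain "is" where bs: "bs = map (\<lambda>i. axis i 1) is" using Basis_list_vec by blast
    show "continuous_on UNIV (partials bs (tensor D (\<lambda>_. 0)))"
      unfolding bs partials_tensor[OF jet] by (rule tensor_continuous[OF jet])
    fix b x :: "real^'n" assume "b \<in> Basis"
    then obtain i where b: "b = axis i 1" by (auto simp: Basis_vec_def)
    show "(\<lambda>s. partials bs (tensor D (\<lambda>_. 0)) (x + s *\<^sub>R b)) differentiable (at 0)"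
      unfolding bs partials_tensor[OF jet] b
      using tensor_has_derivative_axis[of D i "count_list is" x 0, OF jet]
      by (auto simp: differentiable_def has_field_derivative_def)
  qed
  obtain R where R: "R > 0" "\<And>\<beta> x. R \<le> norm x \<Longrightarrow> tensor D \<beta> x = 0" using tensor_support[of D] D by auto
  have "{x. tensor D (\<lambda>_. 0) x \<noteq> 0} \<subseteq> ball 0 R" using R(2) by (force simp: not_le)
  then have "bounded {x. tensor D (\<lambda>_. 0) x \<noteq> 0}" by (rule bounded_subset[OF bounded_ball])
  then show "compact (closure {x. tensor D (\<lambda>_. 0) x \<noteq> 0})" by (simp add: compact_closure)
qed

lemma exists_count_list:
  fixes \<alpha> :: "'n::finite \<Rightarrow> nat"
  shows "\<exists>is. \<forall>i. count_list is i = \<alpha> i"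
proof (induction \<alpha> rule: multi_index_induct)
  case zero
  show ?case by (intro exI[of _ "[]"]) auto
next
  case (incr i \<alpha>)
  then obtain "is" where "\<forall>j. count_list is j = \<alpha> j" by blast
  then show ?case by (intro exI[of _ "i # is"]) (auto simp: incr_def)
qed

section \<open>Weak derivatives tested by products\<close>

definition loc_integrable :: "('a::euclidean_space \<Rightarrow> real) \<Rightarrow> bool" where
  "loc_integrable f \<longleftrightarrow> f \<in> borel_measurable borel \<and>
     (\<forall>R. (\<integral>\<^sup>+x. ennreal \<bar>f x\<bar> * indicator (ball 0 R) x \<partial>lborel) < \<infinity>)"

lemma loc_integrable_measurable: "loc_integrable f \<Longrightarrow> f \<in> borel_measurable borel"
  by (simp add: loc_integrable_def)

lemma loc_integrable_ball:
  assumes "loc_integrable f"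
  shows "integrable lborel (\<lambda>x. f x * indicator (ball 0 R) x)"
proof -
  have [measurable]: "f \<in> borel_measurable borel" using assms by (rule loc_integrable_measurable)
  have "(\<integral>\<^sup>+x. ennreal (norm (f x * indicator (ball 0 R) x)) \<partial>lborel) = (\<integral>\<^sup>+x. ennreal \<bar>f x\<bar> * indicator (ball 0 R) x \<partial>lborel)"
    by (intro nn_integral_cong) (auto simp: indicator_def)
  then show ?thesis using assms by (simp add: integrable_iff_bounded loc_integrable_def)
qed

lemma loc_integrableI:
  assumes "f \<in> borel_measurable borel" "\<And>R. integrable lborel (\<lambda>x. f x * indicator (ball 0 R) x)"
  shows "loc_integrable f"
  unfolding loc_integrable_def
proof (intro conjI allI)
  fix R
  have "(\<integral>\<^sup>+x. ennreal (norm (f x * indicator (ball 0 R) x)) \<partial>lborel) = (\<integral>\<^sup>+x. ennreal \<bar>f x\<bar> * indicator (ball 0 R) x \<partial>lborel)"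
    by (intro nn_integral_cong) (auto simp: indicator_def)
  then show "(\<integral>\<^sup>+x. ennreal \<bar>f x\<bar> * indicator (ball 0 R) x \<partial>lborel) < \<infinity>"
    using assms(2)[of R] by (simp add: integrable_iff_bounded)
qed fact

lemma loc_integrable_bound:
  assumes f: "loc_integrable f" and \<phi>: "\<phi> \<in> borel_measurable borel"
    and B: "\<And>x. \<bar>\<phi> x\<bar> \<le> B" "\<And>x. R \<le> norm x \<Longrightarrow> \<phi> x = 0"
  shows "integrable lborel (\<lambda>x. f x * \<phi> x)"
proof -
  have [measurable]: "f \<in> borel_measurable borel" "\<phi> \<in> borel_measurable borel"
    using f \<phi> by (auto intro: loc_integrable_measurable)
  show ?thesis
  proof (rule Bochner_Integration.integrable_bound[OF integrable_mult_right[OF loc_integrable_ball[OF f, of R], of B]])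
    have "\<bar>f x\<bar> * \<bar>\<phi> x\<bar> \<le> \<bar>B * (f x * indicator (ball 0 R) x)\<bar>" for x
    proof (cases "norm x < R")
      case True
      then show ?thesis using mult_right_mono[OF order.trans[OF B(1)[of x] abs_ge_self], of "\<bar>f x\<bar>"]
        by (simp add: abs_mult mult.commute)
    qed (use B(2) in auto)
    then show "AE x in lborel. norm (f x * \<phi> x) \<le> norm (B * (f x * indicator (ball 0 R) x))"
      by (simp add: abs_mult)
  qed measurable
qed

lemma loc_integrable_tensor:
  fixes f :: "real^'n::finite \<Rightarrow> real"
  assumes f: "loc_integrable f" and D: "\<And>i. compact_jet (D i)"
  shows "integrable lborel (\<lambda>x. f x * tensor D \<beta> x)"
proof -
  obtain R where "\<And>\<beta> x. R \<le> norm x \<Longrightarrow> tensor D \<beta> x = 0" using tensor_support[of D] D by auto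
  moreover obtain B where "\<And>x. \<bar>tensor D \<beta> x\<bar> \<le> B" using tensor_bounded[of D \<beta>] D by auto
  ultimately show ?thesis
    by (intro loc_integrable_bound[OF f tensor_measurable]) (use D in auto)
qed

lemma loc_integrable_diff:
  assumes "loc_integrable f" "loc_integrable g"
  shows "loc_integrable (\<lambda>x. f x - g x)"
  using assms Bochner_Integration.integrable_diff[OF loc_integrable_ball[OF assms(1)] loc_integrable_ball[OF assms(2)]]
  by (intro loc_integrableI) (auto simp: loc_integrable_def left_diff_distrib)

lemma loc_integrable_translate:
  fixes f :: "'a::euclidean_space \<Rightarrow> real"
  assumes f: "loc_integrable f"
  shows "loc_integrable (\<lambda>x. f (x + a))"
proof (rule loc_integrableI)
  have [measurable]: "f \<in> borel_measurable borel" using f by (rule loc_integrable_measurable)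
  show "(\<lambda>x. f (x + a)) \<in> borel_measurable borel" by measurable
  fix R
  have "integrable lborel (\<lambda>x. f (a + 1 *\<^sub>R x) * indicator (ball 0 (R + norm a)) (a + 1 *\<^sub>R x))"
    by (rule integrable_lborel_affine[OF loc_integrable_ball[OF f]]) simp
  then show "integrable lborel (\<lambda>x. f (x + a) * indicator (ball 0 R) x)"
  proof (rule Bochner_Integration.integrable_bound)
    have "norm (a + x) < R + norm a" if "norm x < R" for x using norm_triangle_ineq[of a x] that by simp
    then show "AE x in lborel. norm (f (x + a) * indicator (ball 0 R) x)
       \<le> norm (f (a + 1 *\<^sub>R x) * indicator (ball 0 (R + norm a)) (a + 1 *\<^sub>R x))"
      by (intro AE_I2) (auto simp: indicator_def add.commute)
  qed measurable
qed

lemma gauss_integrable_loc: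
  fixes f :: "real^'n::finite \<Rightarrow> real"
  assumes f: "gauss_integrable f"
  shows "loc_integrable f"
proof (rule loc_integrableI)
  show [measurable]: "f \<in> borel_measurable borel" by (rule gauss_integrable_measurable[OF f])
  fix R :: real
  show "integrable lborel (\<lambda>x. f x * indicator (ball 0 R) x)"
  proof (rule Bochner_Integration.integrable_bound[OF gauss_integrable_abs[OF f zero_less_one, of "exp (R\<^sup>2)"]])
    have "\<bar>f x\<bar> \<le> exp (R\<^sup>2) * (exp (- 1 * (norm x)\<^sup>2) * \<bar>f x\<bar>)" if "norm x < R" for x
    proof -
      have "(norm x)\<^sup>2 \<le> R\<^sup>2" using that by (intro power_mono) auto
      then have "1 \<le> exp (R\<^sup>2) * exp (- 1 * (norm x)\<^sup>2)" by (simp add: exp_add[symmetric])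
      from mult_right_mono[OF this, of "\<bar>f x\<bar>"] show ?thesis by (simp add: mult.assoc)
    qed
    then show "AE x in lborel. norm (f x * indicator (ball 0 R) x) \<le> norm (exp (R\<^sup>2) * (exp (- 1 * (norm x)\<^sup>2) * \<bar>f x\<bar>))"
      by (intro AE_I2) (auto simp: indicator_def abs_mult)
  qed measurable
qed

section \<open>Functions that vanish against all product test functions\<close>

lemma integral_box_eq_0:
  fixes h :: "real^'n::finite \<Rightarrow> real"
  assumes h: "loc_integrable h"
    and zero: "\<And>D. (\<And>i. compact_jet (D i)) \<Longrightarrow> (\<integral>x. h x * tensor D (\<lambda>_. 0) x \<partial>lborel) = 0"
  shows "integrable lborel (\<lambda>x. h x * indicator (box a b) x)" "(\<integral>x. h x * indicator (box a b) x \<partial>lborel) = 0"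
proof -
  have [measurable]: "h \<in> borel_measurable borel" using h by (rule loc_integrable_measurable)
  have [measurable]: "box a b \<in> sets borel" by simp
  obtain R where R: "box a b \<subseteq> ball 0 R" using bounded_subset_ballD[OF bounded_box, of a b 0] by blast
  show int: "integrable lborel (\<lambda>x. h x * indicator (box a b) x)"
    by (rule loc_integrable_bound[OF h, of _ 1 R]) (use R in \<open>auto simp: indicator_def subset_eq\<close>)
  \<comment> \<open>Steepness m + 1 makes the products converge to the indicator of the box. They
    are at most 1 and vanish outside it, so |h| on the box is a majorant.\<close>
  define D where "D m i = bump_between (real (Suc m)) (a $ i) (b $ i)" for m and i :: 'n
  have D: "compact_jet (D m i)" for m i unfolding D_def by (rule compact_jet_bump_between) simp
  have D0: "tensor (D m) (\<lambda>_. 0) x = (if x \<in> box a b then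
      \<Prod>i\<in>UNIV. exp (- (1 / (real (Suc m) * (x $ i - a $ i)))) * exp (- (1 / (real (Suc m) * (b $ i - x $ i)))) else 0)" for m x
  proof (cases "x \<in> box a b")
    case True
    then show ?thesis by (auto simp: tensor_def D_def bump_between_0 mem_box_cart intro!: prod.cong)
  next
    case False
    then obtain i where "\<not> (a $ i < x $ i \<and> x $ i < b $ i)" by (auto simp: mem_box_cart)
    then have "D m i 0 (x $ i) = 0" by (simp add: D_def bump_between_0)
    then show ?thesis using False by (auto simp: tensor_def intro!: prod_zero)
  qed
  have "(\<lambda>m. \<integral>x. h x * tensor (D m) (\<lambda>_. 0) x \<partial>lborel) \<longlonglongrightarrow> (\<integral>x. h x * indicator (box a b) x \<partial>lborel)"
  proof (rule integral_dominated_convergence[where w = "\<lambda>x. \<bar>h x * indicator (box a b) x\<bar>"])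
    show "(\<lambda>x. h x * tensor (D m) (\<lambda>_. 0) x) \<in> borel_measurable lborel" for m
      using tensor_measurable[of "D m" "\<lambda>_. 0"] D by simp
    show "AE x in lborel. (\<lambda>m. h x * tensor (D m) (\<lambda>_. 0) x) \<longlonglongrightarrow> h x * indicator (box a b) x"
    proof (intro AE_I2 tendsto_mult_left)
      fix x
      show "(\<lambda>m. tensor (D m) (\<lambda>_. 0) x) \<longlonglongrightarrow> indicator (box a b) x"
      proof (cases "x \<in> box a b")
        case True
        have lim: "(\<lambda>m. exp (- (1 / (real (Suc m) * r)))) \<longlonglongrightarrow> 1" if "r > 0" for r :: real
          using that by real_asymp
        have "(\<lambda>m. \<Prod>i\<in>UNIV. exp (- (1 / (real (Suc m) * (x $ i - a $ i)))) * exp (- (1 / (real (Suc m) * (b $ i - x $ i)))))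
           \<longlonglongrightarrow> (\<Prod>i\<in>(UNIV::'n set). 1 * 1)"
          using True by (intro tendsto_prod tendsto_mult lim) (auto simp: mem_box_cart)
        then show ?thesis using True by (simp add: D0)
      qed (simp add: D0)
    qed
    show "AE x in lborel. norm (h x * tensor (D m) (\<lambda>_. 0) x) \<le> \<bar>h x * indicator (box a b) x\<bar>" for m
    proof (intro AE_I2)
      fix x
      show "norm (h x * tensor (D m) (\<lambda>_. 0) x) \<le> \<bar>h x * indicator (box a b) x\<bar>"
      proof (cases "x \<in> box a b")
        case True
        have "tensor (D m) (\<lambda>_. 0) x \<le> 1" "0 \<le> tensor (D m) (\<lambda>_. 0) x"
          using True unfolding D0
          by (auto intro!: prod_le_1 prod_nonneg mult_le_one mult_nonneg_nonneg simp: mem_box_cart less_imp_le)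
        then show ?thesis using True by (simp add: abs_mult mult_left_le)
      qed (simp add: D0)
    qed
  qed (use int in auto)
  then have "(\<lambda>m. 0::real) \<longlonglongrightarrow> (\<integral>x. h x * indicator (box a b) x \<partial>lborel)" using zero[OF D] by simp
  then show "(\<integral>x. h x * indicator (box a b) x \<partial>lborel) = 0" by (simp add: LIMSEQ_const_iff)
qed

lemma enn2real_eqD: "enn2real a = enn2real b \<Longrightarrow> a < top \<Longrightarrow> b < top \<Longrightarrow> a = b"
  by (metis ennreal_enn2real)

text \<open>\<open>ennreal (h x)\<close> and \<open>ennreal (- h x)\<close> are the positive and
  negative parts of h. The measures with these densities agree on open boxes, a generator stable
  under intersection, hence everywhere; so the two parts coincide almost everywhere, which forces h
  = 0.\<close>

lemma AE_zero_if_test_zero: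
  fixes h :: "real^'n::finite \<Rightarrow> real"
  assumes h: "loc_integrable h"
    and zero: "\<And>D. (\<And>i. compact_jet (D i)) \<Longrightarrow> (\<integral>x. h x * tensor D (\<lambda>_. 0) x \<partial>lborel) = 0"
  shows "AE x in lborel. h x = 0"
proof -
  note box = integral_box_eq_0[OF h zero]
  have [measurable]: "h \<in> borel_measurable borel" using h by (rule loc_integrable_measurable)
  let ?p = "\<lambda>x. ennreal (h x)" and ?m = "\<lambda>x. ennreal (- h x)"
  let ?E = "range (\<lambda>(a, b). box a b :: (real^'n) set)"
  have fin: "(\<integral>\<^sup>+x. ennreal (c * h x) * indicator (box a b) x \<partial>lborel) < \<infinity>" if "c = 1 \<or> c = -1" for c a b
  proof -
    have "(\<integral>\<^sup>+x. ennreal (c * h x) * indicator (box a b) x \<partial>lborel) \<le> (\<integral>\<^sup>+x. ennreal (norm (h x * indicator (box a b) x)) \<partial>lborel)"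
      using that by (intro nn_integral_mono) (auto simp: indicator_def intro!: ennreal_leI)
    then show ?thesis using box(1)[of a b] by (auto simp: integrable_iff_bounded)
  qed
  have "density lborel ?p = density lborel ?m"
  proof (rule measure_eqI_generator_eq[where E = ?E and \<Omega> = UNIV and A = "\<lambda>i::nat. box (- (real i *\<^sub>R One)) (real i *\<^sub>R One)"])
    show "Int_stable ?E" by (auto simp: Int_stable_def box_Int_box)
    show "sets (density lborel ?p) = sigma_sets UNIV ?E" "sets (density lborel ?m) = sigma_sets UNIV ?E"
      by (simp_all add: borel_eq_box)
    show "(\<Union>i::nat. box (- (real i *\<^sub>R One)) (real i *\<^sub>R One)) = (UNIV :: (real^'n) set)" by (rule UN_box_eq_UNIV)
    show "emeasure (density lborel ?p) (box (- (real i *\<^sub>R One)) (real i *\<^sub>R One)) \<noteq> \<infinity>" for i :: nat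
      using fin[of 1] by (subst emeasure_density) (auto simp: less_top)
    fix X assume "X \<in> ?E"
    then obtain a b where X: "X = box a b" by auto
    have "integral\<^sup>L lborel (\<lambda>x. h x * indicator X x)
      = enn2real (\<integral>\<^sup>+x. ennreal (h x * indicator X x) \<partial>lborel) - enn2real (\<integral>\<^sup>+x. ennreal (- (h x * indicator X x)) \<partial>lborel)"
      unfolding X by (rule real_lebesgue_integral_def[OF box(1)])
    moreover have "(\<integral>\<^sup>+x. ennreal (h x * indicator X x) \<partial>lborel) = (\<integral>\<^sup>+x. ?p x * indicator X x \<partial>lborel)"
      by (intro nn_integral_cong) (auto simp: indicator_def)
    moreover have "(\<integral>\<^sup>+x. ennreal (- (h x * indicator X x)) \<partial>lborel) = (\<integral>\<^sup>+x. ?m x * indicator X x \<partial>lborel)"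
      by (intro nn_integral_cong) (auto simp: indicator_def)
    ultimately have "enn2real (\<integral>\<^sup>+x. ?p x * indicator X x \<partial>lborel) = enn2real (\<integral>\<^sup>+x. ?m x * indicator X x \<partial>lborel)"
      using box(2)[of a b] X by simp
    moreover have "(\<integral>\<^sup>+x. ?p x * indicator X x \<partial>lborel) < top" "(\<integral>\<^sup>+x. ?m x * indicator X x \<partial>lborel) < top"
      using fin[of 1 a b] fin[of "-1" a b] X by simp_all
    ultimately have "(\<integral>\<^sup>+x. ?p x * indicator X x \<partial>lborel) = (\<integral>\<^sup>+x. ?m x * indicator X x \<partial>lborel)"
      by (rule enn2real_eqD)
    then show "emeasure (density lborel ?p) X = emeasure (density lborel ?m) X"
      using X by (subst (1 2) emeasure_density) auto
  qed auto
  then have "AE x in lborel. ?p x = ?m x" by (intro sigma_finite_measure.density_unique[OF sigma_finite_lborel]) auto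
  then show ?thesis
  proof eventually_elim
    case (elim x)
    show ?case
    proof (cases "h x \<ge> 0")
      case True
      then have "ennreal (- h x) = 0" by (intro ennreal_neg) simp
      with elim have "h x \<le> 0" by (simp only: ennreal_eq_0_iff)
      then show ?thesis using True by simp
    next
      case False
      then have "ennreal (h x) = 0" by (intro ennreal_neg) simp
      with elim have "- h x \<le> 0" by (metis ennreal_eq_0_iff)
      then show ?thesis using False by simp
    qed
  qed
qed

section \<open>Averages over unit segments and differences\<close>

definition jet_avg :: "(nat \<Rightarrow> real \<Rightarrow> real) \<Rightarrow> nat \<Rightarrow> real \<Rightarrow> real" where
  "jet_avg A k s = (\<integral>r. indicator {0..1} r * A k (s - r) \<partial>lborel)"

lemma integrable_avg:
  fixes A :: "real \<Rightarrow> real"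
  assumes "continuous_on UNIV A"
  shows "integrable lborel (\<lambda>r. indicator {0..1} r * A (s - r))"
proof -
  have "continuous_on {0..1} (\<lambda>r. A (s - r))"
    by (rule continuous_on_compose2[OF assms]) (auto intro!: continuous_intros)
  from borel_integrable_compact[OF compact_Icc this] show ?thesis by simp
qed

lemma jet_jet_avg:
  assumes A: "compact_jet A"
  shows "jet (jet_avg A)"
  unfolding jet_def
proof (intro allI)
  fix k s
  have j: "jet A" using A by simp
  obtain B where B: "\<And>s. \<bar>A (Suc k) s\<bar> \<le> B" using compact_jet_bounded[OF A, of "Suc k"] by blast
  have [measurable]: "A k \<in> borel_measurable borel" for k by (rule jet_measurable[OF j])
  show "(jet_avg A k has_real_derivative jet_avg A (Suc k) s) (at s)"
    unfolding jet_avg_def[abs_def]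
  proof (rule has_real_derivative_integral[where d = 1 and w = "\<lambda>r. B * indicator {0..1} r"])
    fix s r :: real
    have "((\<lambda>s. A k (s - r)) has_real_derivative A (Suc k) (s - r) * 1) (at s)"
      by (rule DERIV_chain2[where f = "A k", OF jetD[OF j]]) (auto intro!: derivative_eq_intros)
    from DERIV_cmult[OF this, of "indicator {0..1} r"]
    show "((\<lambda>s. indicator {0..1} r * A k (s - r)) has_real_derivative indicator {0..1} r * A (Suc k) (s - r)) (at s)"
      by simp
    show "\<bar>indicator {0..1} r * A (Suc k) (s - r)\<bar> \<le> B * indicator {0..1} r"
      using B[of "s - r"] by (simp add: indicator_def)
    show "integrable lborel (\<lambda>r. indicator {0..1} r * A k (s - r))"
      by (rule integrable_avg[OF jet_continuous[OF j]])
  qed auto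
qed

lemma compact_jet_jet_avg:
  assumes A: "compact_jet A"
  shows "compact_jet (jet_avg A)"
proof -
  obtain R where R: "\<And>k s. R \<le> \<bar>s\<bar> \<Longrightarrow> A k s = 0" using A by (auto simp: compact_jet_def)
  have "jet_avg A k s = 0" if "R + 1 \<le> \<bar>s\<bar>" for k s
  proof -
    have "indicator {0..1} r * A k (s - r) = 0" for r :: real
      using R[of "s - r" k] that by (auto simp: indicator_def)
    then show ?thesis by (simp only: jet_avg_def Bochner_Integration.integral_zero)
  qed
  then show ?thesis using jet_jet_avg[OF A] by (auto simp: compact_jet_def)
qed

text \<open>The average over [0, 1] is convolution with an indicator, whose derivative is a unit
  backward difference. Averaging a test function thereby turns a weak derivative into a difference
  of f.\<close>

lemma jet_avg_Suc:
  assumes A: "compact_jet A"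
  shows "jet_avg A (Suc k) s = A k s - A k (s - 1)"
proof -
  have j: "jet A" using A by simp
  have "(\<integral>r. A (Suc k) (s - r) * indicator {0..1} r \<partial>lborel) = (- A k (s - 1)) - (- A k (s - 0))"
  proof (rule integral_FTC_Icc_real)
    fix r
    have "((\<lambda>r. A k (s - r)) has_real_derivative A (Suc k) (s - r) * (-1)) (at r)"
      by (rule DERIV_chain2[where f = "A k", OF jetD[OF j]]) (auto intro!: derivative_eq_intros)
    from DERIV_minus[OF this] show "((\<lambda>r. - A k (s - r)) has_real_derivative A (Suc k) (s - r)) (at r)" by simp
    show "isCont (\<lambda>r. A (Suc k) (s - r)) r"
      by (intro continuous_intros isCont_o2[OF _ DERIV_isCont[OF jetD[OF j]]])
  qed simp
  then show ?thesis by (simp add: jet_avg_def mult.commute)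
qed

text \<open>Tested on products only, where the derivative of order \<alpha> is
  \<open>tensor D \<alpha>\<close> and no order of differentiation has to be chosen. By
  \<open>AE_zero_if_test_zero\<close> these still determine g up to null sets among locally
  integrable functions.\<close>

definition weak_partial :: "('n::finite \<Rightarrow> nat) \<Rightarrow> (real^'n \<Rightarrow> real) \<Rightarrow> (real^'n \<Rightarrow> real) \<Rightarrow> bool" where
  "weak_partial \<alpha> f g \<longleftrightarrow> (\<forall>D. (\<forall>i. compact_jet (D i)) \<longrightarrow>
     (\<integral>x. f x * tensor D \<alpha> x \<partial>lborel) = (-1) ^ multi_order \<alpha> * (\<integral>x. g x * tensor D (\<lambda>_. 0) x \<partial>lborel))"

text \<open>Test the identity for g with the derivative along axis i of the product: shifting the
  i-th jet by one again gives a product of compact jets.\<close>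

lemma weak_partial_incr:
  fixes f g h :: "real^'n::finite \<Rightarrow> real"
  assumes g: "weak_partial \<alpha> f g" and h: "weak_partial (incr i \<alpha>) f h"
  shows "weak_partial (incr i (\<lambda>_. 0)) g h"
  unfolding weak_partial_def
proof (intro allI impI)
  fix D :: "'n \<Rightarrow> nat \<Rightarrow> real \<Rightarrow> real" assume D: "\<forall>i. compact_jet (D i)"
  define E where "E = D(i := \<lambda>k. D i (Suc k))"
  have "compact_jet (\<lambda>k. D i (Suc k))"
  proof -
    have "compact_jet (D i)" using D by simp
    then show ?thesis unfolding compact_jet_def jet_def by blast
  qed
  then have E: "\<forall>j. compact_jet (E j)" using D by (auto simp: E_def)
  have t: "tensor E \<beta> = tensor D (incr i \<beta>)" for \<beta>
    unfolding tensor_def E_def incr_def by (intro ext prod.cong) auto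
  have "(-1) ^ multi_order \<alpha> * (\<integral>x. g x * tensor D (incr i (\<lambda>_. 0)) x \<partial>lborel)
      = (-1) ^ multi_order (incr i \<alpha>) * (\<integral>x. h x * tensor D (\<lambda>_. 0) x \<partial>lborel)"
    using g[unfolded weak_partial_def, rule_format, of E] h[unfolded weak_partial_def, rule_format, of D] D E
    by (simp add: t)
  then show "(\<integral>x. g x * tensor D (incr i (\<lambda>_. 0)) x \<partial>lborel)
     = (-1) ^ multi_order (incr i (\<lambda>_. 0)) * (\<integral>x. h x * tensor D (\<lambda>_. 0) x \<partial>lborel)"
    by (cases "even (multi_order \<alpha>)") auto
qed

lemma nn_integral_gauss_avg_finite:
  fixes h :: "real^'n::finite \<Rightarrow> real"
  assumes h: "gauss_integrable h" and e: "\<epsilon> > 0" and v: "norm v \<le> 1"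
  shows "(\<integral>\<^sup>+x. ennreal (exp (- \<epsilon> * (norm x)\<^sup>2)) * (\<integral>\<^sup>+r. ennreal (indicator {0..1} r * \<bar>h (x + r *\<^sub>R v)\<bar>) \<partial>lborel) \<partial>lborel) < \<infinity>"
proof -
  have [measurable]: "h \<in> borel_measurable borel" by (rule gauss_integrable_measurable[OF h])
  \<comment> \<open>From |x|^2 \<le> 2 |x - r v|^2 + 2 |r v|^2 and |r v| \<le> 1: translating by at
    most 1 costs half of the exponent and the factor exp \<epsilon>.\<close>
  define S where "S = (\<integral>\<^sup>+x. ennreal (exp \<epsilon> * (exp (- (\<epsilon> / 2) * (norm x)\<^sup>2) * \<bar>h x\<bar>)) \<partial>lborel)"
  have S: "S < \<infinity>"
  proof -
    have "integrable lborel (\<lambda>x. exp \<epsilon> * (exp (- (\<epsilon> / 2) * (norm x)\<^sup>2) * \<bar>h x\<bar>))"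
      using e by (intro gauss_integrable_abs[OF h]) auto
    then show ?thesis
      unfolding integrable_iff_bounded S_def by (simp only: real_norm_def abs_mult abs_abs abs_exp_cancel)
  qed
  have "(\<integral>\<^sup>+x. ennreal (exp (- \<epsilon> * (norm x)\<^sup>2)) * (\<integral>\<^sup>+r. ennreal (indicator {0..1} r * \<bar>h (x + r *\<^sub>R v)\<bar>) \<partial>lborel) \<partial>lborel)
    = (\<integral>\<^sup>+x. (\<integral>\<^sup>+r. ennreal (exp (- \<epsilon> * (norm x)\<^sup>2) * (indicator {0..1} r * \<bar>h (x + r *\<^sub>R v)\<bar>)) \<partial>lborel) \<partial>lborel)"
    by (intro nn_integral_cong) (simp add: nn_integral_cmult[symmetric] ennreal_mult)
  also have "\<dots> = (\<integral>\<^sup>+r. (\<integral>\<^sup>+x. ennreal (exp (- \<epsilon> * (norm x)\<^sup>2) * (indicator {0..1} r * \<bar>h (x + r *\<^sub>R v)\<bar>)) \<partial>lborel) \<partial>lborel)"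
    by (rule lborel_pair.Fubini'[symmetric]) measurable
  also have "\<dots> \<le> (\<integral>\<^sup>+r. S * indicator {0..1} r \<partial>(lborel :: real measure))"
  proof (intro nn_integral_mono)
    fix r :: real
    show "(\<integral>\<^sup>+x. ennreal (exp (- \<epsilon> * (norm x)\<^sup>2) * (indicator {0..1} r * \<bar>h (x + r *\<^sub>R v)\<bar>)) \<partial>lborel) \<le> S * indicator {0..1} r"
    proof (cases "r \<in> {0..1}")
      case True
      have "(\<integral>\<^sup>+x. ennreal (exp (- \<epsilon> * (norm x)\<^sup>2) * (indicator {0..1} r * \<bar>h (x + r *\<^sub>R v)\<bar>)) \<partial>lborel)
         = (\<integral>\<^sup>+x. ennreal (exp (- \<epsilon> * (norm (- (r *\<^sub>R v) + x))\<^sup>2) * \<bar>h (- (r *\<^sub>R v) + x + r *\<^sub>R v)\<bar>) \<partial>lborel)"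
        using True
        by (subst nn_integral_lborel_translation[where f = "\<lambda>x. ennreal (exp (- \<epsilon> * (norm x)\<^sup>2) * \<bar>h (x + r *\<^sub>R v)\<bar>)"]) auto
      also have "\<dots> \<le> S"
        unfolding S_def
      proof (intro nn_integral_mono ennreal_leI)
        fix x
        have "norm (r *\<^sub>R v) \<le> 1" using True v by (simp add: mult_le_one)
        then have "(norm (r *\<^sub>R v))\<^sup>2 \<le> 1" by (intro power_le_one) auto
        moreover have "(norm x)\<^sup>2 \<le> 2 * (norm (- (r *\<^sub>R v) + x))\<^sup>2 + 2 * (norm (r *\<^sub>R v))\<^sup>2"
          using norm_add_power2_le[of "- (r *\<^sub>R v) + x" "r *\<^sub>R v"] by simp
        ultimately have "(norm x)\<^sup>2 \<le> 2 * (norm (- (r *\<^sub>R v) + x))\<^sup>2 + 2" by linarith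
        then have "\<epsilon> * ((norm x)\<^sup>2 / 2 - 1) \<le> \<epsilon> * (norm (- (r *\<^sub>R v) + x))\<^sup>2"
          using e by (intro mult_left_mono) auto
        then have "exp (- \<epsilon> * (norm (- (r *\<^sub>R v) + x))\<^sup>2) \<le> exp \<epsilon> * exp (- (\<epsilon> / 2) * (norm x)\<^sup>2)"
          unfolding exp_add[symmetric] by (simp add: right_diff_distrib)
        from mult_right_mono[OF this, of "\<bar>h x\<bar>"]
        show "exp (- \<epsilon> * (norm (- (r *\<^sub>R v) + x))\<^sup>2) * \<bar>h (- (r *\<^sub>R v) + x + r *\<^sub>R v)\<bar>
          \<le> exp \<epsilon> * (exp (- (\<epsilon> / 2) * (norm x)\<^sup>2) * \<bar>h x\<bar>)"
          by (simp add: mult.assoc)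
      qed
      finally show ?thesis using True by simp
    qed simp
  qed
  also have "\<dots> = S" by (simp add: nn_integral_cmult_indicator)
  finally show ?thesis using S by (rule le_less_trans)
qed

lemma gauss_integrable_avg:
  fixes h :: "real^'n::finite \<Rightarrow> real"
  assumes h: "gauss_integrable h" and v: "norm v \<le> 1"
  shows "gauss_integrable (\<lambda>x. \<integral>r. indicator {0..1} r * h (x + r *\<^sub>R v) \<partial>lborel)"
  unfolding gauss_integrable_iff_nn
proof (intro conjI allI impI)
  have [measurable]: "h \<in> borel_measurable borel" by (rule gauss_integrable_measurable[OF h])
  show "(\<lambda>x. \<integral>r. indicator {0..1} r * h (x + r *\<^sub>R v) \<partial>lborel) \<in> borel_measurable borel" by measurable
  fix \<epsilon> :: real assume e: "\<epsilon> > 0"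
  have "(\<integral>\<^sup>+x. ennreal (exp (- \<epsilon> * (norm x)\<^sup>2) * \<bar>\<integral>r. indicator {0..1} r * h (x + r *\<^sub>R v) \<partial>lborel\<bar>) \<partial>lborel)
    \<le> (\<integral>\<^sup>+x. ennreal (exp (- \<epsilon> * (norm x)\<^sup>2)) * (\<integral>\<^sup>+r. ennreal (indicator {0..1} r * \<bar>h (x + r *\<^sub>R v)\<bar>) \<partial>lborel) \<partial>lborel)"
  proof (intro nn_integral_mono)
    fix x
    \<comment> \<open>Where h is not integrable along the segment the Bochner integral is 0 by
      convention, and the bound is trivial.\<close>
    have "ennreal \<bar>\<integral>r. indicator {0..1} r * h (x + r *\<^sub>R v) \<partial>lborel\<bar> \<le> (\<integral>\<^sup>+r. ennreal (indicator {0..1} r * \<bar>h (x + r *\<^sub>R v)\<bar>) \<partial>lborel)"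
    proof (cases "integrable lborel (\<lambda>r. indicator {0..1} r * h (x + r *\<^sub>R v))")
      case True
      from integral_norm_bound_ennreal[OF this] show ?thesis by (simp add: abs_mult)
    qed (simp add: not_integrable_integral_eq)
    then show "ennreal (exp (- \<epsilon> * (norm x)\<^sup>2) * \<bar>\<integral>r. indicator {0..1} r * h (x + r *\<^sub>R v) \<partial>lborel\<bar>)
      \<le> ennreal (exp (- \<epsilon> * (norm x)\<^sup>2)) * (\<integral>\<^sup>+r. ennreal (indicator {0..1} r * \<bar>h (x + r *\<^sub>R v)\<bar>) \<partial>lborel)"
      by (simp add: ennreal_mult mult_left_mono)
  qed
  also have "\<dots> < \<infinity>" by (rule nn_integral_gauss_avg_finite[OF h e v])
  finally show "(\<integral>\<^sup>+x. ennreal (exp (- \<epsilon> * (norm x)\<^sup>2) * \<bar>\<integral>r. indicator {0..1} r * h (x + r *\<^sub>R v) \<partial>lborel\<bar>) \<partial>lborel) < \<infinity>" .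
qed

lemma tensor_translate_upd:
  fixes D :: "'n::finite \<Rightarrow> nat \<Rightarrow> real \<Rightarrow> real"
  shows "tensor D (\<lambda>_. 0) (x - r *\<^sub>R axis i 1) = D i 0 (x $ i - r) * (\<Prod>j\<in>UNIV - {i}. D j 0 (x $ j))"
  unfolding tensor_def by (subst prod.remove[of _ i]) (auto intro!: prod.cong simp: axis_def)

text \<open>Fubini and the substitution x -> x + r e carry the average from the test function to h
  and reverse its direction.\<close>

lemma integral_mult_avg:
  fixes h :: "real^'n::finite \<Rightarrow> real"
  assumes h: "loc_integrable h" and D: "\<And>i. compact_jet (D i)"
  shows "(\<integral>x. h x * (\<integral>r. indicator {0..1} r * tensor D (\<lambda>_. 0) (x - r *\<^sub>R axis i 1) \<partial>lborel) \<partial>lborel)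
    = (\<integral>x. (\<integral>r. indicator {0..1} r * h (x + r *\<^sub>R axis i 1) \<partial>lborel) * tensor D (\<lambda>_. 0) x \<partial>lborel)"
proof -
  let ?e = "axis i 1 :: real^'n" and ?\<phi> = "tensor D (\<lambda>_. 0)" and ?I = "indicator {0..1} :: real \<Rightarrow> real"
  have [measurable]: "h \<in> borel_measurable borel" "?\<phi> \<in> borel_measurable borel"
    using h D by (auto intro: loc_integrable_measurable tensor_measurable)
  obtain R where R: "\<And>\<beta> x. R \<le> norm x \<Longrightarrow> tensor D \<beta> x = 0" using tensor_support[of D] D by auto
  obtain B where B: "\<And>x. \<bar>?\<phi> x\<bar> \<le> B" using tensor_bounded[of D "\<lambda>_. 0"] D by auto
  have [simp]: "B \<ge> 0" using B[of 0] by linarith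
  have intI: "integrable lborel ?I" by (simp add: integrable_indicator_iff)
  \<comment> \<open>The shift by r in [0, 1] enlarges the support radius from R to R + 1.\<close>
  have int1: "integrable (lborel \<Otimes>\<^sub>M lborel) (\<lambda>(r, x). ?I r * h x * ?\<phi> (x - r *\<^sub>R ?e))"
  proof (rule Bochner_Integration.integrable_bound[OF
        integrable_lborel_prod_mult[OF intI integrable_mult_right[OF loc_integrable_ball[OF h, of "R + 1"], of B]]])
    have "\<bar>?I r * h x * ?\<phi> (x - r *\<^sub>R ?e)\<bar> \<le> \<bar>?I r * (B * (h x * indicator (ball 0 (R + 1)) x))\<bar>" for r x
    proof (cases "r \<in> {0..1} \<and> norm x < R + 1")
      case True
      then show ?thesis
        using mult_left_mono[OF B[of "x - r *\<^sub>R ?e"], of "\<bar>h x\<bar>"] by (simp add: abs_mult mult.commute)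
    next
      case False
      have "?\<phi> (x - r *\<^sub>R ?e) = 0" if "r \<in> {0..1}"
      proof (rule R)
        have "norm x \<le> norm (x - r *\<^sub>R ?e) + norm (r *\<^sub>R ?e)" by (metis norm_triangle_sub add.commute diff_add_cancel norm_triangle_ineq)
        moreover have "norm (r *\<^sub>R ?e) \<le> 1" using that by (simp add: norm_axis_1)
        ultimately show "R \<le> norm (x - r *\<^sub>R ?e)" using False that by auto
      qed
      then show ?thesis by (cases "r \<in> {0..1}") auto
    qed
    then show "AE w in lborel \<Otimes>\<^sub>M lborel. norm (case w of (r, x) \<Rightarrow> ?I r * h x * ?\<phi> (x - r *\<^sub>R ?e))
       \<le> norm (case w of (r, x) \<Rightarrow> ?I r * (B * (h x * indicator (ball 0 (R + 1)) x)))"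
      by (intro AE_I2) (auto simp: split_beta)
  qed measurable
  have inner: "(\<integral>x. F (h x) * G (?\<phi> (x - r *\<^sub>R ?e)) \<partial>lborel) = (\<integral>x. F (h (x + r *\<^sub>R ?e)) * G (?\<phi> x) \<partial>lborel)"
    if [measurable]: "F \<in> borel_measurable borel" "G \<in> borel_measurable borel" for r and F G :: "real \<Rightarrow> real"
    by (subst integral_lborel_affine[of "\<lambda>x. F (h x) * G (?\<phi> (x - r *\<^sub>R ?e))" 1 "r *\<^sub>R ?e"])
      (auto simp: add.commute)
  have int2: "integrable (lborel \<Otimes>\<^sub>M lborel) (\<lambda>(r, x). ?I r * (h (x + r *\<^sub>R ?e) * ?\<phi> x))"
  proof (rule lborel_pair.Fubini_integrable)
    show "(\<lambda>(r, x). ?I r * (h (x + r *\<^sub>R ?e) * ?\<phi> x)) \<in> borel_measurable (lborel \<Otimes>\<^sub>M lborel)" by measurable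
    \<comment> \<open>For each r the inner integral of the absolute value is that of
      \<open>int1\<close> after translation, so integrability in r carries over.\<close>
    have "integrable lborel (\<lambda>r. \<integral>x. norm (?I r * h x * ?\<phi> (x - r *\<^sub>R ?e)) \<partial>lborel)"
      using lborel_pair.integrable_fst'[OF integrable_norm[OF int1]] by simp
    then show "integrable lborel (\<lambda>r. \<integral>x. norm (case (r, x) of (r, x) \<Rightarrow> ?I r * (h (x + r *\<^sub>R ?e) * ?\<phi> x)) \<partial>lborel)"
      using inner[of abs abs] by (simp add: abs_mult mult.assoc)
    show "AE r in lborel. integrable lborel (\<lambda>x. case (r, x) of (r, x) \<Rightarrow> ?I r * (h (x + r *\<^sub>R ?e) * ?\<phi> x))"
      using loc_integrable_tensor[OF loc_integrable_translate[OF h] D] by (intro AE_I2) simp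
  qed
  have "(\<integral>x. h x * (\<integral>r. ?I r * ?\<phi> (x - r *\<^sub>R ?e) \<partial>lborel) \<partial>lborel)
     = (\<integral>x. (\<integral>r. ?I r * h x * ?\<phi> (x - r *\<^sub>R ?e) \<partial>lborel) \<partial>lborel)"
    by (intro Bochner_Integration.integral_cong refl) (simp add: mult_ac integral_mult_right_zero[symmetric] del: integral_mult_right_zero)
  also have "\<dots> = (\<integral>r. (\<integral>x. ?I r * h x * ?\<phi> (x - r *\<^sub>R ?e) \<partial>lborel) \<partial>lborel)"
    by (rule lborel_pair.Fubini_integral[OF int1])
  also have "\<dots> = (\<integral>r. (\<integral>x. ?I r * (h (x + r *\<^sub>R ?e) * ?\<phi> x) \<partial>lborel) \<partial>lborel)"
    using inner[of "\<lambda>x. x" "\<lambda>x. x"] by (simp add: mult.assoc)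
  also have "\<dots> = (\<integral>x. (\<integral>r. ?I r * (h (x + r *\<^sub>R ?e) * ?\<phi> x) \<partial>lborel) \<partial>lborel)"
    by (rule lborel_pair.Fubini_integral[OF int2, symmetric])
  also have "\<dots> = (\<integral>x. (\<integral>r. ?I r * h (x + r *\<^sub>R ?e) \<partial>lborel) * ?\<phi> x \<partial>lborel)"
    by (intro Bochner_Integration.integral_cong refl) (simp add: mult.assoc[symmetric])
  finally show ?thesis .
qed

text \<open>Replace the i-th factor of a test function \<phi> by its average E. Differentiating
  along axis i gives \<phi> x - \<phi> (x - e), so the weak identity reads as a difference of f on
  one side and, by \<open>integral_mult_avg\<close>, as an average of h on the other.\<close>

lemma weak_partial_difference:
  fixes f h :: "real^'n::finite \<Rightarrow> real"
  assumes f: "loc_integrable f" and h: "gauss_integrable h" and weak: "weak_partial (incr i (\<lambda>_. 0)) f h"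
  shows "AE x in lborel. f (x + axis i 1) - f x = (\<integral>r. indicator {0..1} r * h (x + r *\<^sub>R axis i 1) \<partial>lborel)"
proof -
  let ?e = "axis i 1 :: real^'n"
  let ?H = "\<lambda>x. (\<integral>r. indicator {0..1} r * h (x + r *\<^sub>R ?e) \<partial>lborel)"
  have H: "loc_integrable ?H" by (intro gauss_integrable_loc gauss_integrable_avg h) (simp add: norm_axis_1)
  note ft = loc_integrable_translate[OF f, of ?e]
  have "AE x in lborel. f (x + ?e) - f x - ?H x = 0"
  proof (rule AE_zero_if_test_zero)
    show "loc_integrable (\<lambda>x. f (x + ?e) - f x - ?H x)" by (intro loc_integrable_diff ft f H)
    fix D :: "'n \<Rightarrow> nat \<Rightarrow> real \<Rightarrow> real" assume D: "\<And>i. compact_jet (D i)"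
    let ?\<phi> = "tensor D (\<lambda>_. 0)"
    have [measurable]: "f \<in> borel_measurable borel" "?\<phi> \<in> borel_measurable borel"
      using f D by (auto intro: loc_integrable_measurable tensor_measurable)
    define E where "E = D(i := jet_avg (D i))"
    have E: "\<forall>j. compact_jet (E j)" using D by (auto simp: E_def compact_jet_jet_avg)
    have t0: "tensor E (\<lambda>_. 0) x = (\<integral>r. indicator {0..1} r * ?\<phi> (x - r *\<^sub>R ?e) \<partial>lborel)" for x
    proof -
      have "tensor E (\<lambda>_. 0) x = jet_avg (D i) 0 (x $ i) * (\<Prod>j\<in>UNIV - {i}. D j 0 (x $ j))"
        unfolding tensor_def by (subst prod.remove[of _ i]) (auto intro!: prod.cong simp: E_def)
      then show ?thesis by (simp add: tensor_translate_upd jet_avg_def mult.assoc[symmetric])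
    qed
    have t1: "tensor E (incr i (\<lambda>_. 0)) x = ?\<phi> x - ?\<phi> (x - ?e)" for x
    proof -
      have "tensor E (incr i (\<lambda>_. 0)) x = jet_avg (D i) (Suc 0) (x $ i) * (\<Prod>j\<in>UNIV - {i}. D j 0 (x $ j))"
        unfolding tensor_def by (subst prod.remove[of _ i]) (auto intro!: prod.cong simp: E_def incr_def)
      then show ?thesis
        using tensor_translate_upd[where D = D and x = x and i = i and r = 0] tensor_translate_upd[where D = D and x = x and i = i and r = 1]
        by (simp add: jet_avg_Suc[OF D] left_diff_distrib)
    qed
    have shift_eq: "(\<integral>x. f x * ?\<phi> (x - ?e) \<partial>lborel) = (\<integral>x. f (x + ?e) * ?\<phi> x \<partial>lborel)"
      by (subst integral_lborel_affine[of "\<lambda>x. f x * ?\<phi> (x - ?e)" 1 ?e]) (auto simp: add.commute)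
    have shift_int: "integrable lborel (\<lambda>x. f x * ?\<phi> (x - ?e))"
      using integrable_lborel_affine[OF loc_integrable_tensor[OF ft D, where \<beta> = "\<lambda>_. 0"], of 1 "- ?e"] by simp
    have "(\<integral>x. f x * (?\<phi> x - ?\<phi> (x - ?e)) \<partial>lborel) = - (\<integral>x. h x * tensor E (\<lambda>_. 0) x \<partial>lborel)"
      using weak[unfolded weak_partial_def, rule_format, of E] E by (simp add: t1)
    also have "(\<integral>x. h x * tensor E (\<lambda>_. 0) x \<partial>lborel) = (\<integral>x. ?H x * ?\<phi> x \<partial>lborel)"
      unfolding t0 by (rule integral_mult_avg[OF gauss_integrable_loc[OF h] D])
    also have "(\<integral>x. f x * (?\<phi> x - ?\<phi> (x - ?e)) \<partial>lborel) = (\<integral>x. f x * ?\<phi> x \<partial>lborel) - (\<integral>x. f (x + ?e) * ?\<phi> x \<partial>lborel)"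
      using loc_integrable_tensor[OF f D] shift_int
      by (simp add: right_diff_distrib shift_eq[symmetric])
    finally have key: "(\<integral>x. f (x + ?e) * ?\<phi> x \<partial>lborel) - (\<integral>x. f x * ?\<phi> x \<partial>lborel) - (\<integral>x. ?H x * ?\<phi> x \<partial>lborel) = 0"
      by simp
    have "(\<integral>x. (f (x + ?e) - f x - ?H x) * ?\<phi> x \<partial>lborel)
      = (\<integral>x. f (x + ?e) * ?\<phi> x - f x * ?\<phi> x - ?H x * ?\<phi> x \<partial>lborel)"
      by (simp add: left_diff_distrib)
    also have "\<dots> = (\<integral>x. f (x + ?e) * ?\<phi> x \<partial>lborel) - (\<integral>x. f x * ?\<phi> x \<partial>lborel) - (\<integral>x. ?H x * ?\<phi> x \<partial>lborel)"
      using loc_integrable_tensor[OF f D, where \<beta> = "\<lambda>_. 0"] loc_integrable_tensor[OF ft D, where \<beta> = "\<lambda>_. 0"] loc_integrable_tensor[OF H D, where \<beta> = "\<lambda>_. 0"]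
      by (subst Bochner_Integration.integral_diff, simp, simp, subst Bochner_Integration.integral_diff) auto
    finally show "(\<integral>x. (f (x + ?e) - f x - ?H x) * ?\<phi> x \<partial>lborel) = 0" using key by simp
  qed
  then show ?thesis by eventually_elim simp
qed

section \<open>Growth of a function from its unit differences\<close>

lemma gauss_integrable_cong_AE:
  fixes f g :: "real^'n::finite \<Rightarrow> real"
  assumes "gauss_integrable f" "AE x in lborel. f x = g x" and [measurable]: "g \<in> borel_measurable borel"
  shows "gauss_integrable g"
  unfolding gauss_integrable_def
proof (intro conjI allI impI)
  fix \<epsilon> :: real assume "\<epsilon> > 0"
  then have "integrable lborel (\<lambda>y. exp (- \<epsilon> * (norm y)\<^sup>2) * f y)" using assms by (simp add: gauss_integrable_def)
  moreover have [measurable]: "f \<in> borel_measurable borel" using assms by (simp add: gauss_integrable_def)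
  ultimately show "integrable lborel (\<lambda>y. exp (- \<epsilon> * (norm y)\<^sup>2) * g y)"
    by (subst (asm) integrable_cong_AE[where g = "\<lambda>y. exp (- \<epsilon> * (norm y)\<^sup>2) * g y"])
      (use assms(2) in auto)
qed fact

text \<open>Moving a point with a large coordinate one step towards the origin gains an arbitrarily small factor
  in the Gaussian weight, so the weighted integrals of \<open>f\<close> over cubes absorb themselves.\<close>

lemma gauss_integrable_of_differences:
  fixes f :: "real^'n::finite \<Rightarrow> real"
  assumes f: "loc_integrable f" and d: "\<And>i. gauss_integrable (\<lambda>x. f (x + axis i 1) - f x)"
  shows "gauss_integrable f"
  unfolding gauss_integrable_iff_nn
proof (intro conjI allI impI)
  show [measurable]: "f \<in> borel_measurable borel" by (rule loc_integrable_measurable[OF f])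
  fix \<epsilon> :: real assume e: "\<epsilon> > 0"
  define n where "n = real CARD('n)"
  have n: "n > 0" by (simp add: n_def)
  obtain M0 where M0: "M0 > 0" "(2 * n) * exp (- \<epsilon> * M0\<^sup>2) \<le> 1/2"
    using exists_gaussian_small[OF e, of "2 * n"] n by auto
  define M where "M = max 1 (M0\<^sup>2)"
  \<comment> \<open>If |x_i| \<ge> M, a unit step towards the origin lowers |x|^2 by 2 |x_i| - 1
    \<ge> 2 M - 1, so the weight gains \<delta>. There are n coordinates with two directions each,
    hence the requirement 2 n \<delta> \<le> 1/2; M0 provides it since M0^2 \<le> 2 M - 1.\<close>
  define \<delta> where "\<delta> = exp (- \<epsilon> * (2 * M - 1))"
  have M: "M \<ge> 1" "M0\<^sup>2 \<le> 2 * M - 1" by (auto simp: M_def max_def)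
  have \<delta>: "0 \<le> \<delta>" "\<delta> \<le> 1" "2 * n * \<delta> \<le> 1/2"
  proof -
    have "exp (- \<epsilon> * (2 * M - 1)) \<le> exp (- \<epsilon> * M0\<^sup>2)" using M e by simp
    then have "2 * n * \<delta> \<le> (2 * n) * exp (- \<epsilon> * M0\<^sup>2)" unfolding \<delta>_def using n by (intro mult_left_mono) auto
    then show "2 * n * \<delta> \<le> 1/2" using M0 by linarith
    show "\<delta> \<le> 1" unfolding \<delta>_def using e M by (simp add: mult_nonneg_nonneg)
  qed (simp add: \<delta>_def)
  let ?w = "\<lambda>x. exp (- \<epsilon> * (norm (x::real^'n))\<^sup>2)" and ?e = "\<lambda>i. axis i 1 :: real^'n"
  let ?Q = "\<lambda>R. {x::real^'n. \<forall>i. \<bar>x $ i\<bar> < R}"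
  let ?K = "\<lambda>i x. \<bar>f (x + ?e i) - f x\<bar>"
  have Q[measurable]: "?Q R \<in> sets borel" for R
  proof (rule borel_open)
    have "?Q R = (\<Inter>i. {x. \<bar>x $ i\<bar> < R})" by auto
    also have "open \<dots>"
    proof (intro open_INT ballI)
      show "open {x :: real^'n. \<bar>x $ i\<bar> < R}" for i by (intro open_Collect_less continuous_intros)
    qed simp
    finally show "open (?Q R)" .
  qed
  define J where "J R = (\<integral>\<^sup>+x. ennreal (?w x * \<bar>f x\<bar>) * indicator (?Q R) x \<partial>lborel)" for R
  define S where "S i = (\<integral>\<^sup>+x. ennreal (?w x * ?K i x) \<partial>lborel)" for i
  have S: "S i < \<infinity>" for i using d[of i] e unfolding gauss_integrable_iff_nn S_def by auto
  have fin: "J R < \<infinity>" for R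
  proof -
    have "norm x < n * \<bar>R\<bar> + 1" if "x \<in> ?Q R" for x
    proof -
      have "norm x \<le> (\<Sum>i\<in>UNIV. \<bar>x $ i\<bar>)" by (rule norm_le_l1_cart)
      also have "\<dots> \<le> (\<Sum>i\<in>(UNIV::'n set). \<bar>R\<bar>)" using that by (intro sum_mono) (auto intro: order.trans[OF less_imp_le])
      finally show ?thesis by (simp add: n_def)
    qed
    then have "J R \<le> (\<integral>\<^sup>+x. ennreal \<bar>f x\<bar> * indicator (ball 0 (n * \<bar>R\<bar> + 1)) x \<partial>lborel)"
      unfolding J_def using e
      by (intro nn_integral_mono) (auto simp: indicator_def intro!: ennreal_leI mult_left_le_one_le)
    also have "\<dots> < \<infinity>" using f by (simp add: loc_integrable_def)
    finally show ?thesis .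
  qed
  define A where "A = J M + (\<Sum>i\<in>UNIV. 2 * S i)"
  have A: "A < \<infinity>" using S fin[of M] by (simp add: A_def ennreal_mult_less_top less_top)
  have norm_step: "(norm (x + c *\<^sub>R ?e i))\<^sup>2 = (norm x)\<^sup>2 + 2 * c * x $ i + c\<^sup>2" for x i and c :: real
  proof -
    have a: "inner x (?e i) = x $ i" "inner (?e i) x = x $ i" "inner (?e i) (?e i) = 1"
      by (simp_all add: inner_axis inner_axis' inner_axis_axis)
    show ?thesis
      unfolding power2_norm_eq_inner inner_add_left inner_add_right inner_scaleR_left inner_scaleR_right a
      by (simp add: power2_eq_square algebra_simps)
  qed
  have rec: "J R \<le> A + ennreal (1/2) * J R" for R
  proof -
    \<comment> \<open>\<open>?P i\<close> steps by -e_i and uses the difference of f based at x -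
      e_i; \<open>?N i\<close> steps by +e_i and uses the one based at x. Which of them bounds the
      integrand depends on x, so all are summed.\<close>
    let ?P = "\<lambda>i x. ennreal \<delta> * (ennreal (?w (- ?e i + x) * \<bar>f (- ?e i + x)\<bar>) * indicator (?Q R) (- ?e i + x)) + ennreal (?w (- ?e i + x) * ?K i (- ?e i + x))"
    let ?N = "\<lambda>i x. ennreal \<delta> * (ennreal (?w (?e i + x) * \<bar>f (?e i + x)\<bar>) * indicator (?Q R) (?e i + x)) + ennreal (?w x * ?K i x)"
    have "J R \<le> (\<integral>\<^sup>+x. ennreal (?w x * \<bar>f x\<bar>) * indicator (?Q M) x + (\<Sum>i\<in>UNIV. ?P i x + ?N i x) \<partial>lborel)"
      unfolding J_def
    proof (rule nn_integral_mono)
      fix x :: "real^'n"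
      show "ennreal (?w x * \<bar>f x\<bar>) * indicator (?Q R) x \<le> ennreal (?w x * \<bar>f x\<bar>) * indicator (?Q M) x + (\<Sum>i\<in>UNIV. ?P i x + ?N i x)"
      proof (cases "x \<in> ?Q R \<and> x \<notin> ?Q M")
        case False
        then show ?thesis by (intro add_increasing2) (auto simp: indicator_def)
      next
        case True
        then obtain i where i: "\<bar>x $ i\<bar> \<ge> M" by (auto simp: not_less)
        have "ennreal (?w x * \<bar>f x\<bar>) \<le> ?P i x + ?N i x"
        proof (cases "x $ i \<ge> M")
          case pos: True
          \<comment> \<open>M \<ge> 1 prevents the step from overshooting: the new coordinate stays
            nonnegative and below R.\<close>
          have "- ?e i + x \<in> ?Q R"
          proof -
            have "\<bar>(- ?e i + x) $ j\<bar> < R" for j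
              using True pos M by (cases "j = i") (auto simp: axis_def abs_if dest!: spec[of _ i] spec[of _ j])
            then show ?thesis by simp
          qed
          have w: "?w x \<le> \<delta> * ?w (- ?e i + x)"
          proof -
            have "(norm (- ?e i + x))\<^sup>2 = (norm x)\<^sup>2 - 2 * x $ i + 1" using norm_step[of x "-1" i] by simp
            then have "\<epsilon> * ((2 * M - 1) + (norm (- ?e i + x))\<^sup>2) \<le> \<epsilon> * (norm x)\<^sup>2" using pos e by (intro mult_left_mono) auto
            then show ?thesis unfolding \<delta>_def exp_add[symmetric] exp_le_cancel_iff by (simp add: algebra_simps)
          qed
          have "?w x * \<bar>f x\<bar> \<le> \<delta> * ?w (- ?e i + x) * (\<bar>f (- ?e i + x)\<bar> + ?K i (- ?e i + x))"
            using w \<delta> by (intro mult_mono) auto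
          also have "\<dots> \<le> \<delta> * (?w (- ?e i + x) * \<bar>f (- ?e i + x)\<bar>) + ?w (- ?e i + x) * ?K i (- ?e i + x)"
            using mult_right_mono[OF \<delta>(2), of "?w (- ?e i + x) * ?K i (- ?e i + x)"] by (simp add: algebra_simps)
          finally have "ennreal (?w x * \<bar>f x\<bar>) \<le> ennreal \<delta> * ennreal (?w (- ?e i + x) * \<bar>f (- ?e i + x)\<bar>) + ennreal (?w (- ?e i + x) * ?K i (- ?e i + x))"
            using \<delta>(1) by (simp only: ennreal_mult[symmetric] ennreal_plus[symmetric] mult_nonneg_nonneg exp_ge_zero abs_ge_zero ennreal_leI)
          then have "ennreal (?w x * \<bar>f x\<bar>) \<le> ?P i x" using \<open>- ?e i + x \<in> ?Q R\<close> by simp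
          then show ?thesis by (rule add_increasing2[rotated]) simp
        next
          case neg: False
          then have neg: "x $ i \<le> - M" using i M by linarith
          have "?e i + x \<in> ?Q R"
          proof -
            have "\<bar>(?e i + x) $ j\<bar> < R" for j
              using True neg M by (cases "j = i") (auto simp: axis_def abs_if dest!: spec[of _ i] spec[of _ j])
            then show ?thesis by simp
          qed
          have w: "?w x \<le> \<delta> * ?w (?e i + x)"
          proof -
            have "(norm (?e i + x))\<^sup>2 = (norm x)\<^sup>2 + 2 * x $ i + 1" using norm_step[of x 1 i] by (simp add: add.commute)
            then have "\<epsilon> * ((2 * M - 1) + (norm (?e i + x))\<^sup>2) \<le> \<epsilon> * (norm x)\<^sup>2" using neg e by (intro mult_left_mono) auto
            then show ?thesis unfolding \<delta>_def exp_add[symmetric] exp_le_cancel_iff by (simp add: algebra_simps)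
          qed
          have "?w x * \<bar>f x\<bar> \<le> ?w x * (\<bar>f (?e i + x)\<bar> + ?K i x)"
            by (intro mult_left_mono) (auto simp: add.commute)
          also have "\<dots> \<le> \<delta> * (?w (?e i + x) * \<bar>f (?e i + x)\<bar>) + ?w x * ?K i x"
            using mult_right_mono[OF w, of "\<bar>f (?e i + x)\<bar>"] by (simp add: algebra_simps)
          finally have "ennreal (?w x * \<bar>f x\<bar>) \<le> ennreal \<delta> * ennreal (?w (?e i + x) * \<bar>f (?e i + x)\<bar>) + ennreal (?w x * ?K i x)"
            using \<delta>(1) by (simp only: ennreal_mult[symmetric] ennreal_plus[symmetric] mult_nonneg_nonneg exp_ge_zero abs_ge_zero ennreal_leI)
          then have "ennreal (?w x * \<bar>f x\<bar>) \<le> ?N i x" using \<open>?e i + x \<in> ?Q R\<close> by simp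
          then show ?thesis by (rule add_increasing[rotated]) simp
        qed
        also have "\<dots> \<le> (\<Sum>i\<in>UNIV. ?P i x + ?N i x)" by (rule member_le_sum) auto
        finally show ?thesis using True by (intro add_increasing) auto
      qed
    qed
    also have "\<dots> = J M + (\<Sum>i\<in>UNIV. (\<integral>\<^sup>+x. ?P i x \<partial>lborel) + (\<integral>\<^sup>+x. ?N i x \<partial>lborel))"
      unfolding J_def by (subst nn_integral_add, measurable, subst nn_integral_sum, measurable, subst nn_integral_add) (auto simp: J_def)
    also have "(\<Sum>i\<in>UNIV. (\<integral>\<^sup>+x. ?P i x \<partial>lborel) + (\<integral>\<^sup>+x. ?N i x \<partial>lborel)) = (\<Sum>i\<in>(UNIV::'n set). (ennreal \<delta> * J R + S i) + (ennreal \<delta> * J R + S i))"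
    proof (intro sum.cong refl arg_cong2[where f = "(+)"])
      fix i
      have meas[measurable]: "(\<lambda>x. ennreal (?w x * \<bar>f x\<bar>) * indicator (?Q R) x) \<in> borel_measurable borel" by measurable
      have 1: "(\<integral>\<^sup>+x. ennreal (?w (a + x) * \<bar>f (a + x)\<bar>) * indicator (?Q R) (a + x) \<partial>lborel) = J R" for a
        unfolding J_def by (rule nn_integral_lborel_translation[OF meas])
      have m1[measurable]: "(\<lambda>x. ennreal (?w (a + x) * \<bar>f (a + x)\<bar>) * indicator (?Q R) (a + x)) \<in> borel_measurable borel" for a
        by (rule measurable_compose[OF _ meas]) measurable
      have 2: "(\<integral>\<^sup>+x. ennreal (?w (- ?e i + x) * ?K i (- ?e i + x)) \<partial>lborel) = S i"
        unfolding S_def by (rule nn_integral_lborel_translation) measurable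
      show "(\<integral>\<^sup>+x. ?P i x \<partial>lborel) = ennreal \<delta> * J R + S i"
        by (subst nn_integral_add, measurable, subst nn_integral_cmult, measurable) (simp only: 1 2)
      show "(\<integral>\<^sup>+x. ?N i x \<partial>lborel) = ennreal \<delta> * J R + S i"
        by (subst nn_integral_add, measurable, subst nn_integral_cmult, measurable) (simp only: 1 S_def)
    qed
    also have "\<dots> = (\<Sum>i\<in>(UNIV::'n set). 2 * S i) + ennreal (2 * n * \<delta>) * J R"
    proof -
      have "(ennreal \<delta> * J R + S i) + (ennreal \<delta> * J R + S i) = 2 * S i + ennreal (2 * \<delta>) * J R" for i
      proof -
        have "ennreal (2 * \<delta>) = ennreal \<delta> + ennreal \<delta>"
          unfolding mult_2 by (rule ennreal_plus[OF \<delta>(1) \<delta>(1)])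
        then show ?thesis by (simp only: mult_2 distrib_right add_ac)
      qed
      moreover have "of_nat CARD('n) * (ennreal (2 * \<delta>) * J R) = ennreal (2 * n * \<delta>) * J R"
      proof -
        have "2 * n * \<delta> = n * (2 * \<delta>)" by simp
        then have "ennreal (2 * n * \<delta>) = ennreal n * ennreal (2 * \<delta>)"
          using \<delta>(1) n by (simp only: ennreal_mult less_imp_le mult_nonneg_nonneg zero_le_numeral)
        then show ?thesis by (simp only: n_def ennreal_of_nat_eq_real_of_nat mult.assoc)
      qed
      ultimately show ?thesis by (simp only: sum.distrib sum_constant)
    qed
    also have "J M + (\<dots>) = A + ennreal (2 * n * \<delta>) * J R" by (simp add: A_def add.assoc)
    also have "\<dots> \<le> A + ennreal (1/2) * J R"
      using \<delta> by (intro add_left_mono mult_right_mono ennreal_leI) auto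
    finally show ?thesis .
  qed
  have "(\<integral>\<^sup>+x. ennreal (?w x * \<bar>f x\<bar>) \<partial>lborel) \<le> 2 * A"
  proof (rule nn_integral_le_exhaustion[where A = "\<lambda>m. ?Q (real m)"])
    show "(\<integral>\<^sup>+x. ennreal (?w x * \<bar>f x\<bar>) * indicator (?Q (real m)) x \<partial>lborel) \<le> 2 * A" for m
      using ennreal_absorb_half[OF fin rec[of "real m"]] by (simp add: J_def)
    show "incseq (\<lambda>m. ?Q (real m))" by (fastforce simp: incseq_def intro: less_le_trans)
    show "space (lborel :: (real^'n) measure) \<subseteq> (\<Union>m. ?Q (real m))"
    proof
      fix x :: "real^'n"
      obtain m where "norm x < real m" using reals_Archimedean2 by blast
      then have "x \<in> ?Q (real m)" using component_le_norm_cart[of x] by (auto intro: le_less_trans)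
      then show "x \<in> (\<Union>m. ?Q (real m))" by blast
    qed
  qed auto
  then show "(\<integral>\<^sup>+x. ennreal (?w x * \<bar>f x\<bar>) \<partial>lborel) < \<infinity>"
    using A by (auto simp: ennreal_mult_less_top intro: le_less_trans)
qed

lemma gauss_integrable_weak_gradient:
  fixes f :: "real^'n::finite \<Rightarrow> real"
  assumes f: "loc_integrable f" and h: "\<And>i. \<exists>h. gauss_integrable h \<and> weak_partial (incr i (\<lambda>_. 0)) f h"
  shows "gauss_integrable f"
proof (rule gauss_integrable_of_differences[OF f])
  fix i
  have [measurable]: "f \<in> borel_measurable borel" by (rule loc_integrable_measurable[OF f])
  obtain h where h: "gauss_integrable h" "weak_partial (incr i (\<lambda>_. 0)) f h" using h by blast
  show "gauss_integrable (\<lambda>x. f (x + axis i 1) - f x)"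
    by (rule gauss_integrable_cong_AE[OF gauss_integrable_avg[OF h(1), of "axis i 1"]])
      (use weak_partial_difference[OF f h] in \<open>auto simp: norm_axis_1\<close>)
qed

text \<open>Downward induction on the order, k counting the levels below l: the derivatives one
  order higher form the weak gradient of the one at hand. The derivative of order zero reached at
  the end equals f almost everywhere.\<close>

theorem gauss_integrable_weak_partials:
  fixes f :: "real^'n::finite \<Rightarrow> real"
  assumes f: "loc_integrable f"
    and ex: "\<And>\<alpha>. multi_order \<alpha> < l \<Longrightarrow> \<exists>g. loc_integrable g \<and> weak_partial \<alpha> f g"
    and top: "\<And>\<alpha>. multi_order \<alpha> = l \<Longrightarrow> \<exists>g. gauss_integrable g \<and> weak_partial \<alpha> f g"
  shows "gauss_integrable f"
proof -
  have "k \<le> l \<Longrightarrow> multi_order \<alpha> = l - k \<Longrightarrow> \<exists>g. gauss_integrable g \<and> weak_partial \<alpha> f g" for k \<alpha>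
  proof (induction k arbitrary: \<alpha>)
    case 0
    then show ?case using top by simp
  next
    case (Suc k)
    then obtain g where g: "loc_integrable g" "weak_partial \<alpha> f g" using ex[of \<alpha>] by auto
    have "gauss_integrable g"
    proof (rule gauss_integrable_weak_gradient[OF g(1)])
      fix i
      have "multi_order (incr i \<alpha>) = l - k" using Suc.prems by simp
      then obtain h where "gauss_integrable h" "weak_partial (incr i \<alpha>) f h"
        using Suc.IH[of "incr i \<alpha>"] Suc.prems(1) Suc_leD by blast
      then show "\<exists>h. gauss_integrable h \<and> weak_partial (incr i (\<lambda>_. 0)) g h"
        using weak_partial_incr[OF g(2)] by blast
    qed
    then show ?case using g by blast
  qed
  from this[of l "\<lambda>_. 0"] obtain g where g: "gauss_integrable g" "weak_partial (\<lambda>_. 0) f g" by auto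
  have "AE x in lborel. g x - f x = 0"
  proof (rule AE_zero_if_test_zero)
    show "loc_integrable (\<lambda>x. g x - f x)" by (intro loc_integrable_diff f gauss_integrable_loc g)
    fix D :: "'n \<Rightarrow> nat \<Rightarrow> real \<Rightarrow> real" assume D: "\<And>i. compact_jet (D i)"
    show "(\<integral>x. (g x - f x) * tensor D (\<lambda>_. 0) x \<partial>lborel) = 0"
      using g(2)[unfolded weak_partial_def, rule_format, of D] D
        loc_integrable_tensor[OF f D, where \<beta> = "\<lambda>_. 0"] loc_integrable_tensor[OF gauss_integrable_loc[OF g(1)] D, where \<beta> = "\<lambda>_. 0"]
      by (simp add: left_diff_distrib)
  qed
  then have "AE x in lborel. g x = f x" by eventually_elim simp
  then show ?thesis by (rule gauss_integrable_cong_AE[OF g(1)]) (rule loc_integrable_measurable[OF f])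
qed

section \<open>Weak derivatives under the Gaussian kernel\<close>

lemma gauss_kernel_1d_bound:
  assumes "t > 0"
  shows "\<exists>C\<ge>0. \<forall>s. \<bar>gauss_kernel_1d k t s\<bar> \<le> C * exp (- s\<^sup>2 / (8 * t\<^sup>2))"
proof -
  obtain C where C: "C > 0" "\<And>v. \<bar>gauss_profile k v\<bar> \<le> C * exp (- v\<^sup>2 / 8)" using gauss_profile_bound by blast
  have "\<bar>gauss_kernel_1d k t s\<bar> \<le> C / t ^ Suc k * exp (- s\<^sup>2 / (8 * t\<^sup>2))" for s
    using C(2)[of "s / t"] assms by (simp add: gauss_kernel_1d_def divide_right_mono power_divide field_simps)
  then show ?thesis using C assms by (intro exI[of _ "C / t ^ Suc k"]) auto
qed

text \<open>The function s -> G (x - s), with G the j-th derivative of the one-variable kernel,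
  listed with its derivatives in s; the inner minus sign produces (-1)^k.\<close>

definition gauss_jet :: "nat \<Rightarrow> real \<Rightarrow> real \<Rightarrow> nat \<Rightarrow> real \<Rightarrow> real" where
  "gauss_jet j t x k s = (-1) ^ k * gauss_kernel_1d (j + k) t (x - s)"

lemma jet_gauss_jet:
  assumes "t > 0"
  shows "jet (gauss_jet j t x)"
  unfolding jet_def gauss_jet_def[abs_def]
proof (intro allI)
  fix k s
  have "((\<lambda>s. gauss_kernel_1d (j + k) t (x - s)) has_real_derivative gauss_kernel_1d (Suc (j + k)) t (x - s) * (-1)) (at s)"
    by (rule DERIV_chain2[where f = "gauss_kernel_1d (j + k) t", OF gauss_kernel_1d_has_derivative])
      (use assms in \<open>auto intro!: derivative_eq_intros\<close>)
  from DERIV_cmult[OF this, of "(-1) ^ k"]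
  show "((\<lambda>s. (-1) ^ k * gauss_kernel_1d (j + k) t (x - s)) has_real_derivative (-1) ^ Suc k * gauss_kernel_1d (j + Suc k) t (x - s)) (at s)"
    by simp
qed

lemma compact_jet_scale:
  assumes A: "compact_jet A" and c: "c > 0"
  shows "compact_jet (\<lambda>k s. c ^ k * A k (c * s))"
proof -
  obtain R where R: "\<And>k s. R \<le> \<bar>s\<bar> \<Longrightarrow> A k s = 0" using A by (auto simp: compact_jet_def)
  have "A k (c * s) = 0" if "R / c \<le> \<bar>s\<bar>" for k s
    using that c by (intro R) (simp add: abs_mult pos_divide_le_eq mult.commute)
  moreover have "jet (\<lambda>k s. c ^ k * A k (c * s))" using jet_affine[of A c 0] A by simp
  ultimately show ?thesis unfolding compact_jet_def by (metis mult_zero_right)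
qed

text \<open>The Gaussian lacks compact support and is not itself a test function. Multiplication by
  the cutoff at scale m + 1 makes it one.\<close>

definition cut_jet :: "nat \<Rightarrow> real \<Rightarrow> real \<Rightarrow> nat \<Rightarrow> nat \<Rightarrow> real \<Rightarrow> real" where
  "cut_jet j t x m = jet_mult (gauss_jet j t x) (\<lambda>k s. (1 / real (Suc m)) ^ k * cutoff k (1 / real (Suc m) * s))"

lemma compact_jet_cut_jet: "t > 0 \<Longrightarrow> compact_jet (cut_jet j t x m)"
  unfolding cut_jet_def by (intro compact_jet_mult jet_gauss_jet compact_jet_scale compact_jet_cutoff) auto

text \<open>Uniformity in m: derivatives of the rescaled cutoff carry powers of 1 / (m + 1), which
  are at most 1.\<close>

lemma cut_jet_bound:
  assumes t: "t > 0"
  shows "\<exists>C\<ge>0. \<forall>m s. \<bar>cut_jet j t x m k s\<bar> \<le> C * exp (- (x - s)\<^sup>2 / (8 * t\<^sup>2))"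
proof -
  have "\<forall>i. \<exists>C\<ge>0. \<forall>s. \<bar>gauss_kernel_1d i t s\<bar> \<le> C * exp (- s\<^sup>2 / (8 * t\<^sup>2))" using gauss_kernel_1d_bound[OF t] by blast
  then obtain C where C: "\<And>i. C i \<ge> 0" "\<And>i s. \<bar>gauss_kernel_1d i t s\<bar> \<le> C i * exp (- s\<^sup>2 / (8 * t\<^sup>2))" by metis
  have "\<forall>i. \<exists>B\<ge>0. \<forall>s. \<bar>cutoff i s\<bar> \<le> B" using compact_jet_bounded[OF compact_jet_cutoff] by blast
  then obtain B where B: "\<And>i. B i \<ge> 0" "\<And>i s. \<bar>cutoff i s\<bar> \<le> B i" by metis
  let ?K = "\<Sum>i\<le>k. real (k choose i) * C (j + i) * B (k - i)"
  have "\<bar>cut_jet j t x m k s\<bar> \<le> ?K * exp (- (x - s)\<^sup>2 / (8 * t\<^sup>2))" for m s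
    unfolding cut_jet_def jet_mult_def sum_distrib_right
  proof (intro order.trans[OF sum_abs] sum_mono)
    fix i
    let ?c = "1 / real (Suc m)" and ?E = "exp (- (x - s)\<^sup>2 / (8 * t\<^sup>2))"
    have "\<bar>?c ^ (k - i) * cutoff (k - i) (?c * s)\<bar> \<le> 1 * B (k - i)"
      unfolding abs_mult by (intro mult_mono B) (auto intro: power_le_one)
    moreover have "\<bar>gauss_jet j t x i s\<bar> \<le> C (j + i) * ?E"
      using C(2)[of "j + i" "x - s"] by (simp add: gauss_jet_def abs_mult power_abs)
    ultimately have "\<bar>gauss_jet j t x i s\<bar> * \<bar>?c ^ (k - i) * cutoff (k - i) (?c * s)\<bar> \<le> (C (j + i) * ?E) * (1 * B (k - i))"
      using C B by (intro mult_mono) auto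
    from mult_left_mono[OF this, of "real (k choose i)"]
    show "\<bar>real (k choose i) * gauss_jet j t x i s * (?c ^ (k - i) * cutoff (k - i) (?c * s))\<bar>
      \<le> real (k choose i) * C (j + i) * B (k - i) * ?E"
      by (simp add: abs_mult mult_ac)
  qed
  moreover have "?K \<ge> 0" using C B by (intro sum_nonneg mult_nonneg_nonneg) auto
  ultimately show ?thesis by blast
qed

lemma cut_jet_tendsto: "(\<lambda>m. cut_jet j t x m k s) \<longlonglongrightarrow> gauss_jet j t x k s"
proof -
  have c': "(\<lambda>m. 1 / real (Suc m)) \<longlonglongrightarrow> 0" by real_asymp
  then have c: "(\<lambda>m. 1 / real (Suc m) * s) \<longlonglongrightarrow> 0 * s" by (rule tendsto_mult_right)
  have "isCont (cutoff i) 0" for i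
    using compact_jet_cutoff by (intro DERIV_isCont[OF jetD]) simp
  then have cc: "(\<lambda>m. cutoff i (1 / real (Suc m) * s)) \<longlonglongrightarrow> cutoff i 0" for i
    using c by (intro isCont_tendsto_compose[where g = "cutoff i"]) auto
  have "(\<lambda>m. cut_jet j t x m k s) \<longlonglongrightarrow> (\<Sum>i\<le>k. real (k choose i) * gauss_jet j t x i s * (0 ^ (k - i) * cutoff (k - i) 0))"
    unfolding cut_jet_def jet_mult_def by (intro tendsto_intros c' cc)
  \<comment> \<open>0^(k - i) removes every term except i = k, where 0^0 = 1 and the cutoff has the
    value 1.\<close>
  also have "(\<Sum>i\<le>k. real (k choose i) * gauss_jet j t x i s * (0 ^ (k - i) * cutoff (k - i) 0)) = gauss_jet j t x k s"
    by (subst sum.remove[of _ k]) (auto simp: cutoff_0_0 power_0_left intro!: sum.neutral)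
  finally show ?thesis .
qed

text \<open>Dominated convergence under the uniform Gaussian bound. The sign appears because
  \<alpha> differentiates in y while the kernel depends on x - y.\<close>

lemma integral_cut_tensor_tendsto:
  fixes f :: "real^'n::finite \<Rightarrow> real"
  assumes f: "gauss_integrable f" and t: "t > 0"
  shows "(\<lambda>m. \<integral>y. f y * tensor (\<lambda>j. cut_jet (\<gamma> j) t (x $ j) m) \<alpha> y \<partial>lborel)
    \<longlonglongrightarrow> (-1) ^ multi_order \<alpha> * heat (\<lambda>j. \<gamma> j + \<alpha> j) f (x, t)"
proof -
  have [measurable]: "f \<in> borel_measurable borel" by (rule gauss_integrable_measurable[OF f])
  let ?D = "\<lambda>m j. cut_jet (\<gamma> j) t (x $ j) m"
  have "\<forall>j. \<exists>C\<ge>0. \<forall>m s. \<bar>cut_jet (\<gamma> j) t (x $ j) m (\<alpha> j) s\<bar> \<le> C * exp (- (x $ j - s)\<^sup>2 / (8 * t\<^sup>2))"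
    using cut_jet_bound[OF t] by blast
  then obtain C where C: "\<And>j. C j \<ge> 0" "\<And>j m s. \<bar>cut_jet (\<gamma> j) t (x $ j) m (\<alpha> j) s\<bar> \<le> C j * exp (- (x $ j - s)\<^sup>2 / (8 * t\<^sup>2))"
    by metis
  define K where "K = (\<Prod>j\<in>UNIV. C j)"
  have K: "K \<ge> 0" unfolding K_def using C by (intro prod_nonneg) auto
  have bound: "\<bar>tensor (?D m) \<alpha> y\<bar> \<le> K * exp (- (norm (x - y))\<^sup>2 / (8 * t\<^sup>2))" for m y
  proof -
    have "\<bar>tensor (?D m) \<alpha> y\<bar> \<le> (\<Prod>j\<in>UNIV. C j * exp (- (x $ j - y $ j)\<^sup>2 / (8 * t\<^sup>2)))"
      unfolding tensor_def abs_prod by (intro prod_mono conjI C(2)) auto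
    also have "\<dots> = K * exp (- (norm (x - y))\<^sup>2 / (8 * t\<^sup>2))"
      by (simp add: prod.distrib K_def flip: exp_sum) (simp add: sum_negf norm_power2_vec sum_divide_distrib)
    finally show ?thesis .
  qed
  have "integrable lborel (\<lambda>y. exp (- (norm (x - y))\<^sup>2 / (8 * t\<^sup>2)) * \<bar>f y\<bar>)"
  proof -
    define \<epsilon> where "\<epsilon> = 1 / (8 * t\<^sup>2)"
    have "\<epsilon> > 0" using t by (simp add: \<epsilon>_def)
    from integrable_lborel_affine[OF gauss_integrable_abs[OF gauss_integrable_translate[OF f, of x] this, of 1], of 1 "- x"]
    have "integrable lborel (\<lambda>y. exp (- \<epsilon> * (norm (y - x))\<^sup>2) * \<bar>f y\<bar>)" by simp
    then show ?thesis by (simp add: \<epsilon>_def norm_minus_commute)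
  qed
  from integrable_mult_right[OF this, of K]
  have w: "integrable lborel (\<lambda>y. K * (exp (- (norm (x - y))\<^sup>2 / (8 * t\<^sup>2)) * \<bar>f y\<bar>))" by simp
  have "(\<lambda>m. \<integral>y. f y * tensor (?D m) \<alpha> y \<partial>lborel)
    \<longlonglongrightarrow> (\<integral>y. f y * (\<Prod>j\<in>UNIV. gauss_jet (\<gamma> j) t (x $ j) (\<alpha> j) (y $ j)) \<partial>lborel)"
  proof (rule integral_dominated_convergence[OF _ _ w])
    show "(\<lambda>y. f y * tensor (?D m) \<alpha> y) \<in> borel_measurable lborel" for m
      using tensor_measurable[of "?D m" \<alpha>] compact_jet_cut_jet[OF t] by simp
    have "(\<lambda>y. \<Prod>j\<in>UNIV. gauss_jet (\<gamma> j) t (x $ j) (\<alpha> j) (y $ j)) \<in> borel_measurable borel"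
      using tensor_measurable[of "\<lambda>j. gauss_jet (\<gamma> j) t (x $ j)" \<alpha>] jet_gauss_jet[OF t]
      by (simp add: tensor_def[abs_def])
    then show "(\<lambda>y. f y * (\<Prod>j\<in>UNIV. gauss_jet (\<gamma> j) t (x $ j) (\<alpha> j) (y $ j))) \<in> borel_measurable lborel" by simp
    show "AE y in lborel. (\<lambda>m. f y * tensor (?D m) \<alpha> y) \<longlonglongrightarrow> f y * (\<Prod>j\<in>UNIV. gauss_jet (\<gamma> j) t (x $ j) (\<alpha> j) (y $ j))"
      unfolding tensor_def by (intro AE_I2 tendsto_mult_left tendsto_prod cut_jet_tendsto)
    show "AE y in lborel. norm (f y * tensor (?D m) \<alpha> y) \<le> K * (exp (- (norm (x - y))\<^sup>2 / (8 * t\<^sup>2)) * \<bar>f y\<bar>)" for m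
    proof (intro AE_I2)
      fix y
      from mult_left_mono[OF bound[of m y], of "\<bar>f y\<bar>"]
      show "norm (f y * tensor (?D m) \<alpha> y) \<le> K * (exp (- (norm (x - y))\<^sup>2 / (8 * t\<^sup>2)) * \<bar>f y\<bar>)"
        by (simp add: abs_mult mult_ac)
    qed
  qed
  also have "(\<integral>y. f y * (\<Prod>j\<in>UNIV. gauss_jet (\<gamma> j) t (x $ j) (\<alpha> j) (y $ j)) \<partial>lborel)
     = (\<integral>y. (-1) ^ multi_order \<alpha> * (gauss_deriv (\<lambda>j. \<gamma> j + \<alpha> j) t (x - y) * f y) \<partial>lborel)"
    by (intro Bochner_Integration.integral_cong refl)
      (simp add: gauss_jet_def prod.distrib gauss_deriv_eq multi_order_def power_sum)
  also have "\<dots> = (-1) ^ multi_order \<alpha> * heat (\<lambda>j. \<gamma> j + \<alpha> j) f (x, t)"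
    by (simp add: heat_def)
  finally show ?thesis .
qed

text \<open>The truncated kernels of order \<gamma> are admissible in the weak identity. Letting m
  grow on both sides, the sign from the chain rule cancels the one from the weak derivative.\<close>

lemma heat_weak_partial:
  fixes f g :: "real^'n::finite \<Rightarrow> real"
  assumes f: "gauss_integrable f" and g: "gauss_integrable g" and weak: "weak_partial \<alpha> f g" and t: "t > 0"
  shows "heat (\<lambda>j. \<gamma> j + \<alpha> j) f (x, t) = heat \<gamma> g (x, t)"
proof -
  let ?D = "\<lambda>m j. cut_jet (\<gamma> j) t (x $ j) m" and ?s = "(-1) ^ multi_order \<alpha> :: real"
  have "(\<lambda>m. \<integral>y. f y * tensor (?D m) \<alpha> y \<partial>lborel) \<longlonglongrightarrow> ?s * heat (\<lambda>j. \<gamma> j + \<alpha> j) f (x, t)"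
    by (rule integral_cut_tensor_tendsto[OF f t])
  moreover have "(\<integral>y. f y * tensor (?D m) \<alpha> y \<partial>lborel) = ?s * (\<integral>y. g y * tensor (?D m) (\<lambda>_. 0) y \<partial>lborel)" for m
    using weak[unfolded weak_partial_def, rule_format, of "?D m"] compact_jet_cut_jet[OF t] by simp
  moreover have "(\<lambda>m. ?s * (\<integral>y. g y * tensor (?D m) (\<lambda>_. 0) y \<partial>lborel)) \<longlonglongrightarrow> ?s * heat \<gamma> g (x, t)"
    using integral_cut_tensor_tendsto[OF g t, of \<gamma> x "\<lambda>_. 0"] by (intro tendsto_mult_left) simp
  ultimately have "?s * heat (\<lambda>j. \<gamma> j + \<alpha> j) f (x, t) = ?s * heat \<gamma> g (x, t)"
    by (simp add: LIMSEQ_unique)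
  then show ?thesis by simp
qed

lemma multi_index_split:
  fixes \<beta> :: "'n::finite \<Rightarrow> nat"
  assumes "l \<le> multi_order \<beta>"
  shows "\<exists>\<alpha> \<gamma>. \<beta> = (\<lambda>j. \<gamma> j + \<alpha> j) \<and> multi_order \<alpha> = l \<and> multi_order \<beta> = multi_order \<gamma> + l"
  using assms
proof (induction l)
  case 0
  show ?case by (intro exI[of _ "\<lambda>_. 0"] exI[of _ \<beta>]) auto
next
  case (Suc l)
  then obtain \<alpha> \<gamma> where a: "\<beta> = (\<lambda>j. \<gamma> j + \<alpha> j)" "multi_order \<alpha> = l" "multi_order \<beta> = multi_order \<gamma> + l" by auto
  then have "multi_order \<gamma> > 0" using Suc.prems by simp
  then obtain i \<gamma>' where i: "\<gamma> = incr i \<gamma>'" by (rule incr_cases)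
  have "\<beta> = (\<lambda>j. \<gamma>' j + incr i \<alpha> j)" unfolding a(1) i by (auto simp: incr_def)
  moreover have "multi_order (incr i \<alpha>) = Suc l" "multi_order \<beta> = multi_order \<gamma>' + Suc l"
    using a i by simp_all
  ultimately show ?case by blast
qed

section \<open>The main estimate\<close>

text \<open>The spaces are defined by Lebesgue measurability, while the Fubini and translation
  arguments run on \<open>lborel\<close> with Borel functions; this relation links the two.\<close>

definition borel_version :: "(real^'n::finite \<Rightarrow> real) \<Rightarrow> (real^'n \<Rightarrow> real) \<Rightarrow> bool" where
  "borel_version f f' \<longleftrightarrow> f \<in> borel_measurable lebesgue \<and> f' \<in> borel_measurable borel \<and> (AE x in lborel. f x = f' x)"

lemma borel_version_exists:
  assumes "f \<in> borel_measurable lebesgue"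
  shows "\<exists>f'. borel_version f f'"
  using completion_ex_borel_measurable_real[OF assms] assms by (auto simp: borel_version_def)

lemma lebesgue_measurable_borel: "g \<in> borel_measurable borel \<Longrightarrow> g \<in> borel_measurable lebesgue"
  by (rule measurable_completion) simp

lemma borel_version_integral:
  assumes f: "borel_version f f'" and [measurable]: "\<phi> \<in> borel_measurable borel"
  shows "(LINT x|lebesgue. f x * \<phi> x) = (\<integral>x. f' x * \<phi> x \<partial>lborel)"
    and "integrable lebesgue (\<lambda>x. f x * \<phi> x) \<longleftrightarrow> integrable lborel (\<lambda>x. f' x * \<phi> x)"
proof -
  have [measurable]: "f' \<in> borel_measurable borel" using f by (simp add: borel_version_def)
  have ae: "AE x in lebesgue. f x * \<phi> x = f' x * \<phi> x"
    using f unfolding borel_version_def by (intro AE_completion) auto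
  have m: "(\<lambda>x. f x * \<phi> x) \<in> borel_measurable lebesgue" "(\<lambda>x. f' x * \<phi> x) \<in> borel_measurable lebesgue"
  proof -
    have "f \<in> borel_measurable lebesgue" using f by (simp add: borel_version_def)
    then show "(\<lambda>x. f x * \<phi> x) \<in> borel_measurable lebesgue"
      by (rule borel_measurable_times[OF _ lebesgue_measurable_borel]) measurable
    show "(\<lambda>x. f' x * \<phi> x) \<in> borel_measurable lebesgue" by (rule lebesgue_measurable_borel) measurable
  qed
  show "(LINT x|lebesgue. f x * \<phi> x) = (\<integral>x. f' x * \<phi> x \<partial>lborel)"
    using integral_cong_AE[OF m ae] integral_completion[of "\<lambda>x. f' x * \<phi> x" lborel] by simp
  show "integrable lebesgue (\<lambda>x. f x * \<phi> x) \<longleftrightarrow> integrable lborel (\<lambda>x. f' x * \<phi> x)"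
    using integrable_cong_AE[OF m ae] integrable_completion[of "\<lambda>x. f' x * \<phi> x" lborel] by simp
qed

lemma borel_version_weak_partial:
  fixes f g :: "real^'n::finite \<Rightarrow> real"
  assumes w: "has_weak_deriv \<alpha> f g" and f: "borel_version f f'" and g: "borel_version g g'"
  shows "weak_partial \<alpha> f' g'"
  unfolding weak_partial_def
proof (intro allI impI)
  fix D :: "'n \<Rightarrow> nat \<Rightarrow> real \<Rightarrow> real" assume D: "\<forall>i. compact_jet (D i)"
  then have meas: "tensor D \<beta> \<in> borel_measurable borel" for \<beta> by (intro tensor_measurable) simp
  obtain "is" where "is": "\<forall>i. count_list is i = \<alpha> i" using exists_count_list by blast
  have "partials (map (\<lambda>i. axis i 1) is) (tensor D (\<lambda>_. 0)) = tensor D (count_list is)"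
    using D by (intro partials_tensor) simp
  also have "count_list is = \<alpha>" using "is" by auto
  finally have p: "partials (map (\<lambda>i. axis i 1) is) (tensor D (\<lambda>_. 0)) = tensor D \<alpha>" .
  have "test_function (tensor D (\<lambda>_. 0))" using D by (intro test_function_tensor) simp
  with w "is" have "(LINT x|lebesgue. f x * partials (map (\<lambda>i. axis i 1) is) (tensor D (\<lambda>_. 0)) x)
      = (-1) ^ multi_order \<alpha> * (LINT x|lebesgue. g x * tensor D (\<lambda>_. 0) x)"
    unfolding has_weak_deriv_def by blast
  then show "(\<integral>x. f' x * tensor D \<alpha> x \<partial>lborel) = (-1) ^ multi_order \<alpha> * (\<integral>x. g' x * tensor D (\<lambda>_. 0) x \<partial>lborel)"
    unfolding p borel_version_integral(1)[OF f meas] borel_version_integral(1)[OF g meas] .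
qed

lemma Lp_loc_ball:
  assumes f: "f \<in> Lp_loc p" and v: "borel_version f f'"
  shows "(\<integral>\<^sup>+x. ennreal (\<bar>f' x\<bar> powr p) * indicator (ball 0 R) x \<partial>lborel) < \<infinity>"
proof -
  have "(\<integral>\<^sup>+x. ennreal (\<bar>f' x\<bar> powr p) * indicator (ball 0 R) x \<partial>lborel) = (\<integral>\<^sup>+x. ennreal (\<bar>f x\<bar> powr p) * indicator (ball 0 R) x \<partial>lborel)"
    using v unfolding borel_version_def by (intro nn_integral_cong_AE) auto
  also have "\<dots> = (\<integral>\<^sup>+x. ennreal (\<bar>f x\<bar> powr p) * indicator (ball 0 R) x \<partial>lebesgue)"
    by (rule nn_integral_completion[symmetric])
  also have "\<dots> \<le> (\<integral>\<^sup>+x. ennreal (\<bar>f x\<bar> powr p) * indicator (cball 0 R) x \<partial>lebesgue)"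
    by (intro nn_integral_mono mult_left_mono) (auto simp: indicator_def)
  also have "\<dots> < \<infinity>" using f by (auto simp: Lp_loc_def)
  finally show ?thesis .
qed

lemma Lp_loc_loc_integrable:
  assumes f: "f \<in> Lp_loc 1" and v: "borel_version f f'"
  shows "loc_integrable f'"
  unfolding loc_integrable_def
  using Lp_loc_ball[OF f v] v by (auto simp: borel_version_def)

lemma AE_lborel_translate:
  fixes a :: "'a::euclidean_space"
  assumes "AE x in lborel. P x"
  shows "AE x in lborel. P (x + a)"
proof -
  obtain N where N: "{x. \<not> P x} \<subseteq> N" "N \<in> null_sets lborel"
    using assms by (auto simp: eventually_ae_filter)
  have "{x. x - (- a) \<in> N} \<in> null_sets lborel" by (rule null_sets_translation[OF N(2)])
  moreover have "{x. \<not> P (x + a)} \<subseteq> {x. x - (- a) \<in> N}" using N(1) by auto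
  ultimately show ?thesis by (auto simp: eventually_ae_filter)
qed

lemma fdiff_AE_cong:
  fixes f g :: "'a::euclidean_space \<Rightarrow> real"
  assumes "AE x in lborel. f x = g x"
  shows "AE x in lborel. fdiff k h f x = fdiff k h g x"
  using assms
proof (induction k arbitrary: f g)
  case (Suc k)
  have "AE x in lborel. f (x + h) - f x = g (x + h) - g x"
    using AE_lborel_translate[OF Suc.prems, of h] Suc.prems by eventually_elim simp
  from Suc.IH[OF this] show ?case by simp
qed simp

lemma epowr_epowr:
  assumes "r > 0"
  shows "epowr (epowr x (1 / r)) r = x"
proof (cases x)
  case (real y)
  then show ?thesis using assms by (simp add: epowr_def powr_powr)
qed (simp add: epowr_def)

lemma epowr_mono:
  assumes "x \<le> y" "r > 0"
  shows "epowr x r \<le> epowr y r"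
proof (cases "y = \<infinity>")
  case False
  then have "y < top" by (simp add: less_top)
  then have "x \<noteq> \<infinity>" using assms(1) by auto
  then show ?thesis
    using False assms \<open>y < top\<close> by (simp add: epowr_def ennreal_leI powr_mono2 enn2real_mono)
qed (simp add: epowr_def)

text \<open>The p-th powers undo both the inner root of the L^p norm and the outer root, infinite
  values included. Changing f on a null set alters each difference only on a null set, for every
  fixed h.\<close>

lemma besov_seminorm_le1_powr:
  fixes f :: "real^'n::finite \<Rightarrow> real"
  assumes p: "1 \<le> p" and v: "borel_version f f'"
  shows "epowr (besov_seminorm_le1 s p f) p = difference_energy s p (\<lambda>h. fdiff (nat \<lfloor>s\<rfloor> + 1) h f')"
proof -
  have "epowr (Lp_norm p (fdiff k h f)) p = (\<integral>\<^sup>+x. ennreal (\<bar>fdiff k h f' x\<bar> powr p) \<partial>lborel)" for k h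
  proof -
    have "epowr (Lp_norm p (fdiff k h f)) p = (\<integral>\<^sup>+x. ennreal (\<bar>fdiff k h f x\<bar> powr p) \<partial>lborel)"
      using p unfolding Lp_norm_def by (subst epowr_epowr) (auto simp: nn_integral_completion)
    also have "\<dots> = (\<integral>\<^sup>+x. ennreal (\<bar>fdiff k h f' x\<bar> powr p) \<partial>lborel)"
    proof (intro nn_integral_cong_AE)
      have "AE x in lborel. fdiff k h f x = fdiff k h f' x" by (rule fdiff_AE_cong) (use v in \<open>simp add: borel_version_def\<close>)
      then show "AE x in lborel. ennreal (\<bar>fdiff k h f x\<bar> powr p) = ennreal (\<bar>fdiff k h f' x\<bar> powr p)"
        by eventually_elim simp
    qed
    finally show ?thesis .
  qed
  moreover have "p > 0" using p by simp
  ultimately show ?thesis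
    unfolding besov_seminorm_le1_def difference_energy_def by (simp only: epowr_epowr nn_integral_completion)
qed

section \<open>Besov functions and their weak derivatives against Gaussians\<close>

lemma besov_space_le1_version:
  fixes g :: "real^'n::finite \<Rightarrow> real"
  assumes p: "1 \<le> p" and s: "0 < s" "s \<le> 1" and g: "g \<in> besov_space_le1 s p" and v: "borel_version g g'"
  shows "gauss_integrable g'"
proof (rule gauss_integrable_difference_energy[OF p s])
  show "g' \<in> borel_measurable borel" using v by (simp add: borel_version_def)
  show "(\<integral>\<^sup>+h. ennreal (\<bar>g' h\<bar> powr p) * indicator (ball 0 R) h \<partial>lborel) < \<infinity>" for R
    using g by (intro Lp_loc_ball[OF _ v]) (simp add: besov_space_le1_def)
  have "besov_seminorm_le1 s p g < \<infinity>" using g by (simp add: besov_space_le1_def)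
  then have "epowr (besov_seminorm_le1 s p g) p < \<infinity>" by (simp add: epowr_def)
  then show "difference_energy s p (\<lambda>h. fdiff (nat \<lfloor>s\<rfloor> + 1) h g') < \<infinity>"
    by (simp only: besov_seminorm_le1_powr[OF p v])
qed

text \<open>The remainder s - l lies in (0, 1]; for an integer s > 1 it is exactly 1, the case of
  second differences.\<close>

lemma besov_order_props:
  assumes "s > 1"
  shows "1 \<le> besov_order s" "real (besov_order s) < s" "s - real (besov_order s) \<le> 1"
proof -
  let ?J = "{j. 1 \<le> j \<and> real j < s}"
  have fin: "finite ?J"
  proof (rule finite_subset)
    show "?J \<subseteq> {..nat \<lceil>s\<rceil>}" by (auto simp: le_nat_iff) linarith
  qed simp
  have "1 \<in> ?J" using assms by simp
  then have "besov_order s \<in> ?J" unfolding besov_order_def by (intro Max_in fin) blast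
  then show "1 \<le> besov_order s" "real (besov_order s) < s" by auto
  have "Suc (besov_order s) \<notin> ?J"
    using Max_ge[OF fin, of "Suc (besov_order s)"] by (auto simp: besov_order_def)
  then show "s - real (besov_order s) \<le> 1" by simp
qed

lemma weak_deriv_Wkp_loc:
  assumes "f \<in> Wkp_loc k p" "multi_order \<alpha> \<le> k"
  shows "has_weak_deriv \<alpha> f (weak_deriv \<alpha> f)"
proof -
  obtain g where "has_weak_deriv \<alpha> f g" using assms by (auto simp: Wkp_loc_def)
  then show ?thesis unfolding weak_deriv_def by (rule someI[where P = "has_weak_deriv \<alpha> f"])
qed

lemma besov_space_lebesgue:
  assumes "f \<in> besov_space s p"
  shows "f \<in> borel_measurable lebesgue"
  using assms by (auto simp: besov_space_def besov_space_le1_def Wkp_loc_def Lp_loc_def split: if_splits)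

lemma besov_space_weak_deriv:
  fixes f :: "real^'n::finite \<Rightarrow> real"
  assumes p: "1 \<le> p" and s: "s > 1" and f: "f \<in> besov_space s p" and \<alpha>: "multi_order \<alpha> = besov_order s"
    and v: "borel_version f f'"
  shows "\<exists>g'. borel_version (weak_deriv \<alpha> f) g' \<and> gauss_integrable g' \<and> weak_partial \<alpha> f' g'"
proof -
  have f': "f \<in> Wkp_loc (besov_order s) p" "weak_deriv \<alpha> f \<in> besov_space_le1 (s - real (besov_order s)) p"
    using f s \<alpha> by (auto simp: besov_space_def)
  have w: "has_weak_deriv \<alpha> f (weak_deriv \<alpha> f)" by (rule weak_deriv_Wkp_loc[OF f'(1)]) (simp add: \<alpha>)
  then have "weak_deriv \<alpha> f \<in> borel_measurable lebesgue" by (simp add: has_weak_deriv_def Lp_loc_def)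
  then obtain g' where g': "borel_version (weak_deriv \<alpha> f) g'" using borel_version_exists by blast
  moreover have "gauss_integrable g'"
    using besov_order_props[OF s] by (intro besov_space_le1_version[OF p _ _ f'(2) g']) auto
  moreover have "weak_partial \<alpha> f' g'" by (rule borel_version_weak_partial[OF w v g'])
  ultimately show ?thesis by blast
qed

lemma besov_space_gauss_integrable:
  fixes f :: "real^'n::finite \<Rightarrow> real"
  assumes p: "1 \<le> p" and s: "0 < s" and f: "f \<in> besov_space s p" and v: "borel_version f f'"
  shows "gauss_integrable f'"
proof (cases "s \<le> 1")
  case True
  then show ?thesis using f by (intro besov_space_le1_version[OF p s _ _ v]) (auto simp: besov_space_def)
next
  case False
  then have s1: "s > 1" by simp
  have fW: "f \<in> Wkp_loc (besov_order s) p" using f s1 by (simp add: besov_space_def)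
  show ?thesis
  proof (rule gauss_integrable_weak_partials[where l = "besov_order s"])
    \<comment> \<open>The weak derivative of order zero is taken because
      \<open>has_weak_deriv\<close> records that f is locally integrable.\<close>
    have "has_weak_deriv (\<lambda>_. 0) f (weak_deriv (\<lambda>_. 0) f)" by (rule weak_deriv_Wkp_loc[OF fW]) simp
    then show "loc_integrable f'" by (intro Lp_loc_loc_integrable[OF _ v]) (simp add: has_weak_deriv_def)
    show "\<exists>g. loc_integrable g \<and> weak_partial \<alpha> f' g" if "multi_order \<alpha> < besov_order s" for \<alpha>
    proof -
      have w: "has_weak_deriv \<alpha> f (weak_deriv \<alpha> f)" by (rule weak_deriv_Wkp_loc[OF fW]) (use that in simp)
      then have L: "weak_deriv \<alpha> f \<in> Lp_loc 1" by (simp add: has_weak_deriv_def)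
      then obtain g' where g': "borel_version (weak_deriv \<alpha> f) g'"
        using borel_version_exists[of "weak_deriv \<alpha> f"] by (auto simp: Lp_loc_def)
      show ?thesis using Lp_loc_loc_integrable[OF L g'] borel_version_weak_partial[OF w v g'] by blast
    qed
    show "\<exists>g. gauss_integrable g \<and> weak_partial \<alpha> f' g" if "multi_order \<alpha> = besov_order s" for \<alpha>
      using besov_space_weak_deriv[OF p s1 f that v] by blast
  qed
qed

section \<open>Weighted energies of the terms that make up a derivative\<close>

lemma heat_energy_time_power:
  fixes F :: "(real^'n::finite) \<times> real \<Rightarrow> real"
  shows "heat_energy b p (\<lambda>z. snd z ^ j * F z) = heat_energy (b + real j * p) p F"
  unfolding heat_energy_def
proof (intro nn_integral_cong)
  fix z :: "(real^'n) \<times> real"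
  have "snd z powr b * \<bar>snd z ^ j * F z\<bar> powr p = snd z powr (b + real j * p) * \<bar>F z\<bar> powr p" if "z \<in> half_space"
  proof -
    have t: "snd z > 0" using that by (auto simp: half_space_def)
    then have "(snd z ^ j) powr p = snd z powr (real j * p)" by (simp add: powr_realpow[symmetric] powr_powr)
    then show ?thesis using t by (simp add: abs_mult powr_mult powr_add mult.assoc)
  qed
  then show "ennreal (snd z powr b * \<bar>snd z ^ j * F z\<bar> powr p) * indicator half_space z
    = ennreal (snd z powr (b + real j * p) * \<bar>F z\<bar> powr p) * indicator half_space z"
    by (cases "z \<in> half_space") auto
qed

lemma heat_energy_cong:
  "(\<And>z. z \<in> half_space \<Longrightarrow> F z = G z) \<Longrightarrow> heat_energy b p F = heat_energy b p G"
  unfolding heat_energy_def by (intro nn_integral_cong) (auto simp: indicator_def)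

lemma heat_energy_add:
  fixes F G :: "(real^'n::finite) \<times> real \<Rightarrow> real"
  assumes p: "1 \<le> p" and [measurable]: "F \<in> borel_measurable borel" "G \<in> borel_measurable borel"
  shows "heat_energy b p (\<lambda>z. F z + G z) \<le> ennreal (2 powr p) * (heat_energy b p F + heat_energy b p G)"
proof -
  have "heat_energy b p (\<lambda>z. F z + G z) \<le> (\<integral>\<^sup>+z. ennreal (2 powr p) * (ennreal (snd z powr b * \<bar>F z\<bar> powr p) * indicator half_space z
      + ennreal (snd z powr b * \<bar>G z\<bar> powr p) * indicator half_space z) \<partial>lborel)"
    unfolding heat_energy_def
  proof (intro nn_integral_mono)
    fix z :: "(real^'n) \<times> real"
    have "snd z powr b * \<bar>F z + G z\<bar> powr p \<le> snd z powr b * (2 powr p * (\<bar>F z\<bar> powr p + \<bar>G z\<bar> powr p))"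
      using p by (intro mult_left_mono powr_add_le) auto
    then have "ennreal (snd z powr b * \<bar>F z + G z\<bar> powr p) \<le> ennreal (2 powr p * (snd z powr b * \<bar>F z\<bar> powr p + snd z powr b * \<bar>G z\<bar> powr p))"
      by (intro ennreal_leI) (simp add: algebra_simps)
    then show "ennreal (snd z powr b * \<bar>F z + G z\<bar> powr p) * indicator half_space z
      \<le> ennreal (2 powr p) * (ennreal (snd z powr b * \<bar>F z\<bar> powr p) * indicator half_space z
        + ennreal (snd z powr b * \<bar>G z\<bar> powr p) * indicator half_space z)"
      by (cases "z \<in> half_space") (auto simp: ennreal_mult)
  qed
  also have "\<dots> = ennreal (2 powr p) * (heat_energy b p F + heat_energy b p G)"
    unfolding heat_energy_def by (subst nn_integral_cmult, measurable, subst nn_integral_add) auto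
  finally show ?thesis .
qed

lemma heat_energy_cmult:
  fixes F :: "(real^'n::finite) \<times> real \<Rightarrow> real"
  assumes [measurable]: "F \<in> borel_measurable borel"
  shows "heat_energy b p (\<lambda>z. c * F z) = ennreal (\<bar>c\<bar> powr p) * heat_energy b p F"
proof -
  have "heat_energy b p (\<lambda>z. c * F z) = (\<integral>\<^sup>+z. ennreal (\<bar>c\<bar> powr p) * (ennreal (snd z powr b * \<bar>F z\<bar> powr p) * indicator half_space z) \<partial>lborel)"
    unfolding heat_energy_def
    by (intro nn_integral_cong) (simp add: abs_mult powr_mult ennreal_mult mult_ac)
  then show ?thesis unfolding heat_energy_def by (simp add: nn_integral_cmult)
qed

lemma heat_class_measurable:
  assumes "heat_class k V" and f: "f \<in> borel_measurable borel"
  shows "V f \<in> borel_measurable borel"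
  using assms(1)
proof induction
  case (base \<beta> k j)
  note heat_measurable[OF f, measurable]
  show ?case by measurable
qed auto

text \<open>For s > 1 the splitting of \<beta> into \<gamma> and \<alpha> with |\<alpha>| = l is
  fixed before f, so C does not depend on f. The condition s - l < |\<gamma>| is just s < |\<beta>|,
  the weight exponent is unchanged, and the seminorm of the single derivative of order \<alpha> is
  one summand of the full seminorm.\<close>

lemma heat_energy_besov:
  fixes \<beta> :: "'n::finite \<Rightarrow> nat"
  assumes p: "1 \<le> p" and s: "0 < s" "s < real (multi_order \<beta>)"
  shows "\<exists>C\<ge>0. \<forall>f f'. f \<in> besov_space s p \<longrightarrow> borel_version f f' \<longrightarrow>
     heat_energy ((real (multi_order \<beta>) - s) * p - 1) p (heat \<beta> f') \<le> ennreal C * epowr (besov_seminorm s p f) p"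
proof (cases "s \<le> 1")
  case True
  obtain C where C: "C \<ge> 0" "\<And>g. gauss_integrable g \<Longrightarrow>
     heat_energy ((real (multi_order \<beta>) - s) * p - 1) p (heat \<beta> g) \<le> ennreal C * difference_energy s p (\<lambda>h. fdiff (nat \<lfloor>s\<rfloor> + 1) h g)"
    using heat_energy_bound[OF p s(1) True s(2)] by blast
  have "heat_energy ((real (multi_order \<beta>) - s) * p - 1) p (heat \<beta> f') \<le> ennreal C * epowr (besov_seminorm s p f) p"
    if f: "f \<in> besov_space s p" and v: "borel_version f f'" for f f'
    using C(2)[OF besov_space_gauss_integrable[OF p s(1) f v]] True besov_seminorm_le1_powr[OF p v, of s]
    by (simp add: besov_seminorm_def)
  then show ?thesis using C(1) by blast
next
  case False
  then have s1: "s > 1" by simp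
  define l where "l = besov_order s"
  note l = besov_order_props[OF s1, folded l_def]
  have "real l < real (multi_order \<beta>)" using l s by linarith
  then have "l \<le> multi_order \<beta>" by simp
  then obtain \<alpha> \<gamma> where ag: "\<beta> = (\<lambda>j. \<gamma> j + \<alpha> j)" "multi_order \<alpha> = l" "multi_order \<beta> = multi_order \<gamma> + l"
    using multi_index_split by blast
  have "s - real l < real (multi_order \<gamma>)" "0 < s - real l" using s ag l by auto
  then obtain C where C: "C \<ge> 0" "\<And>g. gauss_integrable g \<Longrightarrow>
     heat_energy ((real (multi_order \<gamma>) - (s - real l)) * p - 1) p (heat \<gamma> g)
       \<le> ennreal C * difference_energy (s - real l) p (\<lambda>h. fdiff (nat \<lfloor>s - real l\<rfloor> + 1) h g)"
    using heat_energy_bound[OF p _ l(3), of \<gamma>] by blast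
  have e: "real (multi_order \<gamma>) - (s - real l) = real (multi_order \<beta>) - s" using ag by simp
  have "heat_energy ((real (multi_order \<beta>) - s) * p - 1) p (heat \<beta> f') \<le> ennreal C * epowr (besov_seminorm s p f) p"
    if f: "f \<in> besov_space s p" and v: "borel_version f f'" for f f'
  proof -
    obtain g' where g': "borel_version (weak_deriv \<alpha> f) g'" "gauss_integrable g'" "weak_partial \<alpha> f' g'"
      using besov_space_weak_deriv[OF p s1 f _ v, of \<alpha>] ag by (auto simp: l_def)
    have f': "gauss_integrable f'" by (rule besov_space_gauss_integrable[OF p s(1) f v])
    have "heat_energy ((real (multi_order \<beta>) - s) * p - 1) p (heat \<beta> f') = heat_energy ((real (multi_order \<beta>) - s) * p - 1) p (heat \<gamma> g')"
      unfolding ag(1) by (rule heat_energy_cong) (auto simp: half_space_def heat_weak_partial[OF f' g'(2,3)])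
    also have "\<dots> \<le> ennreal C * difference_energy (s - real l) p (\<lambda>h. fdiff (nat \<lfloor>s - real l\<rfloor> + 1) h g')"
      using C(2)[OF g'(2)] by (simp only: e)
    also have "\<dots> = ennreal C * epowr (besov_seminorm_le1 (s - real l) p (weak_deriv \<alpha> f)) p"
      by (simp only: besov_seminorm_le1_powr[OF p g'(1)])
    also have "\<dots> \<le> ennreal C * epowr (besov_seminorm s p f) p"
    proof (intro mult_left_mono epowr_mono)
      show "besov_seminorm_le1 (s - real l) p (weak_deriv \<alpha> f) \<le> besov_seminorm s p f"
      proof -
        have "besov_seminorm_le1 (s - real l) p (weak_deriv \<alpha> f)
          \<le> (\<Sum>\<alpha> | multi_order \<alpha> = l. besov_seminorm_le1 (s - real l) p (weak_deriv \<alpha> f))"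
          by (rule member_le_sum[where f = "\<lambda>\<alpha>. besov_seminorm_le1 (s - real l) p (weak_deriv \<alpha> f)"])
            (use ag(2) finite_multi_order[of l] in auto)
        then show ?thesis using s1 by (simp add: besov_seminorm_def l_def)
      qed
    qed (use p in auto)
    finally show ?thesis .
  qed
  then show ?thesis using C(1) by blast
qed

lemma heat_class_besov:
  fixes V :: "(real^'n::finite \<Rightarrow> real) \<Rightarrow> (real^'n) \<times> real \<Rightarrow> real"
  assumes p: "1 \<le> p" and s: "0 < s" "s < real k" and V: "heat_class k V"
  shows "\<exists>C\<ge>0. \<forall>f f'. f \<in> besov_space s p \<longrightarrow> borel_version f f' \<longrightarrow>
     heat_energy ((real k - s) * p - 1) p (V f') \<le> ennreal C * epowr (besov_seminorm s p f) p"
  using V s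
proof induction
  case (base \<beta> k j)
  \<comment> \<open>The factor t^j raises the weight by j p, exactly what |\<beta>| = k + j demands;
    all terms of order k therefore share one weight.\<close>
  have "(real k - s) * p - 1 + real j * p = (real (multi_order \<beta>) - s) * p - 1"
    using base by (simp add: algebra_simps)
  moreover have "s < real (multi_order \<beta>)" using base by simp
  ultimately show ?case
    using heat_energy_besov[OF p, of s \<beta>] base(2) by (simp only: heat_energy_time_power)
next
  case (add k V W)
  then obtain C1 C2 where C: "C1 \<ge> 0" "C2 \<ge> 0"
    "\<And>f f'. f \<in> besov_space s p \<Longrightarrow> borel_version f f' \<Longrightarrow> heat_energy ((real k - s) * p - 1) p (V f') \<le> ennreal C1 * epowr (besov_seminorm s p f) p"
    "\<And>f f'. f \<in> besov_space s p \<Longrightarrow> borel_version f f' \<Longrightarrow> heat_energy ((real k - s) * p - 1) p (W f') \<le> ennreal C2 * epowr (besov_seminorm s p f) p"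
    by metis
  have "heat_energy ((real k - s) * p - 1) p (\<lambda>z. V f' z + W f' z) \<le> ennreal (2 powr p * (C1 + C2)) * epowr (besov_seminorm s p f) p"
    if f: "f \<in> besov_space s p" and v: "borel_version f f'" for f f'
  proof -
    have m: "f' \<in> borel_measurable borel" using v by (simp add: borel_version_def)
    have "heat_energy ((real k - s) * p - 1) p (\<lambda>z. V f' z + W f' z)
      \<le> ennreal (2 powr p) * (heat_energy ((real k - s) * p - 1) p (V f') + heat_energy ((real k - s) * p - 1) p (W f'))"
      by (intro heat_energy_add p heat_class_measurable[OF _ m, of k]) (use add.hyps in auto)
    also have "\<dots> \<le> ennreal (2 powr p) * (ennreal C1 * epowr (besov_seminorm s p f) p + ennreal C2 * epowr (besov_seminorm s p f) p)"
      by (intro mult_left_mono add_mono C f v) auto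
    finally show ?thesis using C(1,2) by (simp add: ennreal_mult distrib_right mult.assoc)
  qed
  then show ?case using C(1,2) by (intro exI[of _ "2 powr p * (C1 + C2)"]) auto
next
  case (scale k V c)
  then obtain C where C: "C \<ge> 0"
    "\<And>f f'. f \<in> besov_space s p \<Longrightarrow> borel_version f f' \<Longrightarrow> heat_energy ((real k - s) * p - 1) p (V f') \<le> ennreal C * epowr (besov_seminorm s p f) p"
    by metis
  have "heat_energy ((real k - s) * p - 1) p (\<lambda>z. c * V f' z) \<le> ennreal (\<bar>c\<bar> powr p * C) * epowr (besov_seminorm s p f) p"
    if f: "f \<in> besov_space s p" and v: "borel_version f f'" for f f'
  proof -
    have m: "f' \<in> borel_measurable borel" using v by (simp add: borel_version_def)
    have "heat_energy ((real k - s) * p - 1) p (\<lambda>z. c * V f' z) = ennreal (\<bar>c\<bar> powr p) * heat_energy ((real k - s) * p - 1) p (V f')"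
      by (intro heat_energy_cmult heat_class_measurable[OF _ m, of k]) (use scale.hyps in auto)
    also have "\<dots> \<le> ennreal (\<bar>c\<bar> powr p) * (ennreal C * epowr (besov_seminorm s p f) p)"
      by (intro mult_left_mono C f v) auto
    finally show ?thesis using C(1) by (simp add: ennreal_mult mult.assoc)
  qed
  then show ?case using C(1) by (intro exI[of _ "\<bar>c\<bar> powr p * C"]) auto
qed

lemma powr_sum_le:
  fixes x :: "'i \<Rightarrow> real"
  assumes p: "1 \<le> p" and I: "finite I" and x: "\<And>i. i \<in> I \<Longrightarrow> 0 \<le> x i"
  shows "(\<Sum>i\<in>I. x i) powr p \<le> real (card I) powr p * (\<Sum>i\<in>I. x i powr p)"
proof (cases "I = {}")
  case False
  define M where "M = Max (x ` I)"
  have "M \<in> x ` I" unfolding M_def using I False by (intro Max_in) auto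
  then obtain i where i: "i \<in> I" "M = x i" by auto
  have "(\<Sum>i\<in>I. x i) \<le> real (card I) * M"
    using I unfolding M_def by (intro sum_bounded_above) auto
  then have "(\<Sum>i\<in>I. x i) powr p \<le> (real (card I) * M) powr p"
    using p x by (intro powr_mono2 sum_nonneg) auto
  also have "\<dots> = real (card I) powr p * x i powr p" using i x by (simp add: powr_mult)
  also have "\<dots> \<le> real (card I) powr p * (\<Sum>i\<in>I. x i powr p)"
    using I i by (intro mult_left_mono member_le_sum) auto
  finally show ?thesis .
qed (use p in simp)

lemma gauss_ext_eq_heat:
  assumes v: "borel_version f f'" and z: "z \<in> half_space"
  shows "gauss_ext f z = heat (\<lambda>_. 0) f' z"
proof -
  obtain x t where zt: "z = (x, t)" "t > 0" using z by (auto simp: half_space_def)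
  have [measurable]: "(\<lambda>y. gauss_deriv (\<lambda>_. 0) t (x - y)) \<in> borel_measurable borel" by measurable
  have "gauss_ext f z = (LINT y|lebesgue. f y * gauss_deriv (\<lambda>_. 0) t (x - y))"
    by (simp add: gauss_ext_def zt gauss_deriv_eq_gauss_kernel mult.commute)
  also have "\<dots> = (\<integral>y. f' y * gauss_deriv (\<lambda>_. 0) t (x - y) \<partial>lborel)"
    by (rule borel_version_integral(1)[OF v]) measurable
  finally show ?thesis by (simp add: heat_def zt mult.commute)
qed

lemma gauss_kernel_integrable:
  fixes f :: "real^'n::finite \<Rightarrow> real"
  assumes v: "borel_version f f'" and f': "gauss_integrable f'" and t: "t > 0"
  shows "integrable lebesgue (\<lambda>y. gauss_kernel t (x - y) * f y)"
proof -
  have "(\<lambda>y. gauss_deriv (\<lambda>_. 0) t (x - y)) \<in> borel_measurable borel" by measurable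
  from borel_version_integral(2)[OF v this] heat_integrable[OF f' t, of "\<lambda>_. 0" x]
  show ?thesis by (simp add: gauss_deriv_eq_gauss_kernel[OF t, symmetric] mult.commute)
qed

theorem theorem1p2:
  fixes m :: nat and p a :: real
  assumes "1 \<le> p"
    and "-1 < a" and "a < p * (real m + 1) - 1"
  shows "\<exists>C::real. C > 0 \<and>
    (\<forall>f :: real^'n::finite \<Rightarrow> real.
       f \<in> besov_space (real m + 1 - (a + 1) / p) p \<longrightarrow>
         (\<forall>x t. 0 < t \<longrightarrow> integrable lebesgue (\<lambda>y. gauss_kernel t (x - y) * f y)) \<and>
         Ck_on (m + 1) (gauss_ext f) half_space \<and>
         (\<integral>\<^sup>+z\<in>half_space. ennreal (snd z powr a * grad_norm (m + 1) (gauss_ext f) z powr p)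
            \<partial>lebesgue)
           \<le> ennreal C * epowr (besov_seminorm (real m + 1 - (a + 1) / p) p f) p)"
proof -
  define s where "s = real m + 1 - (a + 1) / p"
  have p: "1 \<le> p" and p0: "p > 0" using assms by auto
  \<comment> \<open>The two bounds on a are equivalent to 0 < s < m + 1, and s is such that the
    weight exponent (m + 1 - s) p - 1 equals a.\<close>
  have "(a + 1) / p > 0" using assms p0 by simp
  then have s_less: "s < real (m + 1)" by (simp add: s_def)
  have "(a + 1) / p < real m + 1" using assms p0 by (simp add: pos_divide_less_eq mult.commute)
  then have s_pos: "0 < s" by (simp add: s_def)
  have a_eq: "(real (m + 1) - s) * p - 1 = a" using p0 by (simp add: s_def)
  let ?B = "{bs. set bs \<subseteq> (Basis :: ((real^'n) \<times> real) set) \<and> length bs = m + 1}"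
  have fin: "finite ?B" by (rule finite_tensor_index)
  \<comment> \<open>For each of the finitely many entries of the tensor the operator and its
    constant are chosen before f.\<close>
  have "\<forall>bs\<in>?B. \<exists>W C. heat_class (m + 1) W \<and> C \<ge> 0 \<and>
     (\<forall>f z. gauss_integrable f \<longrightarrow> z \<in> half_space \<longrightarrow> partials bs (heat (\<lambda>_. 0) f) z = W f z) \<and>
     (\<forall>f f'. f \<in> besov_space s p \<longrightarrow> borel_version f f' \<longrightarrow> heat_energy a p (W f') \<le> ennreal C * epowr (besov_seminorm s p f) p)"
  proof
    fix bs assume bs: "bs \<in> ?B"
    then obtain W where W: "heat_class (m + 1) W"
      "\<forall>f z. gauss_integrable f \<longrightarrow> z \<in> half_space \<longrightarrow> partials bs (heat (\<lambda>_. 0) f) z = W f z"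
      using partials_heat_class[of bs] by auto
    obtain C where "C \<ge> 0" "\<forall>f f'. f \<in> besov_space s p \<longrightarrow> borel_version f f' \<longrightarrow>
       heat_energy a p (W f') \<le> ennreal C * epowr (besov_seminorm s p f) p"
      using heat_class_besov[OF p s_pos s_less W(1)] unfolding a_eq by blast
    then show "\<exists>W C. heat_class (m + 1) W \<and> C \<ge> 0 \<and>
     (\<forall>f z. gauss_integrable f \<longrightarrow> z \<in> half_space \<longrightarrow> partials bs (heat (\<lambda>_. 0) f) z = W f z) \<and>
     (\<forall>f f'. f \<in> besov_space s p \<longrightarrow> borel_version f f' \<longrightarrow> heat_energy a p (W f') \<le> ennreal C * epowr (besov_seminorm s p f) p)"
      using W by blast
  qed
  from bchoice[OF this] obtain W where "\<forall>bs\<in>?B. \<exists>C. heat_class (m + 1) (W bs) \<and> C \<ge> 0 \<and>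
     (\<forall>f z. gauss_integrable f \<longrightarrow> z \<in> half_space \<longrightarrow> partials bs (heat (\<lambda>_. 0) f) z = W bs f z) \<and>
     (\<forall>f f'. f \<in> besov_space s p \<longrightarrow> borel_version f f' \<longrightarrow> heat_energy a p (W bs f') \<le> ennreal C * epowr (besov_seminorm s p f) p)" ..
  from bchoice[OF this] obtain C where *: "\<forall>bs\<in>?B. heat_class (m + 1) (W bs) \<and> C bs \<ge> 0 \<and>
     (\<forall>f z. gauss_integrable f \<longrightarrow> z \<in> half_space \<longrightarrow> partials bs (heat (\<lambda>_. 0) f) z = W bs f z) \<and>
     (\<forall>f f'. f \<in> besov_space s p \<longrightarrow> borel_version f f' \<longrightarrow> heat_energy a p (W bs f') \<le> ennreal (C bs) * epowr (besov_seminorm s p f) p)" ..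
  have WC: "heat_class (m + 1) (W bs)" "C bs \<ge> 0"
    "\<And>f z. gauss_integrable f \<Longrightarrow> z \<in> half_space \<Longrightarrow> partials bs (heat (\<lambda>_. 0) f) z = W bs f z"
    "\<And>f f'. f \<in> besov_space s p \<Longrightarrow> borel_version f f' \<Longrightarrow> heat_energy a p (W bs f') \<le> ennreal (C bs) * epowr (besov_seminorm s p f) p"
    if "bs \<in> ?B" for bs
    using bspec[OF * that] by blast+
  define N where "N = real (card ?B) powr p"
  have N: "N \<ge> 0" by (simp add: N_def)
  \<comment> \<open>N bounds the p-th power of a sum of \<open>card ?B\<close> terms by the sum of
    the p-th powers; the summand 1 makes K positive even if all the C bs are 0.\<close>
  define K where "K = N * (\<Sum>bs\<in>?B. C bs) + 1"
  have C_sum: "(\<Sum>bs\<in>?B. C bs) \<ge> 0" using WC(2) by (intro sum_nonneg)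
  have K: "K > 0" using mult_nonneg_nonneg[OF N C_sum] by (simp add: K_def)
  have main: "(\<forall>x t. 0 < t \<longrightarrow> integrable lebesgue (\<lambda>y. gauss_kernel t (x - y) * f y)) \<and>
         Ck_on (m + 1) (gauss_ext f) half_space \<and>
         (\<integral>\<^sup>+z\<in>half_space. ennreal (snd z powr a * grad_norm (m + 1) (gauss_ext f) z powr p) \<partial>lebesgue)
           \<le> ennreal K * epowr (besov_seminorm s p f) p"
    if f: "f \<in> besov_space s p" for f :: "real^'n \<Rightarrow> real"
  proof (intro conjI allI impI)
    obtain f' where v: "borel_version f f'" using borel_version_exists[OF besov_space_lebesgue[OF f]] by blast
    have f': "gauss_integrable f'" by (rule besov_space_gauss_integrable[OF p s_pos f v])
    have m': "f' \<in> borel_measurable borel" using v by (simp add: borel_version_def)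
    note ext = gauss_ext_eq_heat[OF v]
    show "integrable lebesgue (\<lambda>y. gauss_kernel t (x - y) * f y)" if "0 < t" for x t
      by (rule gauss_kernel_integrable[OF v f' that])
    show "Ck_on (m + 1) (gauss_ext f) half_space"
      by (rule Ck_on_cong_open[OF open_half_space ext Ck_on_heat[OF f']])
    have "(\<integral>\<^sup>+z\<in>half_space. ennreal (snd z powr a * grad_norm (m + 1) (gauss_ext f) z powr p) \<partial>lebesgue)
       = (\<integral>\<^sup>+z\<in>half_space. ennreal (snd z powr a * grad_norm (m + 1) (gauss_ext f) z powr p) \<partial>lborel)"
      by (rule nn_integral_completion)
    also have "\<dots> \<le> (\<integral>\<^sup>+z. ennreal N * (\<Sum>bs\<in>?B. ennreal (snd z powr a * \<bar>W bs f' z\<bar> powr p) * indicator half_space z) \<partial>lborel)"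
    proof (intro nn_integral_mono)
      fix z :: "(real^'n) \<times> real"
      show "ennreal (snd z powr a * grad_norm (m + 1) (gauss_ext f) z powr p) * indicator half_space z
        \<le> ennreal N * (\<Sum>bs\<in>?B. ennreal (snd z powr a * \<bar>W bs f' z\<bar> powr p) * indicator half_space z)"
      proof (cases "z \<in> half_space")
        case True
        have "partials bs (gauss_ext f) z = W bs f' z" if "bs \<in> ?B" for bs
          using partials_cong_open[OF open_half_space ext True, where bs = bs] WC(3)[OF that f' True] by simp
        then have "grad_norm (m + 1) (gauss_ext f) z = sqrt (\<Sum>bs\<in>?B. (W bs f' z)\<^sup>2)"
          unfolding grad_norm_def by (intro arg_cong[where f = sqrt] sum.cong) auto
        also have "\<dots> \<le> (\<Sum>bs\<in>?B. \<bar>W bs f' z\<bar>)"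
          using L2_set_le_sum_abs[of "\<lambda>bs. W bs f' z" ?B] by (simp only: L2_set_def)
        finally have "grad_norm (m + 1) (gauss_ext f) z powr p \<le> (\<Sum>bs\<in>?B. \<bar>W bs f' z\<bar>) powr p"
          using p0 by (intro powr_mono2) (auto simp: grad_norm_def sum_nonneg)
        also have "\<dots> \<le> N * (\<Sum>bs\<in>?B. \<bar>W bs f' z\<bar> powr p)"
          unfolding N_def by (rule powr_sum_le[OF p fin]) simp
        finally have "snd z powr a * grad_norm (m + 1) (gauss_ext f) z powr p \<le> snd z powr a * (N * (\<Sum>bs\<in>?B. \<bar>W bs f' z\<bar> powr p))"
          by (intro mult_left_mono) auto
        also have "\<dots> = N * (\<Sum>bs\<in>?B. snd z powr a * \<bar>W bs f' z\<bar> powr p)"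
          by (simp add: sum_distrib_left mult_ac)
        finally have "ennreal (snd z powr a * grad_norm (m + 1) (gauss_ext f) z powr p)
           \<le> ennreal (N * (\<Sum>bs\<in>?B. snd z powr a * \<bar>W bs f' z\<bar> powr p))" by (rule ennreal_leI)
        also have "\<dots> = ennreal N * (\<Sum>bs\<in>?B. ennreal (snd z powr a * \<bar>W bs f' z\<bar> powr p))"
          using N by (subst ennreal_mult) (auto intro: sum_nonneg simp: sum_ennreal)
        finally show ?thesis using True by simp
      qed simp
    qed
    also have "\<dots> = ennreal N * (\<Sum>bs\<in>?B. heat_energy a p (W bs f'))"
    proof -
      let ?F = "\<lambda>bs z. ennreal (snd z powr a * \<bar>W bs f' z\<bar> powr p) * indicator half_space z"
      have F: "?F bs \<in> borel_measurable lborel" if "bs \<in> ?B" for bs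
      proof -
        note heat_class_measurable[OF WC(1)[OF that] m', measurable]
        show ?thesis by measurable
      qed
      have "(\<integral>\<^sup>+z. ennreal N * (\<Sum>bs\<in>?B. ?F bs z) \<partial>lborel) = ennreal N * (\<integral>\<^sup>+z. (\<Sum>bs\<in>?B. ?F bs z) \<partial>lborel)"
        by (rule nn_integral_cmult) (rule borel_measurable_sum, rule F)
      also have "(\<integral>\<^sup>+z. (\<Sum>bs\<in>?B. ?F bs z) \<partial>lborel) = (\<Sum>bs\<in>?B. (\<integral>\<^sup>+z. ?F bs z \<partial>lborel))"
        by (rule nn_integral_sum) (rule F)
      finally show ?thesis by (simp only: heat_energy_def)
    qed
    also have "\<dots> \<le> ennreal N * (\<Sum>bs\<in>?B. ennreal (C bs) * epowr (besov_seminorm s p f) p)"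
      by (intro mult_left_mono sum_mono WC(4)[OF _ f v]) auto
    also have "\<dots> = ennreal (N * (\<Sum>bs\<in>?B. C bs)) * epowr (besov_seminorm s p f) p"
    proof -
      have "(\<Sum>bs\<in>?B. ennreal (C bs)) = ennreal (\<Sum>bs\<in>?B. C bs)" using WC(2) by (rule sum_ennreal)
      then show ?thesis using N C_sum by (simp only: sum_distrib_right[symmetric] ennreal_mult mult.assoc)
    qed
    also have "\<dots> \<le> ennreal K * epowr (besov_seminorm s p f) p"
      by (intro mult_right_mono ennreal_leI) (auto simp: K_def)
    finally show "(\<integral>\<^sup>+z\<in>half_space. ennreal (snd z powr a * grad_norm (m + 1) (gauss_ext f) z powr p) \<partial>lebesgue)
      \<le> ennreal K * epowr (besov_seminorm s p f) p" .
  qed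
  show ?thesis
    unfolding s_def[symmetric] using K main by blast
qed

end
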